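(* Let $\Omega\subseteq\mathbb{R}^n$ be open, $\mathbf{C}\subset\Omega$ a closed target with compact boundary, $U=\mathbb{R}^m$, and $d\ge1$ an integer. Let $f_0$ and $f_{\alpha}=f_{\alpha_1,\dots,\alpha_m}$ ($\alpha\in\mathbb{N}^m$, $1\le\alpha_1+\dots+\alpha_m\le d$) be continuous vector fields on $\Omega$ with values in $\mathbb{R}^n$, and set $$f(x,u):=f_0(x)+\sum_{i=1}^d\ \sum_{\alpha\in\mathbb{N}^m,\ \alpha_1+\dots+\alpha_m=i}u_1^{\alpha_1}\cdots u_m^{\alpha_m}f_{\alpha_1,\dots,\alpha_m}(x),$$ $$f^{max}(x,u):=f_0(x)+\sum_{\alpha\in\mathbb{N}^m,\ \alpha_1+\dots+\alpha_m=d}u_1^{\alpha_1}\cdots u_m^{\alpha_m}f_{\alpha_1,\dots,\alpha_m}(x).$$ Assume that the running cost has the form $l(x,u)=M_0(x)+M_1(x,u)$, where $M_0,M_1$ are non-negative continuous functions such that $$M_1(x,0)=0,\qquad M_1(x,ku)\le k^dM_1(x,u)\qquad\forall k\ge1,\ x\in\Omega\setminus\mathbf{C},\ u\in\mathbb{R}^m.$$ Let $p_0\ge0$ and let $W$ be a $p_0$-Minimum Restraint Function for the maximal degree problem $(l,f^{max},\mathbf{C})$ in $\Omega$. Then $W$ is a $p_0$-Minimum Restraint Function for the original problem $(l,f,\mathbf{C})$ in $\Omega$. In particular, the control system $\dot x=f(x,u)$, $x(0)=z$, is globally asymptotically controllable to $\mathbf{C}$ and, if $p_0>0$, $$V(z)\le\frac{W(z)}{p_0}\qquad\forall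 z\in\Omega\setminus\mathbf{C}.$$
   Context: Write $\mathbf{d}(x)$ for the Euclidean distance of $x$ from $\mathbf{C}$; $k$ ranges over real numbers $\ge1$. Admissible pairs: for $z\in\Omega\setminus\mathbf{C}$, $\mathcal{A}_f(z)$ is the set of pairs $(x,u)$ for which there is $T_x\in\,]0,+\infty]$ (the exit time) such that $x:[0,T_x[\to\Omega\setminus\mathbf{C}$ is locally absolutely continuous, $\lim_{t\to T_x^-}\mathbf{d}(x(t))=0$, $u\in L^\infty_{loc}([0,T_x[,U)$, and $x$ is a Carathéodory solution of $\dot x=f(x,u)$, $x(0)=z$ (solutions need not be unique). Value function: $V(z):=\inf_{(x,u)\in\mathcal{A}_f(z)}\int_0^{T_x}l(x(t),u(t))\,dt\in[0,+\infty]$. Global asymptotic controllability (GAC) to $\mathbf{C}$: there is $\beta\in\mathcal{KL}$ such that for each $z\in\Omega\setminus\mathbf{C}$ there is $(x,u)\in\mathcal{A}_f(z)$ with $\mathbf{d}(x(t))\le\beta(\mathbf{d}(z),t)$ for all $t\in[0,+\infty[$; by convention, if $T_x<+\infty$, $x$ is prolonged by $x(t)=\bar z$ for $t\ge T_x$, where $\bar z\in\partial\mathbf{C}$ is a fixed arbitrary point. Here $\mathcal{KL}$ is the set of continuous $\beta:[0,+\infty[\times[0,+\infty[\to[0,+\infty[$ such that $\beta(0,t)=0$ and $\beta(\cdot,t)$ is strictly increasing and unbounded for each $t\ge0$; $\beta(r,\cdot)$ is decreasing for each $r\ge0$; and $\beta(r,t)\to0$ as $t\to+\infty$ for each $r\ge0$.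 For a dynamics $g:\Omega\times U\to\mathbb{R}^n$ the Hamiltonian is $H_{l,g}(x,p_0,p):=\inf_{u\in U}\{\langle p,g(x,u)\rangle+p_0\,l(x,u)\}\in[-\infty,+\infty[$. Limiting gradients: for a locally Lipschitz $F$ on an open set, $D^*F(x)$ is the set of all limits $\lim_k\nabla F(x_k)$ with $x_k\to x$, $x_k\ne x$, $F$ differentiable at $x_k$. $p_0$-Minimum Restraint Function ($p_0$-MRF) for $(l,g,\mathbf{C})$ in $\Omega$: a continuous $W:\Omega\setminus\overset{\circ}{\mathbf{C}}\to[0,+\infty[$ such that (1) $W$ is locally semiconcave on $\Omega\setminus\mathbf{C}$: for every compact $\mathcal{K}\subset\Omega\setminus\mathbf{C}$ there is $\rho>0$ with $W(z_1)+W(z_2)-2W(\frac{z_1+z_2}{2})\le\rho|z_1-z_2|^2$ whenever the segment $[z_1,z_2]\subseteq\mathcal{K}$ (in particular $W$ is locally Lipschitz there); (2) $W$ is positive definite: $W>0$ on $\Omega\setminus\mathbf{C}$ and $W=0$ on $\partial\mathbf{C}$; (3) $W$ is proper: $W^{-1}(K)$ is compact for every compact $K\subset[0,+\infty)$; (4) $H_{l,g}(x,p_0,p)<0$ for all $x\in\Omega\setminus\mathbf{C}$ and all $p\in D^*W(x)$ (the value $-\infty$ is allowed); (5) there is $W_0\in[0,+\infty]$ such that $W(x)<W_0$ for all $x\in\Omega\setminus\mathbf{C}$ and $\lim_{x\to x_0,\,x\in\Omega}W(x)=W_0$ for every $x_0\in\partial\Omega$.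
   Formalization: Global asymptotic controllability is false as stated for Ω ≠ ℝⁿ (Ω=]-1,1[, C={0}, f=-x(1-x²), l=0, W=x²/(1-x²)); it is proved for Ω=ℝⁿ and, for general Ω, with β uniform over initial states in any subset Z of Ω closed in ℝⁿ. C is taken nonempty. *)

theory Defs
  imports "HOL-Analysis.Analysis"
begin

section \<open>Polynomial control systems\<close>

definition mdegree :: "nat ^ 'm \<Rightarrow> nat" where
  "mdegree \<alpha> = (\<Sum>j\<in>UNIV. \<alpha> $ j)"

definition mpower :: "real ^ 'm \<Rightarrow> nat ^ 'm \<Rightarrow> real" where
  "mpower u \<alpha> = (\<Prod>j\<in>UNIV. (u $ j) ^ (\<alpha> $ j))"

text \<open>This keeps the sums over multi-indices below from collapsing to 0.\<close>

lemma finite_mdegree: "finite {\<alpha> :: nat ^ 'm. mdegree \<alpha> = i}"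
proof -
  have "\<alpha> $ j \<le> i" if "mdegree \<alpha> = i" for \<alpha> :: "nat ^ 'm" and j
    using that member_le_sum[of j UNIV "\<lambda>j. \<alpha> $ j"] by (simp add: mdegree_def)
  then have "{\<alpha> :: nat ^ 'm. mdegree \<alpha> = i} \<subseteq> vec_lambda ` (UNIV \<rightarrow>\<^sub>E {..i})"
    by (force intro!: image_eqI[where x = "vec_nth _"] simp: PiE_def vec_nth_inverse)
  then show ?thesis
    by (rule finite_subset) (intro finite_imageI finite_PiE; simp)
qed

definition poly_dynamics ::
  "nat \<Rightarrow> ('a::real_vector \<Rightarrow> 'a) \<Rightarrow> (nat ^ 'm \<Rightarrow> 'a \<Rightarrow> 'a) \<Rightarrow> 'a \<Rightarrow> real ^ 'm \<Rightarrow> 'a" where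
  "poly_dynamics d f\<^sub>0 F x u =
     f\<^sub>0 x + (\<Sum>i=1..d. \<Sum>\<alpha> | mdegree \<alpha> = i. mpower u \<alpha> *\<^sub>R F \<alpha> x)"

definition max_degree_dynamics ::
  "nat \<Rightarrow> ('a::real_vector \<Rightarrow> 'a) \<Rightarrow> (nat ^ 'm \<Rightarrow> 'a \<Rightarrow> 'a) \<Rightarrow> 'a \<Rightarrow> real ^ 'm \<Rightarrow> 'a" where
  "max_degree_dynamics d f\<^sub>0 F x u =
     f\<^sub>0 x + (\<Sum>\<alpha> | mdegree \<alpha> = d. mpower u \<alpha> *\<^sub>R F \<alpha> x)"


section \<open>Admissible pairs and the value function\<close>

definition abs_continuous_on_Icc ::
  "real \<Rightarrow> real \<Rightarrow> (real \<Rightarrow> 'a::real_normed_vector) \<Rightarrow> bool" where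
  "abs_continuous_on_Icc a b x \<longleftrightarrow>
     (\<forall>\<epsilon>>0. \<exists>\<delta>>0. \<forall>(N::nat) s t.
        (\<forall>i<N. a \<le> s i \<and> s i \<le> t i \<and> t i \<le> b) \<longrightarrow>
        disjoint_family_on (\<lambda>i. {s i<..<t i}) {..<N} \<longrightarrow>
        (\<Sum>i<N. t i - s i) < \<delta> \<longrightarrow>
        (\<Sum>i<N. norm (x (t i) - x (s i))) < \<epsilon>)"

definition time_interval :: "ereal \<Rightarrow> real set" where
  "time_interval T = {t. 0 \<le> t \<and> ereal t < T}"

definition to_left :: "ereal \<Rightarrow> real filter" where
  "to_left T = (if T = \<infinity> then at_top else at_left (real_of_ereal T))"

definition carath_solution ::
  "('a::euclidean_space \<Rightarrow> 'b::euclidean_space \<Rightarrow> 'a) \<Rightarrow> ereal \<Rightarrow> (real \<Rightarrow> 'a) \<Rightarrow> (real \<Rightarrow> 'b) \<Rightarrow> 'a \<Rightarrow> bool"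
where
  "carath_solution f T x u z \<longleftrightarrow>
     x 0 = z \<and>
     (\<forall>b\<in>time_interval T. abs_continuous_on_Icc 0 b x) \<and>
     (AE t in lebesgue. t \<in> time_interval T \<longrightarrow>
        (x has_vector_derivative f (x t) (u t)) (at t within time_interval T))"

text \<open>Controls in \<open>L\<^sup>\<infinity>\<^sub>l\<^sub>o\<^sub>c([0,T[, U)\<close>, where "locally" refers to the compact
  subintervals of \<open>[0,T[\<close>: blow-up is only possible as \<open>t\<close> tends to \<open>T\<close>.\<close>

definition Linf_loc :: "ereal \<Rightarrow> 'b::euclidean_space set \<Rightarrow> (real \<Rightarrow> 'b) \<Rightarrow> bool" where
  "Linf_loc T U u \<longleftrightarrow>
     (\<forall>t\<in>time_interval T. u t \<in> U) \<and>
     (\<forall>b\<in>time_interval T.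
        u \<in> borel_measurable (lebesgue_on {0..b}) \<and>
        (\<exists>B. AE t in lebesgue_on {0..b}. norm (u t) \<le> B))"

text \<open>Functions being total here, the exit time (the right end of the domain of \<open>x\<close>) is
  carried along explicitly; the values of \<open>x\<close> and \<open>u\<close> outside \<open>[0,T[\<close> are irrelevant.\<close>

definition admissible ::
  "('a::euclidean_space \<Rightarrow> 'b::euclidean_space \<Rightarrow> 'a) \<Rightarrow> 'b set \<Rightarrow> 'a set \<Rightarrow> 'a set \<Rightarrow> 'a
    \<Rightarrow> (ereal \<times> (real \<Rightarrow> 'a) \<times> (real \<Rightarrow> 'b)) set" where
  "admissible f U C \<Omega> z =
     {(T, x, u). 0 < T \<and>
        (\<forall>t\<in>time_interval T. x t \<in> \<Omega> - C) \<and>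
        ((\<lambda>t. infdist (x t) C) \<longlongrightarrow> 0) (to_left T) \<and>
        Linf_loc T U u \<and>
        carath_solution f T x u z}"

definition value_function ::
  "('a::euclidean_space \<Rightarrow> 'b::euclidean_space \<Rightarrow> real) \<Rightarrow> ('a \<Rightarrow> 'b \<Rightarrow> 'a) \<Rightarrow> 'b set \<Rightarrow> 'a set \<Rightarrow> 'a set
    \<Rightarrow> 'a \<Rightarrow> ennreal" where
  "value_function l f U C \<Omega> z =
     (INF (T, x, u) \<in> admissible f U C \<Omega> z.
        \<integral>\<^sup>+ t \<in> time_interval T. ennreal (l (x t) (u t)) \<partial>lebesgue)"


section \<open>Asymptotic controllability\<close>

definition class_KL :: "(real \<Rightarrow> real \<Rightarrow> real) set" where
  "class_KL = {\<beta>.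
     continuous_on ({0..} \<times> {0..}) (\<lambda>(r, t). \<beta> r t) \<and>
     (\<forall>r\<ge>0. \<forall>t\<ge>0. 0 \<le> \<beta> r t) \<and>
     (\<forall>t\<ge>0. \<beta> 0 t = 0 \<and> strict_mono_on {0..} (\<lambda>r. \<beta> r t) \<and> (\<forall>B. \<exists>r\<ge>0. B < \<beta> r t)) \<and>
     (\<forall>r\<ge>0. antimono_on {0..} (\<beta> r) \<and> (\<beta> r \<longlongrightarrow> 0) at_top)}"

text \<open>\<open>zb\<close> is the conventional value taken by a trajectory from its exit time on.\<close>

definition prolong :: "'a \<Rightarrow> ereal \<Rightarrow> (real \<Rightarrow> 'a) \<Rightarrow> real \<Rightarrow> 'a" where
  "prolong zb T x t = (if ereal t < T then x t else zb)"

definition asymp_controllable_from ::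
  "'a set \<Rightarrow> ('a::euclidean_space \<Rightarrow> 'b::euclidean_space \<Rightarrow> 'a) \<Rightarrow> 'b set \<Rightarrow> 'a set \<Rightarrow> 'a set \<Rightarrow> bool"
where
  "asymp_controllable_from Z f U C \<Omega> \<longleftrightarrow>
     (\<forall>zb\<in>frontier C. \<exists>\<beta>\<in>class_KL. \<forall>z\<in>Z - C. \<exists>(T, x, u)\<in>admissible f U C \<Omega> z.
        \<forall>t\<ge>0. infdist (prolong zb T x t) C \<le> \<beta> (infdist z C) t)"

text \<open>Global asymptotic controllability allows every initial state in \<open>\<Omega> - C\<close>.  When
  \<open>\<Omega>\<close> is not the whole space, this uniform bound is not implied by the existence of a
  minimum restraint function: let \<open>\<Omega> = ]-1,1[\<close>, \<open>C = {0}\<close>, \<open>l = 0\<close>, \<open>f(x,u) = -x(1-x\<^sup>2)\<close> and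
  \<open>W(x) = x\<^sup>2/(1-x\<^sup>2)\<close>.  The solution from \<open>z\<close> satisfies, for each fixed \<open>t\<close>, \<open>x(t) \<rightarrow> 1\<close> as
  \<open>z \<rightarrow> 1\<close>, which forces \<open>\<beta>(1,t) \<ge> 1\<close> for all \<open>t\<close>.  The bound is then available for
  initial states in a subset \<open>Z\<close> of \<open>\<Omega>\<close> that is closed in the whole space, with \<open>\<beta>\<close>
  depending on \<open>Z\<close>; \<open>Z = \<Omega>\<close> is one of these sets exactly when \<open>\<Omega>\<close> is the whole space
  (or empty).\<close>

definition globally_asymp_controllable ::
  "('a::euclidean_space \<Rightarrow> 'b::euclidean_space \<Rightarrow> 'a) \<Rightarrow> 'b set \<Rightarrow> 'a set \<Rightarrow> 'a set \<Rightarrow> bool" where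
  "globally_asymp_controllable f U C \<Omega> \<longleftrightarrow> asymp_controllable_from \<Omega> f U C \<Omega>"


section \<open>Minimum restraint functions\<close>

definition hamiltonian ::
  "'b set \<Rightarrow> ('a::euclidean_space \<Rightarrow> 'b \<Rightarrow> real) \<Rightarrow> ('a \<Rightarrow> 'b \<Rightarrow> 'a) \<Rightarrow> 'a \<Rightarrow> real \<Rightarrow> 'a \<Rightarrow> ereal" where
  "hamiltonian U l g x p\<^sub>0 p = (INF u\<in>U. ereal (p \<bullet> g x u + p\<^sub>0 * l x u))"

text \<open>\<open>D\<^sup>*F(x)\<close> for \<open>F\<close> given on the open set \<open>S\<close>.\<close>

definition limiting_gradients :: "'a::euclidean_space set \<Rightarrow> ('a \<Rightarrow> real) \<Rightarrow> 'a \<Rightarrow> 'a set" where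
  "limiting_gradients S F x =
     {p. \<exists>y q. (\<forall>k::nat. y k \<in> S \<and> y k \<noteq> x \<and> GDERIV F (y k) :> q k) \<and>
               y \<longlonglongrightarrow> x \<and> q \<longlonglongrightarrow> p}"

definition locally_semiconcave_on :: "'a::euclidean_space set \<Rightarrow> ('a \<Rightarrow> real) \<Rightarrow> bool" where
  "locally_semiconcave_on S W \<longleftrightarrow>
     (\<forall>K. compact K \<and> K \<subseteq> S \<longrightarrow>
        (\<exists>\<rho>>0. \<forall>z1 z2. closed_segment z1 z2 \<subseteq> K \<longrightarrow>
           W z1 + W z2 - 2 * W (midpoint z1 z2) \<le> \<rho> * (norm (z1 - z2))\<^sup>2))"

definition min_restraint_function ::
  "real \<Rightarrow> 'b set \<Rightarrow> ('a::euclidean_space \<Rightarrow> 'b \<Rightarrow> real) \<Rightarrow> ('a \<Rightarrow> 'b \<Rightarrow> 'a) \<Rightarrow> 'a set \<Rightarrow> 'a set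
    \<Rightarrow> ('a \<Rightarrow> real) \<Rightarrow> bool" where
  "min_restraint_function p\<^sub>0 U l g C \<Omega> W \<longleftrightarrow>
     continuous_on (\<Omega> - interior C) W \<and>
     (\<forall>x\<in>\<Omega> - interior C. 0 \<le> W x) \<and>
     locally_semiconcave_on (\<Omega> - C) W \<and>
     (\<forall>x\<in>\<Omega> - C. 0 < W x) \<and> (\<forall>x\<in>frontier C. W x = 0) \<and>
     (\<forall>K. compact K \<and> K \<subseteq> {0..} \<longrightarrow> compact {x \<in> \<Omega> - interior C. W x \<in> K}) \<and>
     (\<forall>x\<in>\<Omega> - C. \<forall>p\<in>limiting_gradients (\<Omega> - C) W x. hamiltonian U l g x p\<^sub>0 p < 0) \<and>
     (\<exists>W\<^sub>0::ereal. 0 \<le> W\<^sub>0 \<and>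
        (\<forall>x\<in>\<Omega> - C. ereal (W x) < W\<^sub>0) \<and>
        (\<forall>x\<^sub>0\<in>frontier \<Omega>. ((\<lambda>x. ereal (W x)) \<longlongrightarrow> W\<^sub>0) (at x\<^sub>0 within \<Omega>)))"

end

theory Submission
  imports Defs "HOL-Complex_Analysis.Great_Picard"
begin

text \<open>If \<open>p \<bullet> f\<^sup>m\<^sup>a\<^sup>x + p\<^sub>0 l\<close> is negative for some control \<open>u\<close>, then either its part of degree \<open>d\<close> in
  \<open>u\<close> is negative, and replacing \<open>u\<close> by \<open>k u\<close> with \<open>k\<close> large makes the lower-order terms of \<open>f\<close>
  negligible, or its part of degree 0 is negative and the control 0 will do.  So \<open>W\<close> is a minimum
  restraint function for \<open>f\<close>.

  At a point \<open>x\<close> choose a limiting gradient \<open>p\<close>.  Semiconcavity bounds \<open>W\<close> near \<open>x\<close> from above by a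
  parabola with slope \<open>p\<close>, so along any (Peano) solution for a constant control that makes the
  Hamiltonian negative, \<open>W\<close> plus \<open>p\<^sub>0\<close> times the accumulated cost decreases for a short time.  The
  graph of the limiting gradients is closed and locally bounded, hence step length and decay rate are
  uniform on each compact band \<open>a \<le> W \<le> b\<close>, \<open>a > 0\<close>.  Concatenating such steps drives \<open>W\<close> to 0,
  uniformly in the initial level; the cost telescopes to at most \<open>W z / p\<^sub>0\<close>.  Properness of \<open>W\<close>
  and compactness of the boundary of the target convert this into distance estimates, and these
  admit a \<open>KL\<close> majorant.\<close>

section \<open>Peano existence\<close>

text \<open>Two obstacles shape the construction. The control space is unbounded, so the infimum in
  the Hamiltonian need not be attained and may be minus infinity; only the strict inequality,
  carried through a limit of points and gradients, gives a common bound for the controls and a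
  common margin on a band. Both may degenerate as \<open>W\<close> tends to 0: steps may shrink,
  nodes may accumulate at a finite time, and controls may blow up there. Hence every concatenation
  has infinitely many pieces, and its exit time is a supremum in \<open>ereal\<close> that covers
  the finite and the infinite case at once. The dynamics is merely continuous in the state, so
  solutions need not be unique and no feedback law is integrated. One gradient and one control value
  are frozen per step, chosen from the starting point of the step alone. Since only countably many
  points are used on a trajectory, this choice may depend on the point in any manner, and the
  resulting control is still measurable.\<close>

text \<open>Tonelli's scheme: with the delay \<open>h = \<delta> / n\<close> the integral equation determines its solution
  on \<open>[0, \<delta>]\<close> explicitly, and the iteration below reaches it after \<open>n\<close> steps.\<close>

primrec delayed_iterate :: "('a::euclidean_space \<Rightarrow> 'a) \<Rightarrow> 'a \<Rightarrow> real \<Rightarrow> nat \<Rightarrow> real \<Rightarrow> 'a" where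
  "delayed_iterate g x0 h 0 = (\<lambda>t. x0)"
| "delayed_iterate g x0 h (Suc j) = (\<lambda>t. x0 + integral {0..t - h} (\<lambda>s. g (delayed_iterate g x0 h j s)))"

lemma norm_integral_Icc_le:
  fixes f :: "real \<Rightarrow> 'a::euclidean_space"
  assumes "continuous_on {a..b} f" "\<And>s. s \<in> {a..b} \<Longrightarrow> norm (f s) \<le> m" "a \<le> b"
  shows "norm (integral {a..b} f) \<le> m * (b - a)"
  using assms integral_bound[of a b f m] by auto

text \<open>For \<open>t < h\<close> the interval \<open>{0..t - h}\<close> is empty and its
  integral is 0, so the delayed integral stays constant up to time \<open>h\<close>. The estimate
  therefore holds for all real \<open>s\<close> and \<open>t\<close>, and the cases follow the signs
  of \<open>s - h\<close> and \<open>t - h\<close>.\<close>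

lemma norm_diff_integral_shifted:
  fixes f :: "real \<Rightarrow> 'a::euclidean_space"
  assumes f: "continuous_on UNIV f" "\<And>s. norm (f s) \<le> m" and "s \<le> t" "0 \<le> h" "0 \<le> m"
  shows "norm (integral {0..t - h} f - integral {0..s - h} f) \<le> m * (t - s)"
proof (cases "0 \<le> s - h")
  case True
  have "integral {0..s - h} f + integral {s - h..t - h} f = integral {0..t - h} f"
    using True assms
    by (intro Henstock_Kurzweil_Integration.integral_combine integrable_continuous_real continuous_on_subset[OF f(1)]) auto
  then have "integral {0..t - h} f - integral {0..s - h} f = integral {s - h..t - h} f"
    by (simp add: algebra_simps)
  then show ?thesis
    using norm_integral_Icc_le[of "s - h" "t - h" f m] assms continuous_on_subset[OF f(1)] by auto
next
  case False
  then have [simp]: "{0..s - h} = {}" by auto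
  show ?thesis
  proof (cases "0 \<le> t - h")
    case True
    have "norm (integral {0..t - h} f) \<le> m * (t - h - 0)"
      using True assms continuous_on_subset[OF f(1)] by (intro norm_integral_Icc_le) auto
    also have "\<dots> \<le> m * (t - s)"
      using False assms by (intro mult_left_mono) auto
    finally show ?thesis by simp
  next
    case False
    then have [simp]: "{0..t - h} = {}" by auto
    show ?thesis using assms by auto
  qed
qed

text \<open>The constant depends neither on the delay nor on the number of iterations; this is the
  equicontinuity that Arzela-Ascoli requires.\<close>

lemma delayed_iterate_lipschitz:
  assumes g: "continuous_on UNIV g" "\<And>x. norm (g x) \<le> m" and "0 \<le> h"
  shows "m-lipschitz_on UNIV (delayed_iterate g x0 h j)"
proof -
  have m: "0 \<le> m" using g(2)[of x0] norm_ge_zero order_trans by blast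
  show ?thesis
  proof (induction j)
    case 0
    then show ?case using m by (simp add: lipschitz_on_def)
  next
    case (Suc j)
    let ?f = "\<lambda>s. g (delayed_iterate g x0 h j s)"
    have c: "continuous_on UNIV ?f"
      by (rule continuous_on_compose2[OF g(1) lipschitz_on_continuous_on[OF Suc]]) auto
    have b: "norm (integral {0..t - h} ?f - integral {0..s - h} ?f) \<le> m * (t - s)" if "s \<le> t" for s t
      using norm_diff_integral_shifted[OF c] g(2) that \<open>0 \<le> h\<close> m by auto
    show ?case
    proof (rule lipschitz_onI[OF _ m])
      fix s t :: real
      show "dist (delayed_iterate g x0 h (Suc j) s) (delayed_iterate g x0 h (Suc j) t) \<le> m * dist s t"
        using b[of s t] b[of t s] by (cases "s \<le> t") (auto simp: dist_norm norm_minus_commute)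
    qed
  qed
qed

text \<open>At time \<open>t\<close> an iterate reads its predecessor only up to
  \<open>t - h\<close>, so each iteration fixes the values on one more interval of length
  \<open>h\<close>. In the base case \<open>t <= 0\<close> and the integral is over the empty
  set.\<close>

lemma delayed_iterate_stable:
  assumes "0 < h" "t \<le> real j * h"
  shows "delayed_iterate g x0 h (Suc j) t = delayed_iterate g x0 h j t"
  using assms(2)
proof (induction j arbitrary: t)
  case 0
  then have "{0..t - h} = {}" using assms(1) by auto
  then show ?case by simp
next
  case (Suc j)
  have "delayed_iterate g x0 h (Suc j) s = delayed_iterate g x0 h j s" if "s \<in> {0..t - h}" for s
    using that Suc.prems by (intro Suc.IH) (auto simp: algebra_simps)
  then have "integral {0..t - h} (\<lambda>s. g (delayed_iterate g x0 h (Suc j) s)) =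
      integral {0..t - h} (\<lambda>s. g (delayed_iterate g x0 h j s))"
    by (intro Henstock_Kurzweil_Integration.integral_cong) metis
  then show ?case by (subst (1 2) delayed_iterate.simps(2)) simp
qed

lemma peano_bounded:
  fixes g :: "'a::euclidean_space \<Rightarrow> 'a"
  assumes g: "continuous_on UNIV g" "\<And>x. norm (g x) \<le> m" and d: "0 < \<delta>"
  shows "\<exists>y. y 0 = x0 \<and> (\<forall>t\<in>{0..\<delta>}. (y has_vector_derivative g (y t)) (at t within {0..\<delta>}))"
proof -
  \<comment> \<open>With this delay \<open>real (Suc n) * h n = \<delta>\<close>, so
    \<open>Suc n\<close> iterations solve the delayed equation on all of
    \<open>[0, \<delta>]\<close>.\<close>
  define h where "h n = \<delta> / real (Suc n)" for n
  define X where "X n = delayed_iterate g x0 (h n) (Suc n)" for n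
  have h: "0 < h n" for n using d by (simp add: h_def)
  have m: "0 \<le> m" using g(2)[of x0] norm_ge_zero order_trans by blast
  have lip: "m-lipschitz_on UNIV (X n)" for n
    unfolding X_def by (rule delayed_iterate_lipschitz[OF g]) (use h[of n] in simp)
  have gX: "continuous_on A (\<lambda>s. g (X n s))" for n A
    by (rule continuous_on_compose2[OF g(1) continuous_on_subset[OF lipschitz_on_continuous_on[OF lip]]]) auto
  have eq: "X n t = x0 + integral {0..t - h n} (\<lambda>s. g (X n s))" if "t \<le> \<delta>" for n t
  proof -
    have "delayed_iterate g x0 (h n) (Suc (Suc n)) t = X n t"
      unfolding X_def using that by (intro delayed_iterate_stable h) (simp add: h_def)
    then show ?thesis by (simp add: X_def)
  qed
  have X0: "X n 0 = x0" for n using eq[of 0 n] h[of n] d by simp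
  have bd: "norm (X n t) \<le> norm x0 + m * \<delta>" if "t \<in> {0..\<delta>}" for n t
  proof -
    have "norm (X n t - x0) \<le> m * \<bar>t\<bar>"
      using lipschitz_onD[OF lip[of n], of t 0] X0 by (simp add: dist_norm)
    also have "\<dots> \<le> m * \<delta>" using that m by (intro mult_left_mono) auto
    finally show ?thesis using norm_triangle_ineq2[of "X n t" x0] by linarith
  qed
  obtain y k where y: "continuous_on {0..\<delta>} y" and k: "strict_mono (k::nat \<Rightarrow> nat)"
    and lim: "\<And>e. 0 < e \<Longrightarrow> \<exists>N. \<forall>n x. n \<ge> N \<and> x \<in> {0..\<delta>} \<longrightarrow> norm (X (k n) x - y x) < e"
  proof (rule Arzela_Ascoli[of "{0..\<delta>}" X "norm x0 + m * \<delta>"])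
    fix t e :: real assume "t \<in> {0..\<delta>}" "0 < e"
    have "norm (X n t - X n s) < e" if "norm (t - s) < e / (m + 1)" for n s
    proof -
      have "norm (X n t - X n s) \<le> m * norm (t - s)"
        using lipschitz_onD[OF lip[of n], of t s] by (simp add: dist_norm)
      also have "\<dots> \<le> (m + 1) * norm (t - s)" by (intro mult_right_mono) auto
      also have "\<dots> < e" using that m by (simp add: field_simps)
      finally show ?thesis .
    qed
    then show "\<exists>d>0. \<forall>n y. y \<in> {0..\<delta>} \<and> norm (t - y) < d \<longrightarrow> norm (X n t - X n y) < e"
      using \<open>0 < e\<close> m by (intro exI[of _ "e / (m + 1)"]) auto
  qed (use bd in auto)
  have lim': "(\<lambda>n. X (k n) t) \<longlonglongrightarrow> y t" if "t \<in> {0..\<delta>}" for t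
    unfolding LIMSEQ_def dist_norm using lim that by blast
  have yint: "y t = x0 + integral {0..t} (\<lambda>s. g (y s))" if t: "t \<in> {0..\<delta>}" for t
  proof -
    have "(\<lambda>n. integral {0..t} (\<lambda>s. g (X (k n) s))) \<longlonglongrightarrow> integral {0..t} (\<lambda>s. g (y s))"
    proof (rule dominated_convergence(2)[where h = "\<lambda>_. m"])
      show "(\<lambda>n. g (X (k n) s)) \<longlonglongrightarrow> g (y s)" if "s \<in> {0..t}" for s
        using continuous_on_tendsto_compose[OF g(1) lim'] that t by auto
    qed (use g(2) gX in \<open>auto intro!: integrable_continuous_real\<close>)
    moreover have "(\<lambda>n. X (k n) t - integral {0..t} (\<lambda>s. g (X (k n) s))) \<longlonglongrightarrow> x0"
    proof (rule LIM_zero_cancel, rule Lim_null_comparison)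
      show "\<forall>\<^sub>F n in sequentially.
          norm (X (k n) t - integral {0..t} (\<lambda>s. g (X (k n) s)) - x0) \<le> m * h (k n)"
      proof (rule always_eventually, rule allI)
        fix n
        \<comment> \<open>The upper limit \<open>t\<close> is written
          \<open>t + h (k n) - h (k n)\<close> so that both integrals are shifted by the same delay:
          cutting off a piece of length \<open>h (k n)\<close> costs at most
          \<open>m * h (k n)\<close>.\<close>
        have "norm (integral {0..t + h (k n) - h (k n)} (\<lambda>s. g (X (k n) s)) -
            integral {0..t - h (k n)} (\<lambda>s. g (X (k n) s))) \<le> m * (t + h (k n) - t)"
          using g(2) gX h[of "k n"] m by (intro norm_diff_integral_shifted) auto
        moreover have "X (k n) t = x0 + integral {0..t - h (k n)} (\<lambda>s. g (X (k n) s))"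
          using t by (intro eq) auto
        ultimately show "norm (X (k n) t - integral {0..t} (\<lambda>s. g (X (k n) s)) - x0) \<le> m * h (k n)"
          by (simp add: norm_minus_commute)
      qed
      have "h \<longlonglongrightarrow> 0" unfolding h_def
        using tendsto_mult[OF tendsto_const[of \<delta>] LIMSEQ_Suc[OF lim_inverse_n]] by (simp add: field_simps)
      from LIMSEQ_subseq_LIMSEQ[OF this k] show "(\<lambda>n. m * h (k n)) \<longlonglongrightarrow> 0"
        by (auto intro!: tendsto_mult_right_zero simp: o_def)
    qed
    ultimately have "(\<lambda>n. X (k n) t) \<longlonglongrightarrow> x0 + integral {0..t} (\<lambda>s. g (y s))"
      using tendsto_add by fastforce
    with lim'[OF t] show ?thesis using LIMSEQ_unique by blast
  qed
  have gy: "continuous_on {0..\<delta>} (\<lambda>s. g (y s))"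
    by (rule continuous_on_compose2[OF g(1) y]) auto
  have "(y has_vector_derivative g (y t)) (at t within {0..\<delta>})" if t: "t \<in> {0..\<delta>}" for t
  proof (rule has_vector_derivative_transform[OF t])
    show "((\<lambda>t. x0 + integral {0..t} (\<lambda>s. g (y s))) has_vector_derivative g (y t)) (at t within {0..\<delta>})"
      using has_vector_derivative_add[OF has_vector_derivative_const integral_has_vector_derivative[OF gy t]]
      by simp
  qed (use yint in auto)
  moreover have "y 0 = x0" using yint[of 0] d by simp
  ultimately show ?thesis by blast
qed

text \<open>Composing with the projection onto the ball extends \<open>g\<close> to a bounded
  continuous field on the whole space. As \<open>m * \<delta> <= r\<close>, its solution cannot
  leave the ball, where the projection is the identity.\<close>

lemma peano_cball:
  fixes g :: "'a::euclidean_space \<Rightarrow> 'a"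
  assumes g: "continuous_on (cball x0 r) g" "\<And>x. x \<in> cball x0 r \<Longrightarrow> norm (g x) \<le> m"
    and d: "0 < \<delta>" "m * \<delta> \<le> r" and r: "0 \<le> r"
  obtains y where "y 0 = x0"
    "\<And>t. t \<in> {0..\<delta>} \<Longrightarrow> norm (y t - x0) \<le> m * t"
    "\<And>t. t \<in> {0..\<delta>} \<Longrightarrow> (y has_vector_derivative g (y t)) (at t within {0..\<delta>})"
proof -
  let ?c = "closest_point (cball x0 r)"
  have c: "?c x \<in> cball x0 r" for x
    using closest_point_in_set[of "cball x0 r"] r by force
  have "continuous_on UNIV ?c"
    using continuous_on_closest_point[of "cball x0 r" UNIV] r by force
  then have "continuous_on UNIV (g \<circ> ?c)"
    using c by (intro continuous_on_compose continuous_on_subset[OF g(1)]) auto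
  moreover have "norm ((g \<circ> ?c) x) \<le> m" for x using g(2) c by auto
  ultimately obtain y where y: "y 0 = x0"
    "\<And>t. t \<in> {0..\<delta>} \<Longrightarrow> (y has_vector_derivative (g \<circ> ?c) (y t)) (at t within {0..\<delta>})"
    using peano_bounded[of "g \<circ> ?c" m \<delta> x0] d by blast
  have bd: "norm (y t - x0) \<le> m * t" if t: "t \<in> {0..\<delta>}" for t
  proof -
    have "norm (y t - y 0) \<le> m * norm (t - 0)"
    proof (rule differentiable_bound[where f' = "\<lambda>s v. v *\<^sub>R (g \<circ> ?c) (y s)" and S = "{0..\<delta>}"])
      show "onorm (\<lambda>v. v *\<^sub>R (g \<circ> ?c) (y s)) \<le> m" for s
      proof (rule onorm_le)
        fix v :: real
        show "norm (v *\<^sub>R (g \<circ> ?c) (y s)) \<le> m * norm v"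
          using mult_left_mono[OF g(2)[OF c[of "y s"]], of "norm v"] by (simp add: mult.commute)
      qed
    qed (use t y(2) in \<open>auto simp: has_vector_derivative_def\<close>)
    then show ?thesis using t y(1) by simp
  qed
  show thesis
  proof (rule that[of y])
    fix t assume t: "t \<in> {0..\<delta>}"
    have m: "0 \<le> m" using order_trans[OF norm_ge_zero g(2)[of x0]] r by simp
    have "norm (y t - x0) \<le> r"
      using bd[OF t] mult_left_mono[of t \<delta> m] t m d by auto
    then have "?c (y t) = y t"
      by (intro closest_point_self) (simp add: dist_norm norm_minus_commute)
    then show "(y has_vector_derivative g (y t)) (at t within {0..\<delta>})" using y(2)[OF t] by simp
  qed (use y bd in auto)
qed

section \<open>Limiting gradients of semiconcave functions\<close>

text \<open>The dyadic step sizes match the repeated halving of a segment in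
  \<open>semiconcave_upper_parabola\<close>.\<close>

lemma gderiv_directional_LIMSEQ:
  fixes W :: "'a::euclidean_space \<Rightarrow> real"
  assumes "GDERIV W y :> q"
  shows "(\<lambda>k. 2 ^ k * (W (y + (1 / 2 ^ k) *\<^sub>R v) - W y)) \<longlonglongrightarrow> q \<bullet> v"
proof -
  have "((\<lambda>t. W (y + t *\<^sub>R v)) has_derivative (\<lambda>t. (t *\<^sub>R v) \<bullet> q)) (at 0)"
  proof (rule has_derivative_compose[of "\<lambda>t. y + t *\<^sub>R v" "\<lambda>t. t *\<^sub>R v" 0 UNIV W "\<lambda>h. h \<bullet> q"])
    show "((\<lambda>t. y + t *\<^sub>R v) has_derivative (\<lambda>t. t *\<^sub>R v)) (at 0)"
      by (auto intro!: derivative_eq_intros)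
    show "(W has_derivative (\<lambda>h. h \<bullet> q)) (at (y + 0 *\<^sub>R v))"
      using assms by (simp add: gderiv_def)
  qed
  then have "DERIV (\<lambda>t. W (y + t *\<^sub>R v)) 0 :> q \<bullet> v"
    by (simp add: has_field_derivative_def inner_commute mult.commute[of "q \<bullet> v"] mult_commute_abs)
  then have "((\<lambda>t. (W (y + t *\<^sub>R v) - W y) / t) \<longlongrightarrow> q \<bullet> v) (at 0)"
    by (simp add: DERIV_def)
  moreover have "filterlim (\<lambda>k. (1/2::real) ^ k) (at 0) sequentially"
    by (auto simp: filterlim_at intro!: LIMSEQ_power_zero)
  ultimately have "(\<lambda>k. (W (y + ((1/2) ^ k) *\<^sub>R v) - W y) / (1/2) ^ k) \<longlonglongrightarrow> q \<bullet> v"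
    by (rule filterlim_compose)
  then show ?thesis
    by (simp add: power_one_over mult.commute)
qed

text \<open>Semiconcavity on the segment from \<open>y\<close> to \<open>y + v / 2^k\<close>
  compares the difference quotients with steps \<open>2^-k\<close> and \<open>2^-(k+1)\<close>, with
  error \<open>\<rho> * |v|^2 / 2^k\<close>. The errors sum to \<open>2 * \<rho> * |v|^2\<close>,
  and the quotients tend to \<open>q \<bullet> v\<close>.\<close>

lemma semiconcave_upper_parabola:
  fixes W :: "'a::euclidean_space \<Rightarrow> real"
  assumes sc: "\<And>z1 z2. closed_segment z1 z2 \<subseteq> K \<Longrightarrow>
      W z1 + W z2 - 2 * W (midpoint z1 z2) \<le> \<rho> * (norm (z1 - z2))\<^sup>2"
    and q: "GDERIV W y :> q" and K: "closed_segment y (y + v) \<subseteq> K"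
  shows "W (y + v) \<le> W y + q \<bullet> v + 2 * \<rho> * (norm v)\<^sup>2"
proof -
  define \<phi> where "\<phi> k = 2 ^ k * (W (y + (1 / 2 ^ k) *\<^sub>R v) - W y)" for k :: nat
  have step: "\<phi> k \<le> \<phi> (Suc k) + \<rho> * (norm v)\<^sup>2 * (1/2) ^ k" for k
  proof -
    let ?w = "y + (1 / 2 ^ k) *\<^sub>R v"
    have "?w \<in> closed_segment y (y + v)"
      by (auto simp: in_segment algebra_simps intro!: exI[of _ "1 / 2 ^ k"])
    then have "closed_segment y ?w \<subseteq> K"
      using K by (meson closed_segment_subset convex_closed_segment ends_in_segment(1) subset_trans)
    from sc[OF this] have "W y + W ?w - 2 * W (midpoint y ?w) \<le> \<rho> * (norm (y - ?w))\<^sup>2" .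
    moreover have "midpoint y ?w = y + (1 / 2 ^ Suc k) *\<^sub>R v"
      by (simp add: midpoint_def algebra_simps scaleR_2[symmetric])
    moreover have "(norm (y - ?w))\<^sup>2 = (norm v)\<^sup>2 * (1 / 2 ^ k)\<^sup>2"
      by (simp add: power_mult_distrib power_divide)
    ultimately have *: "W ?w - W y \<le> 2 * (W (y + (1 / 2 ^ Suc k) *\<^sub>R v) - W y) + \<rho> * ((norm v)\<^sup>2 * (1 / 2 ^ k)\<^sup>2)"
      by (simp add: algebra_simps)
    have "2 ^ k * (W ?w - W y) \<le> 2 ^ k * (2 * (W (y + (1 / 2 ^ Suc k) *\<^sub>R v) - W y) + \<rho> * ((norm v)\<^sup>2 * (1 / 2 ^ k)\<^sup>2))"
      by (rule mult_left_mono[OF *]) simp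
    also have "\<dots> = \<phi> (Suc k) + \<rho> * (norm v)\<^sup>2 * (1/2) ^ k"
      by (simp add: \<phi>_def algebra_simps power_one_over power2_eq_square)
    finally show ?thesis by (simp add: \<phi>_def)
  qed
  have "\<phi> 0 \<le> \<phi> k + \<rho> * (norm v)\<^sup>2 * (2 - 2 * (1/2) ^ k)" for k
  proof (induction k)
    case (Suc k)
    have "\<rho> * (norm v)\<^sup>2 * (2 - 2 * (1/2) ^ k) + \<rho> * (norm v)\<^sup>2 * (1/2) ^ k = \<rho> * (norm v)\<^sup>2 * (2 - 2 * (1/2) ^ Suc k)"
      by (simp add: algebra_simps)
    then show ?case using step[of k] Suc by linarith
  qed simp
  moreover have "(\<lambda>k. \<phi> k + \<rho> * (norm v)\<^sup>2 * (2 - 2 * (1/2) ^ k)) \<longlonglongrightarrow> q \<bullet> v + \<rho> * (norm v)\<^sup>2 * (2 - 2 * 0)"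
    unfolding \<phi>_def by (intro tendsto_intros gderiv_directional_LIMSEQ q LIMSEQ_power_zero) auto
  ultimately have "\<phi> 0 \<le> q \<bullet> v + \<rho> * (norm v)\<^sup>2 * (2 - 2 * 0)"
    by (intro LIMSEQ_le_const) auto
  then show ?thesis by (simp add: \<phi>_def algebra_simps)
qed

lemma gderiv_quadratic_remainder:
  fixes f :: "'a::euclidean_space \<Rightarrow> real"
  assumes "0 < s" "\<And>v. norm v < s \<Longrightarrow> \<bar>f (y + v) - f y - q \<bullet> v\<bar> \<le> c * (norm v)\<^sup>2"
  shows "GDERIV f y :> q"
  unfolding gderiv_def has_derivative_at
proof
  show "bounded_linear (\<lambda>h. h \<bullet> q)" by (rule bounded_linear_inner_left)
  show "(\<lambda>h. norm (f (y + h) - f y - h \<bullet> q) / norm h) \<midarrow>0\<rightarrow> 0"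
  proof (rule Lim_null_comparison)
    show "\<forall>\<^sub>F h in at 0. norm (norm (f (y + h) - f y - h \<bullet> q) / norm h) \<le> c * norm h"
      unfolding eventually_at
    proof (intro exI[of _ s] conjI ballI impI \<open>0 < s\<close>)
      fix h :: 'a assume "h \<noteq> 0 \<and> dist h 0 < s"
      then show "norm (norm (f (y + h) - f y - h \<bullet> q) / norm h) \<le> c * norm h"
        using assms(2)[of h] by (simp add: divide_simps inner_commute power2_eq_square mult.assoc)
    qed
    show "((\<lambda>h. c * norm h) \<longlongrightarrow> 0) (at 0)"
      by (auto intro!: tendsto_eq_intros)
  qed
qed

text \<open>If \<open>h \<ge> 0\<close> is the difference of \<open>W\<close> and a parabola touching it from below at \<open>y\<close>, then
  semiconcavity gives \<open>0 \<le> h (y + v) \<le> h (y + v) + h (y - v) \<le> const * |v|\<^sup>2\<close>.  Such contact points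
  are dense, so neither Rademacher's theorem nor convex analysis is needed.\<close>

lemma semiconcave_gderiv_of_touching_parabola:
  fixes W :: "'a::euclidean_space \<Rightarrow> real"
  assumes sc: "\<And>z1 z2. closed_segment z1 z2 \<subseteq> ball y s \<Longrightarrow>
      W z1 + W z2 - 2 * W (midpoint z1 z2) \<le> \<rho> * (norm (z1 - z2))\<^sup>2"
    and s: "0 < s"
    and touch: "\<And>w. w \<in> ball y s \<Longrightarrow>
      W y + \<mu> * (norm (y - c))\<^sup>2 \<le> W w + \<mu> * (norm (w - c))\<^sup>2"
  shows "GDERIV W y :> (2 * \<mu>) *\<^sub>R (c - y)"
proof (rule gderiv_quadratic_remainder[OF s, where c = "4 * \<bar>\<rho>\<bar> + 3 * \<bar>\<mu>\<bar>"])
  fix v :: 'a assume v: "norm v < s"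
  define N where "N = (norm v)\<^sup>2"
  have N: "0 \<le> N" by (simp add: N_def)
  have in_ball: "y + v \<in> ball y s" "y - v \<in> ball y s" using v by (auto simp: dist_norm)
  have "midpoint (y + v) (y - v) = y"
    by (simp add: midpoint_def scaleR_2[symmetric])
  moreover have "closed_segment (y + v) (y - v) \<subseteq> ball y s"
    using in_ball by (simp add: closed_segment_subset)
  moreover have "(norm ((y + v) - (y - v)))\<^sup>2 = 4 * N"
    by (simp add: N_def scaleR_2[symmetric] power_mult_distrib)
  ultimately have 1: "W (y + v) + W (y - v) - 2 * W y \<le> \<rho> * (4 * N)"
    using sc[of "y + v" "y - v"] by simp
  define I where "I = (y - c) \<bullet> v"
  have e: "(norm (y + v - c))\<^sup>2 = (norm (y - c))\<^sup>2 + 2 * I + N"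
       "(norm (y - v - c))\<^sup>2 = (norm (y - c))\<^sup>2 - 2 * I + N"
       "((2 * \<mu>) *\<^sub>R (c - y)) \<bullet> v = - (2 * \<mu> * I)"
    by (simp_all add: I_def N_def power2_norm_eq_inner inner_simps inner_commute algebra_simps)
  have 2: "0 \<le> W (y + v) - W y + (\<mu> * (2 * I) + \<mu> * N)"
    using touch[OF in_ball(1)] unfolding e by (simp add: algebra_simps)
  have 3: "0 \<le> W (y - v) - W y + (\<mu> * N - \<mu> * (2 * I))"
    using touch[OF in_ball(2)] unfolding e by (simp add: algebra_simps)
  have rN: "\<rho> * N \<le> \<bar>\<rho>\<bar> * N" "\<mu> * N \<le> \<bar>\<mu>\<bar> * N" "0 \<le> \<bar>\<rho>\<bar> * N"
    using N by (auto intro!: mult_right_mono)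
  have "(- \<mu>) * N \<le> \<bar>\<mu>\<bar> * N"
    using N by (intro mult_right_mono) auto
  then have mN: "- (\<mu> * N) \<le> \<bar>\<mu>\<bar> * N" by simp
  \<comment> \<open>Fact 1 bounds the sum of the first-order remainders for \<open>v\<close> and
    \<open>- v\<close> from above, facts 2 and 3 bound each of them from below; together they bound
    each on both sides. The constants leave slack.\<close>
  have "\<bar>W (y + v) - W y + \<mu> * (2 * I)\<bar> \<le> 4 * (\<bar>\<rho>\<bar> * N) + 3 * (\<bar>\<mu>\<bar> * N)"
    using 1 2 3 rN mN by linarith
  then show "\<bar>W (y + v) - W y - ((2 * \<mu>) *\<^sub>R (c - y)) \<bullet> v\<bar> \<le> (4 * \<bar>\<rho>\<bar> + 3 * \<bar>\<mu>\<bar>) * (norm v)\<^sup>2"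
    unfolding e N_def[symmetric] by (simp add: algebra_simps)
qed

lemma semiconcave_gderiv_dense:
  fixes W :: "'a::euclidean_space \<Rightarrow> real"
  assumes sc: "\<And>z1 z2. closed_segment z1 z2 \<subseteq> cball x \<epsilon> \<Longrightarrow>
      W z1 + W z2 - 2 * W (midpoint z1 z2) \<le> \<rho> * (norm (z1 - z2))\<^sup>2"
    and cont: "continuous_on (cball x \<epsilon>) W" and \<epsilon>: "0 < \<epsilon>"
  obtains y q where "y \<in> ball x \<epsilon>" "y \<noteq> x" "GDERIV W y :> q"
proof -
  obtain b :: 'a where b: "b \<in> Basis" using nonempty_Basis by blast
  \<comment> \<open>The centre lies at distance \<open>\<epsilon>/2\<close> from \<open>x\<close>
    and the radius is \<open>\<epsilon>/4\<close>, so the contact point lies in the given ball and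
    differs from \<open>x\<close>.\<close>
  define c r where "c = x + (\<epsilon>/2) *\<^sub>R b" and "r = \<epsilon>/4"
  have cx: "dist x c = \<epsilon>/2" using b \<epsilon> by (simp add: c_def dist_norm)
  have sub: "cball c r \<subseteq> cball x \<epsilon>"
    using cx \<epsilon> by (intro cball_subset_cball_iff[THEN iffD2]) (auto simp: r_def dist_commute)
  have "compact (W ` cball x \<epsilon>)" by (intro compact_continuous_image cont) auto
  then obtain M where M: "\<And>w. w \<in> cball x \<epsilon> \<Longrightarrow> \<bar>W w\<bar> \<le> M"
    using compact_imp_bounded by (fastforce simp: bounded_iff)
  \<comment> \<open>On the sphere the penalty equals \<open>2 * M + 1\<close>, so there the
    penalised function is at least \<open>M + 1\<close>, above its value at the centre
    \<open>c\<close>. The minimum is therefore interior.\<close>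
  define \<mu> where "\<mu> = (2 * M + 1) / r\<^sup>2"
  have r: "0 < r" using \<epsilon> by (simp add: r_def)
  let ?h = "\<lambda>w. W w + \<mu> * (norm (w - c))\<^sup>2"
  have "continuous_on (cball c r) ?h"
    by (intro continuous_intros continuous_on_subset[OF cont sub])
  moreover have "cball c r \<noteq> {}" "compact (cball c r)" using r by auto
  ultimately obtain y where y: "y \<in> cball c r" "\<And>w. w \<in> cball c r \<Longrightarrow> ?h y \<le> ?h w"
    using continuous_attains_inf[of "cball c r" ?h] by blast
  have "dist c y < r"
  proof (rule ccontr)
    assume "\<not> dist c y < r"
    then have "norm (y - c) = r" using y(1) by (simp add: dist_norm norm_minus_commute)
    then have "?h y = W y + (2 * M + 1)" using r by (simp add: \<mu>_def)
    moreover have "?h c = W c" by simp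
    moreover have "\<bar>W y\<bar> \<le> M" "\<bar>W c\<bar> \<le> M" using y(1) sub r by (auto intro!: M)
    ultimately show False using y(2)[of c] r by simp
  qed
  define s where "s = r - dist c y"
  have s: "0 < s" using \<open>dist c y < r\<close> by (simp add: s_def)
  have sb: "ball y s \<subseteq> cball c r"
    unfolding s_def by (intro subset_trans[OF ball_subset_cball] cball_subset_cball_iff[THEN iffD2]) (simp add: dist_commute)
  show thesis
  proof (rule that)
    show "GDERIV W y :> (2 * \<mu>) *\<^sub>R (c - y)"
    proof (rule semiconcave_gderiv_of_touching_parabola[OF _ s])
      fix z1 z2 assume "closed_segment z1 z2 \<subseteq> ball y s"
      then show "W z1 + W z2 - 2 * W (midpoint z1 z2) \<le> \<rho> * (norm (z1 - z2))\<^sup>2"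
        using sb sub by (intro sc) blast
    qed (use y(2) sb in blast)
    have "dist x y < \<epsilon>"
      using dist_triangle[of x y c] \<open>dist c y < r\<close> cx \<epsilon> unfolding r_def by linarith
    then show "y \<in> ball x \<epsilon>" by simp
    show "y \<noteq> x"
      using \<open>dist c y < r\<close> cx \<epsilon> dist_commute[of c x] unfolding r_def by auto
  qed
qed

text \<open>A diagonal choice from the sequences that define each \<open>P k\<close>. The points
  chosen must avoid \<open>x\<close> and not only \<open>X k\<close>; if
  \<open>X k \<noteq> x\<close>, a sequence converging to \<open>X k\<close> eventually avoids
  \<open>x\<close>.\<close>

lemma limiting_gradients_closed_graph:
  assumes "X \<longlonglongrightarrow> x" "P \<longlonglongrightarrow> p" "\<And>k::nat. P k \<in> limiting_gradients S W (X k)"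
  shows "p \<in> limiting_gradients S W x"
proof -
  have "\<exists>y q. y \<in> S \<and> y \<noteq> x \<and> (GDERIV W y :> q) \<and> dist y (X k) < 1 / Suc k \<and> dist q (P k) < 1 / Suc k" for k
  proof -
    from assms(3)[of k] obtain Y Q where YQ: "\<And>j. Y j \<in> S" "\<And>j. Y j \<noteq> X k" "\<And>j. GDERIV W (Y j) :> Q j"
      "Y \<longlonglongrightarrow> X k" "Q \<longlonglongrightarrow> P k"
      unfolding limiting_gradients_def by blast
    have "\<forall>\<^sub>F j in sequentially. Y j \<noteq> x"
    proof (cases "X k = x")
      case True
      then show ?thesis using YQ(2) by auto
    next
      case False
      then show ?thesis by (rule tendsto_imp_eventually_ne[OF YQ(4)])
    qed
    moreover have "\<forall>\<^sub>F j in sequentially. dist (Y j) (X k) < 1 / Suc k"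
      "\<forall>\<^sub>F j in sequentially. dist (Q j) (P k) < 1 / Suc k"
      using YQ(4,5) by (auto intro!: tendstoD)
    ultimately have "\<forall>\<^sub>F j in sequentially. Y j \<noteq> x \<and> dist (Y j) (X k) < 1 / Suc k \<and> dist (Q j) (P k) < 1 / Suc k"
      by eventually_elim auto
    then obtain j where "Y j \<noteq> x \<and> dist (Y j) (X k) < 1 / Suc k \<and> dist (Q j) (P k) < 1 / Suc k"
      using eventually_happens'[OF sequentially_bot] by blast
    with YQ show ?thesis by blast
  qed
  then obtain Y Q where YQ: "\<And>k. Y k \<in> S \<and> Y k \<noteq> x \<and> (GDERIV W (Y k) :> Q k) \<and>
      dist (Y k) (X k) < 1 / Suc k \<and> dist (Q k) (P k) < 1 / Suc k"
    by metis
  have inv: "(\<lambda>k. 1 / real (Suc k)) \<longlonglongrightarrow> 0" using LIMSEQ_inverse_real_of_nat by (simp add: inverse_eq_divide)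
  have "Y \<longlonglongrightarrow> x"
  proof (rule Lim_transform[OF assms(1)])
    show "(\<lambda>k. Y k - X k) \<longlonglongrightarrow> 0"
      by (rule Lim_null_comparison[OF _ inv]) (use YQ in \<open>auto simp: dist_norm norm_minus_commute intro!: always_eventually less_imp_le\<close>)
  qed
  moreover have "Q \<longlonglongrightarrow> p"
  proof (rule Lim_transform[OF assms(2)])
    show "(\<lambda>k. Q k - P k) \<longlonglongrightarrow> 0"
      by (rule Lim_null_comparison[OF _ inv]) (use YQ in \<open>auto simp: dist_norm norm_minus_commute intro!: always_eventually less_imp_le\<close>)
  qed
  ultimately show ?thesis
    unfolding limiting_gradients_def using YQ by blast
qed

text \<open>The parabola inequality at nearby points of differentiability survives the limit because
  both sides converge. Convexity of the ball keeps the segments from these points to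
  \<open>w\<close> inside it.\<close>

lemma limiting_gradient_upper_parabola:
  fixes W :: "'a::euclidean_space \<Rightarrow> real"
  assumes sc: "\<And>z1 z2. closed_segment z1 z2 \<subseteq> cball x r \<Longrightarrow>
      W z1 + W z2 - 2 * W (midpoint z1 z2) \<le> \<rho> * (norm (z1 - z2))\<^sup>2"
    and cont: "continuous_on (cball x r) W" and r: "0 < r"
    and p: "p \<in> limiting_gradients S W x" and w: "w \<in> cball x r"
  shows "W w \<le> W x + p \<bullet> (w - x) + 2 * \<rho> * (norm (w - x))\<^sup>2"
proof -
  from p obtain Y Q where YQ: "\<And>j::nat. GDERIV W (Y j) :> Q j" "Y \<longlonglongrightarrow> x" "Q \<longlonglongrightarrow> p"
    unfolding limiting_gradients_def by blast
  have ev: "\<forall>\<^sub>F j in sequentially. Y j \<in> cball x r"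
    using tendstoD[OF YQ(2) r] by eventually_elim (simp add: dist_commute)
  have "\<forall>\<^sub>F j in sequentially. W w \<le> W (Y j) + Q j \<bullet> (w - Y j) + 2 * \<rho> * (norm (w - Y j))\<^sup>2"
    using ev
  proof eventually_elim
    case (elim j)
    then have "closed_segment (Y j) (Y j + (w - Y j)) \<subseteq> cball x r"
      using w by (simp add: closed_segment_subset)
    from semiconcave_upper_parabola[OF sc YQ(1) this] show ?case by simp
  qed
  note le = this
  have "(\<lambda>j. W (Y j)) \<longlonglongrightarrow> W x"
    using continuous_on_tendsto_compose[OF cont YQ(2) _ ev] r by simp
  then have lim: "(\<lambda>j. W (Y j) + Q j \<bullet> (w - Y j) + 2 * \<rho> * (norm (w - Y j))\<^sup>2)
      \<longlonglongrightarrow> W x + p \<bullet> (w - x) + 2 * \<rho> * (norm (w - x))\<^sup>2"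
    by (intro tendsto_intros YQ)
  show ?thesis
    by (rule tendsto_lowerbound[OF lim le sequentially_bot])
qed

text \<open>A move of length \<open>r\<close> against \<open>p\<close> lowers the linear part by
  \<open>r * norm p\<close>, yet \<open>W\<close> stays non-negative there. This takes the place of
  a Lipschitz bound for \<open>W\<close>.\<close>

lemma norm_le_of_upper_parabola:
  fixes W :: "'a::euclidean_space \<Rightarrow> real"
  assumes up: "\<And>w. w \<in> cball x r \<Longrightarrow> W w \<le> W x + p \<bullet> (w - x) + c * (norm (w - x))\<^sup>2"
    and pos: "\<And>w. w \<in> cball x r \<Longrightarrow> 0 \<le> W w" and r: "0 < r"
  shows "norm p \<le> (W x + \<bar>c\<bar> * r\<^sup>2) / r"
proof (cases "p = 0")
  case True
  then show ?thesis using pos[of x] r by simp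
next
  case False
  define v where "v = - (r / norm p) *\<^sub>R p"
  have nv: "norm v = r" using False r by (simp add: v_def)
  have pv: "p \<bullet> v = - (r * norm p)"
    using False by (simp add: v_def power2_norm_eq_inner[symmetric] power2_eq_square)
  have "x + v \<in> cball x r" using nv by (simp add: dist_norm)
  from up[OF this] pos[OF this] have "0 \<le> W x + p \<bullet> v + c * r\<^sup>2" by (simp add: nv)
  moreover have "c * r\<^sup>2 \<le> \<bar>c\<bar> * r\<^sup>2" by (intro mult_right_mono) auto
  ultimately have "norm p * r \<le> W x + \<bar>c\<bar> * r\<^sup>2" by (simp add: pv mult.commute)
  then show ?thesis using r by (simp add: pos_le_divide_eq)
qed

text \<open>Without this the Hamiltonian condition could be vacuous at \<open>x\<close>. Points of
  differentiability accumulate at \<open>x\<close>, their gradients are bounded by the parabola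
  estimate, and a convergent subsequence of gradients gives an element.\<close>

lemma limiting_gradients_nonempty:
  fixes W :: "'a::euclidean_space \<Rightarrow> real"
  assumes sc: "\<And>z1 z2. closed_segment z1 z2 \<subseteq> cball x r \<Longrightarrow>
      W z1 + W z2 - 2 * W (midpoint z1 z2) \<le> \<rho> * (norm (z1 - z2))\<^sup>2"
    and cont: "continuous_on (cball x r) W" and r: "0 < r" and S: "cball x r \<subseteq> S"
    and pos: "\<And>w. w \<in> cball x r \<Longrightarrow> 0 \<le> W w"
  shows "limiting_gradients S W x \<noteq> {}"
proof -
  have "\<exists>y q. y \<in> ball x (r / 2 / Suc k) \<and> y \<noteq> x \<and> GDERIV W y :> q" for k
  proof -
    have le: "r / 2 / Suc k \<le> r"
      using r by (simp add: field_simps)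
    then have sub: "cball x (r / 2 / Suc k) \<subseteq> cball x r" by auto
    show ?thesis
      by (rule semiconcave_gderiv_dense[of x "r / 2 / Suc k" W \<rho>])
        (use sc cont r sub in \<open>auto intro: continuous_on_subset\<close>)
  qed
  then obtain Y Q where YQ: "\<And>k. Y k \<in> ball x (r / 2 / Suc k)" "\<And>k. Y k \<noteq> x" "\<And>k. GDERIV W (Y k) :> Q k"
    by metis
  have inv: "(\<lambda>k. r / 2 / real (Suc k)) \<longlonglongrightarrow> 0"
    using tendsto_mult_right_zero[OF LIMSEQ_inverse_real_of_nat, of "r/2"] by (simp add: inverse_eq_divide)
  have "Y \<longlonglongrightarrow> x"
    by (rule LIM_zero_cancel, rule Lim_null_comparison[OF _ inv])
      (use YQ(1) in \<open>auto simp: dist_norm norm_minus_commute intro!: always_eventually less_imp_le\<close>)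
  \<comment> \<open>Since \<open>Y k\<close> is within \<open>r/2\<close> of \<open>x\<close>, balls
    of radius \<open>r/2\<close> around all \<open>Y k\<close> stay where the hypotheses hold, which
    makes the gradient bound uniform in \<open>k\<close>.\<close>
  have sub: "cball (Y k) (r/2) \<subseteq> cball x r" for k
  proof -
    have "r / 2 / Suc k \<le> r / 2" using r by (simp add: field_simps)
    moreover have "dist (Y k) x < r / 2 / Suc k" using YQ(1)[of k] by (simp add: dist_commute)
    ultimately have "dist (Y k) x \<le> r/2" by linarith
    then show ?thesis by (intro cball_subset_cball_iff[THEN iffD2]) simp
  qed
  have Yr: "Y k \<in> cball x r" for k
    using r by (intro subsetD[OF sub[of k]]) simp
  have "compact (W ` cball x r)" by (intro compact_continuous_image cont) auto
  then obtain M where M: "\<And>w. w \<in> cball x r \<Longrightarrow> \<bar>W w\<bar> \<le> M"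
    using compact_imp_bounded by (fastforce simp: bounded_iff)
  have Q: "norm (Q k) \<le> (M + \<bar>2 * \<rho>\<bar> * (r/2)\<^sup>2) / (r/2)" for k
  proof -
    have "norm (Q k) \<le> (W (Y k) + \<bar>2 * \<rho>\<bar> * (r/2)\<^sup>2) / (r/2)"
    proof (rule norm_le_of_upper_parabola)
      fix w assume w: "w \<in> cball (Y k) (r/2)"
      then have "closed_segment (Y k) (Y k + (w - Y k)) \<subseteq> cball x r"
        using subsetD[OF sub w] Yr[of k] by (simp add: closed_segment_subset)
      from semiconcave_upper_parabola[OF sc YQ(3) this]
      show "W w \<le> W (Y k) + Q k \<bullet> (w - Y k) + 2 * \<rho> * (norm (w - Y k))\<^sup>2" by simp
      show "0 \<le> W w" using w sub pos by blast
    qed (use r in simp)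
    also have "\<dots> \<le> (M + \<bar>2 * \<rho>\<bar> * (r/2)\<^sup>2) / (r/2)"
      using M[OF Yr[of k]] r by (intro divide_right_mono add_right_mono) auto
    finally show ?thesis .
  qed
  have "bounded (range Q)"
    by (rule boundedI) (use Q in blast)
  then obtain p k where k: "strict_mono (k :: nat \<Rightarrow> nat)" "(Q \<circ> k) \<longlonglongrightarrow> p"
    using bounded_imp_convergent_subsequence by blast
  have "p \<in> limiting_gradients S W x"
    unfolding limiting_gradients_def
  proof (rule CollectI, rule exI[of _ "Y \<circ> k"], rule exI[of _ "Q \<circ> k"], intro conjI allI)
    show "(Y \<circ> k) \<longlonglongrightarrow> x" by (rule LIMSEQ_subseq_LIMSEQ[OF \<open>Y \<longlonglongrightarrow> x\<close> k(1)])
    show "(Y \<circ> k) j \<in> S" for j using Yr S by auto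
  qed (use YQ k in auto)
  then show ?thesis by blast
qed

section \<open>Concatenation of trajectories\<close>

lemma lipschitz_imp_abs_continuous_on_Icc:
  assumes "L-lipschitz_on {a..b} x"
  shows "abs_continuous_on_Icc a b x"
  unfolding abs_continuous_on_Icc_def
proof (intro allI impI)
  fix \<epsilon> :: real assume "\<epsilon> > 0"
  have L: "0 \<le> L" using assms by (rule lipschitz_on_nonneg)
  have "(\<Sum>i<N. norm (x (t i) - x (s i))) < \<epsilon>"
    if st: "\<forall>i<N. a \<le> s i \<and> s i \<le> t i \<and> t i \<le> b" and small: "(\<Sum>i<N. t i - s i) < \<epsilon> / (L + 1)"
    for N :: nat and s t
  proof -
    have "(\<Sum>i<N. norm (x (t i) - x (s i))) \<le> (\<Sum>i<N. L * (t i - s i))"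
    proof (rule sum_mono)
      fix i assume "i \<in> {..<N}"
      then have i: "a \<le> s i" "s i \<le> t i" "t i \<le> b" using st by auto
      then show "norm (x (t i) - x (s i)) \<le> L * (t i - s i)"
        using lipschitz_onD[OF assms, of "t i" "s i"] by (simp add: dist_norm)
    qed
    also have "\<dots> = L * (\<Sum>i<N. t i - s i)" by (simp add: sum_distrib_left)
    also have "\<dots> \<le> (L + 1) * (\<Sum>i<N. t i - s i)"
      using st by (intro mult_right_mono sum_nonneg) auto
    also have "\<dots> < \<epsilon>" using small L by (simp add: pos_less_divide_eq mult.commute)
    finally show ?thesis .
  qed
  then show "\<exists>\<delta>>0. \<forall>(N::nat) s t.
        (\<forall>i<N. a \<le> s i \<and> s i \<le> t i \<and> t i \<le> b) \<longrightarrow>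
        disjoint_family_on (\<lambda>i. {s i<..<t i}) {..<N} \<longrightarrow>
        (\<Sum>i<N. t i - s i) < \<delta> \<longrightarrow>
        (\<Sum>i<N. norm (x (t i) - x (s i))) < \<epsilon>"
    using \<open>\<epsilon> > 0\<close> L by (intro exI[of _ "\<epsilon> / (L + 1)"]) auto
qed

lemma eventually_to_left:
  assumes "ereal a < T"
  shows "\<forall>\<^sub>F t in to_left T. a \<le> t \<and> ereal t < T"
proof (cases T)
  case (real r)
  with assms have "a < r" by simp
  then have "\<forall>\<^sub>F t in at_left r. t \<in> {a<..<r}" by (rule eventually_at_left_real)
  then show ?thesis unfolding to_left_def using real by (auto elim!: eventually_mono)
next
  case PInf
  then show ?thesis unfolding to_left_def using eventually_ge_at_top[of a] by auto
qed (use assms in auto)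

text \<open>Piece \<open>n\<close> runs in its own time \<open>[0, \<delta> n]\<close>, with
  constant control \<open>v n\<close>, from \<open>\<xi> n\<close> to \<open>\<xi> (Suc n)\<close>.
  There is no lower bound on the lengths \<open>\<delta> n\<close>, so the total time may be finite.
  The bounds in \<open>f_bounded\<close> may grow with \<open>n\<close>.\<close>

locale concatenation =
  fixes f :: "'a::euclidean_space \<Rightarrow> 'b::euclidean_space \<Rightarrow> 'a"
    and \<xi> :: "nat \<Rightarrow> 'a" and v :: "nat \<Rightarrow> 'b" and \<delta> :: "nat \<Rightarrow> real" and Y :: "nat \<Rightarrow> real \<Rightarrow> 'a"
  assumes \<delta>_pos: "\<And>n. 0 < \<delta> n"
    and Y_start: "\<And>n. Y n 0 = \<xi> n"
    and Y_end: "\<And>n. Y n (\<delta> n) = \<xi> (Suc n)"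
    and Y_deriv: "\<And>n t. t \<in> {0..\<delta> n} \<Longrightarrow>
      (Y n has_vector_derivative f (Y n t) (v n)) (at t within {0..\<delta> n})"
    and f_bounded: "\<And>n. \<exists>m. \<forall>t\<in>{0..\<delta> n}. norm (f (Y n t) (v n)) \<le> m"
begin

definition node :: "nat \<Rightarrow> real" where
  "node n = (\<Sum>k<n. \<delta> k)"

text \<open>The value is meaningful only for \<open>0 \<le> t\<close> before the exit time; later no \<open>n\<close> qualifies.\<close>

definition piece :: "real \<Rightarrow> nat" where
  "piece t = (LEAST n. t < node (Suc n))"

definition exit_time :: ereal where
  "exit_time = (SUP n. ereal (node n))"

definition trajectory :: "real \<Rightarrow> 'a" where
  "trajectory t = Y (piece t) (t - node (piece t))"

definition control :: "real \<Rightarrow> 'b" where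
  "control t = v (piece t)"

lemma node_0 [simp]: "node 0 = 0"
  and node_Suc: "node (Suc n) = node n + \<delta> n"
  by (simp_all add: node_def)

lemma node_strict_mono: "strict_mono node"
  by (rule strict_monoI_Suc) (use \<delta>_pos in \<open>simp add: node_Suc\<close>)

lemma node_mono: "m \<le> n \<Longrightarrow> node m \<le> node n"
  using node_strict_mono by (simp add: strict_mono_less_eq)

lemma node_nonneg: "0 \<le> node n"
  using node_mono[of 0 n] by simp

lemma piece_eqI:
  assumes "node n \<le> t" "t < node (Suc n)"
  shows "piece t = n"
  unfolding piece_def
proof (rule Least_equality)
  fix m assume "t < node (Suc m)"
  then have "node n < node (Suc m)" using assms by linarith
  then show "n \<le> m" using node_strict_mono by (simp add: strict_mono_less)
qed (rule assms)

lemma less_exit_time: "ereal t < exit_time \<longleftrightarrow> (\<exists>n. t < node n)"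
  unfolding exit_time_def by (simp add: less_SUP_iff)

lemma node_less_exit_time: "ereal (node n) < exit_time"
  unfolding less_exit_time using \<delta>_pos[of n] by (intro exI[of _ "Suc n"]) (simp add: node_Suc)

lemma node_piece:
  assumes "t \<in> time_interval exit_time"
  shows "node (piece t) \<le> t" "t < node (Suc (piece t))"
proof -
  from assms obtain n where t: "0 \<le> t" "t < node n"
    by (auto simp: time_interval_def less_exit_time)
  then have "t < node (Suc n)" using node_mono[of n "Suc n"] by linarith
  then show "t < node (Suc (piece t))" unfolding piece_def by (rule LeastI)
  show "node (piece t) \<le> t"
  proof (cases "piece t")
    case (Suc m)
    then have "\<not> t < node (Suc m)" unfolding piece_def by (intro not_less_Least) simp
    then show ?thesis using Suc by simp
  qed (use t in simp)
qed

lemma piece_mono_node: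
  assumes "t \<in> time_interval exit_time" "node n \<le> t"
  shows "n \<le> piece t"
proof -
  have "node n < node (Suc (piece t))" using node_piece(2)[OF assms(1)] assms(2) by linarith
  then show ?thesis using node_strict_mono by (simp add: strict_mono_less)
qed

lemma trajectory_on_piece:
  assumes "t \<in> {node n..node (Suc n)}"
  shows "trajectory t = Y n (t - node n)"
proof (cases "t < node (Suc n)")
  case True
  then have "piece t = n" using assms by (intro piece_eqI) auto
  then show ?thesis by (simp add: trajectory_def)
next
  \<comment> \<open>At the right end point \<open>piece\<close> has already jumped to
    \<open>Suc n\<close>; \<open>Y_end\<close> and \<open>Y_start\<close> make the two values
    agree.\<close>
  case False
  then have t: "t = node (Suc n)" using assms by simp
  then have "piece t = Suc n" using \<delta>_pos[of "Suc n"] by (intro piece_eqI) (auto simp: node_Suc)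
  then show ?thesis using t by (simp add: trajectory_def Y_start node_Suc Y_end)
qed

lemma control_on_piece: "t \<in> {node n..<node (Suc n)} \<Longrightarrow> control t = v n"
  by (simp add: control_def piece_eqI[of n t])

lemma trajectory_0: "trajectory 0 = \<xi> 0"
  using trajectory_on_piece[of 0 0] \<delta>_pos[of 0] by (simp add: node_Suc Y_start)

lemma piece_lipschitz: "\<exists>m. m-lipschitz_on {0..\<delta> n} (Y n)"
proof -
  obtain m where m: "\<forall>t\<in>{0..\<delta> n}. norm (f (Y n t) (v n)) \<le> m" using f_bounded by blast
  have "0 \<le> norm (f (Y n 0) (v n))" by simp
  also have "\<dots> \<le> m" using m \<delta>_pos[of n] by auto
  finally have "0 \<le> m" .
  have "norm (Y n s - Y n t) \<le> m * norm (s - t)" if "s \<in> {0..\<delta> n}" "t \<in> {0..\<delta> n}" for s t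
  proof (rule differentiable_bound[where f' = "\<lambda>r h. h *\<^sub>R f (Y n r) (v n)" and S = "{0..\<delta> n}"])
    fix r assume r: "r \<in> {0..\<delta> n}"
    show "(Y n has_derivative (\<lambda>h. h *\<^sub>R f (Y n r) (v n))) (at r within {0..\<delta> n})"
      using Y_deriv[OF r] by (simp add: has_vector_derivative_def)
    show "onorm (\<lambda>h. h *\<^sub>R f (Y n r) (v n)) \<le> m"
    proof (rule onorm_le)
      fix h :: real
      have "norm (f (Y n r) (v n)) \<le> m" using m r by blast
      from mult_left_mono[OF this, of "norm h"]
      show "norm (h *\<^sub>R f (Y n r) (v n)) \<le> m * norm h" by (simp add: mult.commute)
    qed
  qed (use that in auto)
  then show ?thesis using \<open>0 \<le> m\<close> by (auto simp: lipschitz_on_def dist_norm)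
qed

text \<open>The constant may grow with \<open>n\<close>. Every compact subinterval of the domain
  ends before some node, so this suffices for local absolute continuity.\<close>

lemma trajectory_lipschitz: "\<exists>L. L-lipschitz_on {0..node n} trajectory"
proof (induction n)
  case 0
  then show ?case by (auto simp: lipschitz_on_def)
next
  case (Suc n)
  then obtain L where L: "L-lipschitz_on {0..node n} trajectory" by blast
  obtain m where m: "m-lipschitz_on {0..\<delta> n} (Y n)" using piece_lipschitz by blast
  have "m-lipschitz_on {node n..node (Suc n)} trajectory"
  proof (rule lipschitz_onI)
    fix s t assume s: "s \<in> {node n..node (Suc n)}" and t: "t \<in> {node n..node (Suc n)}"
    then have "s - node n \<in> {0..\<delta> n}" "t - node n \<in> {0..\<delta> n}" by (auto simp: node_Suc)
    from lipschitz_onD[OF m this] show "dist (trajectory s) (trajectory t) \<le> m * dist s t"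
      using trajectory_on_piece[OF s] trajectory_on_piece[OF t] by (simp add: dist_real_def)
  qed (use lipschitz_on_nonneg[OF m] in simp)
  from lipschitz_on_concat_max[OF L this refl]
  have "(max L m)-lipschitz_on {0..node (Suc n)} trajectory" by simp
  then show ?case by blast
qed

lemma trajectory_deriv:
  assumes t: "t \<in> time_interval exit_time" "t \<notin> range node"
  shows "(trajectory has_vector_derivative f (trajectory t) (control t)) (at t within S)"
proof -
  define n where "n = piece t"
  have "node n \<le> t" "t < node (Suc n)" using node_piece[OF t(1)] by (simp_all add: n_def)
  moreover have "t \<noteq> node n" using t(2) by auto
  ultimately have n: "node n < t" "t < node (Suc n)" by auto
  have tr: "trajectory t = Y n (t - node n)" and co: "control t = v n"
    using n trajectory_on_piece[of t n] control_on_piece[of t n] by auto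
  have int: "t - node n \<in> interior {0..\<delta> n}" using n by (simp add: node_Suc)
  have "t - node n \<in> {0..\<delta> n}" using n by (simp add: node_Suc)
  from Y_deriv[OF this] have "(Y n has_vector_derivative f (Y n (t - node n)) (v n)) (at (t - node n))"
    using at_within_interior[OF int] by simp
  moreover have "((\<lambda>t. t - node n) has_vector_derivative 1) (at t)"
    by (auto intro!: derivative_eq_intros simp: has_vector_derivative_def)
  ultimately have "((Y n \<circ> (\<lambda>t. t - node n)) has_vector_derivative (1 *\<^sub>R f (Y n (t - node n)) (v n))) (at t)"
    using vector_diff_chain_at by blast
  then have "((\<lambda>t. Y n (t - node n)) has_vector_derivative f (trajectory t) (control t)) (at t)"
    by (simp add: o_def tr co)
  then have "(trajectory has_vector_derivative f (trajectory t) (control t)) (at t)"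
  proof (rule has_vector_derivative_transform_within_open[where S = "{node n<..<node (Suc n)}"])
    show "Y n (s - node n) = trajectory s" if "s \<in> {node n<..<node (Suc n)}" for s
      using that by (intro trajectory_on_piece[symmetric]) auto
  qed (use n in auto)
  then show ?thesis by (rule has_vector_derivative_at_within)
qed

lemma carath_solution_trajectory: "carath_solution f exit_time trajectory control (\<xi> 0)"
  unfolding carath_solution_def
proof (intro conjI ballI)
  show "trajectory 0 = \<xi> 0" by (rule trajectory_0)
  fix b assume "b \<in> time_interval exit_time"
  then obtain n where n: "b < node n" by (auto simp: time_interval_def less_exit_time)
  obtain L where "L-lipschitz_on {0..node n} trajectory" using trajectory_lipschitz by blast
  then have "L-lipschitz_on {0..b} trajectory" by (rule lipschitz_on_subset) (use n in auto)
  then show "abs_continuous_on_Icc 0 b trajectory" by (rule lipschitz_imp_abs_continuous_on_Icc)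
next
  have "range node \<in> null_sets lebesgue"
    by (intro null_sets_completionI countable_imp_null_set_lborel) simp
  then have "AE t in lebesgue. t \<notin> range node" by (rule AE_not_in)
  then show "AE t in lebesgue. t \<in> time_interval exit_time \<longrightarrow>
      (trajectory has_vector_derivative f (trajectory t) (control t)) (at t within time_interval exit_time)"
    by eventually_elim (use trajectory_deriv in blast)
qed

text \<open>The control factors through the natural number \<open>piece t\<close>:
  \<open>piece\<close> is a least index of measurable conditions, and any function on a discrete
  space is measurable. Only finitely many values occur on a compact subinterval.\<close>

lemma Linf_loc_control: "Linf_loc exit_time UNIV control"
  unfolding Linf_loc_def
proof (intro conjI ballI)
  fix b assume b: "b \<in> time_interval exit_time"
  show "control \<in> borel_measurable (lebesgue_on {0..b})"
  proof -
    have "(\<lambda>t. t < node (Suc i)) \<in> measurable (lebesgue_on {0..b}) (count_space UNIV)" for i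
    proof -
      have "(\<lambda>t::real. t) \<in> borel_measurable (lebesgue_on {0..b})"
        by (intro measurable_restrict_space1 measurable_completion) simp
      then show ?thesis by measurable
    qed
    then have "piece \<in> measurable (lebesgue_on {0..b}) (count_space UNIV)"
      unfolding piece_def by (rule measurable_Least)
    moreover have "v \<in> measurable (count_space UNIV) borel" by simp
    ultimately show ?thesis
      unfolding control_def by (rule measurable_compose)
  qed
  from b obtain n where n: "b < node n" by (auto simp: time_interval_def less_exit_time)
  have "norm (control t) \<le> (\<Sum>k<n. norm (v k))" if t: "t \<in> {0..b}" for t
  proof -
    have "t < node n" using t n by simp
    then have ti: "t \<in> time_interval exit_time"
      using t by (auto simp: time_interval_def less_exit_time)
    have "node (piece t) < node n" using node_piece(1)[OF ti] t n by auto
    then have "piece t < n" using node_strict_mono by (simp add: strict_mono_less)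
    then show ?thesis unfolding control_def
      by (intro member_le_sum[of _ _ "\<lambda>k. norm (v k)"]) auto
  qed
  then show "\<exists>B. AE t in lebesgue_on {0..b}. norm (control t) \<le> B"
    by (intro exI[of _ "\<Sum>k<n. norm (v k)"] AE_I2) simp
qed simp

lemma exit_time_pos: "0 < exit_time"
  using node_less_exit_time[of 0] by (simp add: zero_ereal_def)

text \<open>At each time the running cost is one term of the sum of the shifted, non-negative piece
  costs, and sum and integral of these commute. The closed pieces overlap at the nodes, which is
  harmless for an upper bound.\<close>

lemma cost_le_suminf:
  fixes L :: "'a \<Rightarrow> 'b \<Rightarrow> real"
  assumes nonneg: "\<And>n s. s \<in> {0..\<delta> n} \<Longrightarrow> 0 \<le> L (Y n s) (v n)"
    and int: "\<And>n. ((\<lambda>s. L (Y n s) (v n)) has_integral J n) {0..\<delta> n}"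
  shows "(\<integral>\<^sup>+ t \<in> time_interval exit_time. ennreal (L (trajectory t) (control t)) \<partial>lebesgue)
    \<le> (\<Sum>n. ennreal (J n))"
proof -
  define h where "h n t = indicator {node n..node (Suc n)} t * L (Y n (t - node n)) (v n)" for n t
  have int': "((\<lambda>t. L (Y n (t - node n)) (v n)) has_integral J n) {node n..node (Suc n)}" for n
    using has_integral_shift_Icc_real[of "\<lambda>t. L (Y n (t - node n)) (v n)" "node n" "J n" 0 "\<delta> n"] int[of n]
    by (simp add: o_def node_Suc add.commute)
  have meas: "(\<lambda>t. ennreal (h n t)) \<in> borel_measurable lebesgue" for n
    using has_integral_implies_lebesgue_measurable[OF int', of n] unfolding h_def by simp
  have hint: "(\<integral>\<^sup>+ t. ennreal (h n t) \<partial>lebesgue) = ennreal (J n)" for n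
  proof -
    have "0 \<le> L (Y n (t - node n)) (v n)" if "t \<in> {node n..node (Suc n)}" for t
      using that by (intro nonneg) (auto simp: node_Suc)
    from nn_integral_has_integral_lebesgue[OF this int']
    show ?thesis unfolding h_def nn_integral_completion .
  qed
  have "(\<integral>\<^sup>+ t \<in> time_interval exit_time. ennreal (L (trajectory t) (control t)) \<partial>lebesgue)
      \<le> (\<integral>\<^sup>+ t. (\<Sum>n. ennreal (h n t)) \<partial>lebesgue)"
  proof (rule nn_integral_mono)
    fix t :: real
    show "ennreal (L (trajectory t) (control t)) * indicator (time_interval exit_time) t
        \<le> (\<Sum>n. ennreal (h n t))"
    proof (cases "t \<in> time_interval exit_time")
      case True
      have "L (trajectory t) (control t) = h (piece t) t"
        using node_piece[OF True] by (simp add: h_def trajectory_def control_def)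
      moreover have "ennreal (h (piece t) t) \<le> (\<Sum>n. ennreal (h n t))"
        using sum_le_suminf[of "\<lambda>n. ennreal (h n t)" "{piece t}"] by simp
      ultimately show ?thesis using True by simp
    qed simp
  qed
  also have "\<dots> = (\<Sum>n. ennreal (J n))"
    using meas by (subst nn_integral_suminf) (simp_all add: hint)
  finally show ?thesis .
qed

end

section \<open>Majorants of class KL\<close>

text \<open>The supremum over all later times \<open>s >= t\<close> would be antitone but possibly
  discontinuous. Retaining earlier times with a weight that decays exponentially in
  \<open>t - s\<close> smooths it, and old contributions still die out.\<close>

lemma antitone_continuous_envelope:
  fixes e :: "'i \<Rightarrow> real \<Rightarrow> real"
  assumes nonneg: "\<And>i t. i \<in> I \<Longrightarrow> 0 \<le> t \<Longrightarrow> 0 \<le> e i t"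
    and bound: "\<And>i t. i \<in> I \<Longrightarrow> 0 \<le> t \<Longrightarrow> e i t \<le> B" and B: "0 \<le> B"
    and decay: "\<And>\<epsilon>. 0 < \<epsilon> \<Longrightarrow> \<exists>\<tau>. \<forall>i\<in>I. \<forall>t\<ge>0. \<tau> \<le> t \<longrightarrow> e i t \<le> \<epsilon>"
  obtains b :: "real \<Rightarrow> real" where "continuous_on {0..} b" "antimono_on {0..} b" "(b \<longlongrightarrow> 0) at_top"
    "\<And>t. 0 \<le> b t" "\<And>t. b t \<le> B" "\<And>i t. i \<in> I \<Longrightarrow> 0 \<le> t \<Longrightarrow> e i t \<le> b t"
proof -
  \<comment> \<open>the supremum of \<open>e i s * exp (- max 0 (t - s))\<close> is \<open>B\<close>-Lipschitz in \<open>t\<close>\<close>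
  define S where "S t = insert 0 ((\<lambda>(i, s). e i s * exp (- max 0 (t - s))) ` (I \<times> {0..}))" for t
  define b where "b t = Sup (S t)" for t
  have elem_le: "x \<le> B" if "x \<in> S t" for x t
  proof -
    have "e i s * exp (- max 0 (t - s)) \<le> B" if "i \<in> I" "0 \<le> s" for i s
      using mult_mono[OF bound[OF that], of "exp (- max 0 (t - s))" 1] B by simp
    then show ?thesis using \<open>x \<in> S t\<close> B by (auto simp: S_def)
  qed
  have bdd: "bdd_above (S t)" for t using elem_le by (intro bdd_aboveI)
  have ne: "S t \<noteq> {}" for t by (simp add: S_def)
  have b_leI: "b t \<le> c" if "0 \<le> c" "\<And>i s. i \<in> I \<Longrightarrow> 0 \<le> s \<Longrightarrow> e i s * exp (- max 0 (t - s)) \<le> c" for t c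
    unfolding b_def by (rule cSup_least[OF ne]) (use that in \<open>auto simp: S_def\<close>)
  have le_b: "e i s * exp (- max 0 (t - s)) \<le> b t" if "i \<in> I" "0 \<le> s" for i s t
    unfolding b_def by (rule cSup_upper[OF _ bdd]) (use that in \<open>auto simp: S_def\<close>)
  have b0: "0 \<le> b t" for t
    unfolding b_def by (rule cSup_upper[OF _ bdd]) (simp add: S_def)
  have anti: "b t' \<le> b t" if "t \<le> t'" for t t'
  proof (rule b_leI[OF b0])
    fix i s assume ist: "i \<in> I" "(0::real) \<le> s"
    have "e i s * exp (- max 0 (t' - s)) \<le> e i s * exp (- max 0 (t - s))"
      using that nonneg[OF ist] by (intro mult_left_mono) auto
    also have "\<dots> \<le> b t" by (rule le_b[OF ist])
    finally show "e i s * exp (- max 0 (t' - s)) \<le> b t" .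
  qed
  have lip: "b t \<le> b t' + B * (t' - t)" if tt: "t \<le> t'" for t t'
  proof (rule b_leI)
    show "0 \<le> b t' + B * (t' - t)" using b0 B tt by simp
    fix i s assume ist: "i \<in> I" "(0::real) \<le> s"
    define p q where "p = max 0 (t - s)" and "q = max 0 (t' - s)"
    have pq: "0 \<le> p" "p \<le> q" "q - p \<le> t' - t" using tt by (auto simp: p_def q_def)
    have "exp (- p) - exp (- q) = exp (- p) * (1 - exp (p - q))"
      by (simp add: algebra_simps flip: exp_add)
    also have "\<dots> \<le> 1 * (1 - exp (p - q))" using pq by (intro mult_right_mono) auto
    also have "1 * (1 - exp (p - q)) \<le> q - p"
    proof -
      have "1 + x \<le> y \<Longrightarrow> 1 * (1 - y) \<le> - x" for x y :: real by simp
      from this[OF exp_ge_add_one_self[of "p - q"]] show ?thesis by simp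
    qed
    also have "\<dots> \<le> t' - t" by (rule pq)
    finally have "e i s * (exp (- p) - exp (- q)) \<le> B * (t' - t)"
      using nonneg[OF ist] bound[OF ist] B tt pq by (intro mult_mono) auto
    then show "e i s * exp (- max 0 (t - s)) \<le> b t' + B * (t' - t)"
      using le_b[OF ist, of t'] unfolding p_def[symmetric] q_def[symmetric] by (simp add: algebra_simps)
  qed
  have "B-lipschitz_on {0..} b"
  proof (rule lipschitz_onI[OF _ B])
    fix s t :: real
    show "dist (b s) (b t) \<le> B * dist s t"
      using lip[of s t] lip[of t s] anti[of s t] anti[of t s] by (cases "s \<le> t") (auto simp: dist_real_def)
  qed
  then have "continuous_on {0..} b" by (rule lipschitz_on_continuous_on)
  moreover have "antimono_on {0..} b" using anti by (auto simp: monotone_on_def)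
  moreover have "(b \<longlongrightarrow> 0) at_top"
  proof (rule tendstoI)
    fix \<epsilon> :: real assume \<epsilon>: "0 < \<epsilon>"
    then obtain \<tau>' where \<tau>': "\<And>i t. i \<in> I \<Longrightarrow> 0 \<le> t \<Longrightarrow> \<tau>' \<le> t \<Longrightarrow> e i t \<le> \<epsilon> / 2"
      using decay[of "\<epsilon> / 2"] by auto
    \<comment> \<open>Contributions from \<open>s >= \<tau>'\<close> are small by the decay
      hypothesis. For earlier \<open>s\<close> the gap \<open>x = t - s\<close> is at least
      \<open>2 * B / \<epsilon>\<close>, and \<open>exp x >= 1 + x\<close> makes the weight small
      enough.\<close>
    have "b t \<le> \<epsilon> / 2" if t: "\<tau>' + 2 * B / \<epsilon> \<le> t" for t
    proof (rule b_leI)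
      fix i s assume ist: "i \<in> I" "(0::real) \<le> s"
      show "e i s * exp (- max 0 (t - s)) \<le> \<epsilon> / 2"
      proof (cases "\<tau>' \<le> s")
        case True
        have "e i s * exp (- max 0 (t - s)) \<le> e i s * 1" using nonneg[OF ist] by (intro mult_left_mono) auto
        also have "\<dots> \<le> \<epsilon> / 2" using \<tau>'[OF ist True] by simp
        finally show ?thesis .
      next
        case False
        define x where "x = t - s"
        have x: "2 * B / \<epsilon> \<le> x" using t False by (simp add: x_def)
        moreover have "0 \<le> 2 * B / \<epsilon>" using B \<epsilon> by simp
        ultimately have x0: "0 \<le> x" by linarith
        have "B \<le> \<epsilon> / 2 * (1 + x)" using x \<epsilon> by (simp add: field_simps)
        also have "\<dots> \<le> \<epsilon> / 2 * exp x" using \<epsilon> by (intro mult_left_mono) auto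
        finally have "B * exp (- x) \<le> \<epsilon> / 2" by (simp add: exp_minus field_simps)
        moreover have "e i s * exp (- x) \<le> B * exp (- x)" using bound[OF ist] by (intro mult_right_mono) auto
        moreover have "max 0 (t - s) = x" using x0 by (simp add: x_def)
        ultimately show ?thesis by (metis order_trans)
      qed
    qed (use \<epsilon> in simp)
    then have "\<forall>\<^sub>F t in at_top. b t \<le> \<epsilon> / 2"
      by (rule eventually_mono[OF eventually_ge_at_top[of "\<tau>' + 2 * B / \<epsilon>"]])
    then show "\<forall>\<^sub>F t in at_top. dist (b t) 0 < \<epsilon>"
      by eventually_elim (use b0 \<epsilon> in auto)
  qed
  moreover have "b t \<le> B" for t unfolding b_def by (rule cSup_least[OF ne elem_le])
  moreover have "e i t \<le> b t" if "i \<in> I" "0 \<le> t" for i t using le_b[OF that, of t] by simp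
  ultimately show thesis using b0 that by blast
qed

text \<open>Each product is monotone in \<open>r\<close>, antitone in \<open>t\<close> and 0 at
  \<open>r = 0\<close>, and sums inherit this. Summable bounds that are uniform for \<open>r\<close>
  in bounded intervals give continuity by the Weierstrass test and the limit in \<open>t\<close> by
  Tannery's theorem.\<close>

lemma class_KL_series:
  fixes g b :: "nat \<Rightarrow> real \<Rightarrow> real"
  assumes g: "\<And>k. continuous_on {0..} (g k)" "\<And>k. mono_on {0..} (g k)" "\<And>k. g k 0 = 0"
    and b: "\<And>k. continuous_on {0..} (b k)" "\<And>k. antimono_on {0..} (b k)" "\<And>k. (b k \<longlongrightarrow> 0) at_top"
      "\<And>k t. 0 \<le> b k t"
    and M: "\<And>R. 0 \<le> R \<Longrightarrow> \<exists>M. summable M \<and> (\<forall>k. \<forall>r\<in>{0..R}. \<forall>t\<ge>0. g k r * b k t \<le> M k)"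
  obtains \<beta> where "\<beta> \<in> class_KL" "\<And>k r t. 0 \<le> r \<Longrightarrow> 0 \<le> t \<Longrightarrow> g k r * b k t \<le> \<beta> r t"
proof -
  define \<sigma> where "\<sigma> r t = (\<Sum>k. g k r * b k t)" for r t
  \<comment> \<open>The summand \<open>r * exp (- t)\<close> supplies strict monotonicity and
    unboundedness in \<open>r\<close>, which the series need not have.\<close>
  define \<beta> where "\<beta> r t = r * exp (- t) + \<sigma> r t" for r t
  have g_mono: "g k r \<le> g k r'" if "0 \<le> r" "r \<le> r'" for k r r'
    using g(2)[of k] that by (auto simp: mono_on_def)
  have g0: "0 \<le> g k r" if "0 \<le> r" for k r using g_mono[of 0 r k] that g(3) by simp
  have b_anti: "b k t' \<le> b k t" if "0 \<le> t" "t \<le> t'" for k t t'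
    using b(2)[of k] that by (auto simp: monotone_on_def)
  have term0: "0 \<le> g k r * b k t" if "0 \<le> r" for k r t using g0[OF that] b(4) by simp
  have summ: "summable (\<lambda>k. g k r * b k t)" if r: "0 \<le> r" and t: "0 \<le> t" for r t
  proof -
    obtain N where N: "summable N" "\<forall>k. \<forall>r\<in>{0..r}. \<forall>t\<ge>0. g k r * b k t \<le> N k" using M[OF r] by blast
    show ?thesis
      by (rule summable_comparison_test'[OF N(1), of 0]) (use N(2) term0[OF r] r t in auto)
  qed
  have \<sigma>0: "0 \<le> \<sigma> r t" if "0 \<le> r" "0 \<le> t" for r t
    unfolding \<sigma>_def using summ[OF that] term0[OF that(1)] by (intro suminf_nonneg)
  have \<sigma>_mono: "\<sigma> r t \<le> \<sigma> r' t" if "0 \<le> r" "r \<le> r'" "0 \<le> t" for r r' t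
    unfolding \<sigma>_def using that by (intro suminf_le summ mult_right_mono g_mono b) auto
  have \<sigma>_anti: "\<sigma> r t' \<le> \<sigma> r t" if "0 \<le> r" "0 \<le> t" "t \<le> t'" for r t t'
    unfolding \<sigma>_def using that by (intro suminf_le summ mult_left_mono g0 b_anti) auto
  have cont_R: "continuous_on ({0..R} \<times> {0..}) (\<lambda>z. \<sigma> (fst z) (snd z))" if R: "0 \<le> R" for R
  proof -
    obtain N where N: "summable N" "\<forall>k. \<forall>r\<in>{0..R}. \<forall>t\<ge>0. g k r * b k t \<le> N k" using M[OF R] by blast
    have "uniform_limit ({0..R} \<times> {0..}) (\<lambda>n z. \<Sum>k<n. g k (fst z) * b k (snd z))
        (\<lambda>z. \<sigma> (fst z) (snd z)) sequentially"
      unfolding \<sigma>_def by (rule Weierstrass_m_test[OF _ N(1)]) (use N(2) term0 in auto)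
    moreover have "continuous_on ({0..R} \<times> {0..}) (\<lambda>z. \<Sum>k<n. g k (fst z) * b k (snd z))" for n
    proof (intro continuous_on_sum continuous_on_mult)
      fix k
      show "continuous_on ({0..R} \<times> {0..}) (\<lambda>z. g k (fst z))"
        by (rule continuous_on_compose2[OF g(1)]) (auto intro!: continuous_intros)
      show "continuous_on ({0..R} \<times> {0..}) (\<lambda>z. b k (snd z))"
        by (rule continuous_on_compose2[OF b(1)]) (auto intro!: continuous_intros)
    qed
    ultimately show ?thesis
      by (intro uniform_limit_theorem[OF _ _ sequentially_bot]) auto
  qed
  \<comment> \<open>Uniform convergence is available only on strips \<open>r <= R\<close>.
    Continuity is local, and near a point the quadrant coincides with such a strip.\<close>
  have cont: "continuous_on ({0..} \<times> {0..}) (\<lambda>z. \<sigma> (fst z) (snd z))"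
    unfolding continuous_on_eq_continuous_within
  proof
    fix z :: "real \<times> real" assume z: "z \<in> {0..} \<times> {0..}"
    then have "continuous (at z within {0..fst z + 1} \<times> {0..}) (\<lambda>z. \<sigma> (fst z) (snd z))"
      using cont_R[of "fst z + 1"] by (auto simp: continuous_on_eq_continuous_within)
    moreover have "at z within {0..} \<times> {0..} = at z within {0..fst z + 1} \<times> {0..}"
      by (rule at_within_nhd[of z "{..<fst z + 1} \<times> UNIV"])
        (auto intro!: open_Times simp: mem_Times_iff)
    ultimately show "continuous (at z within {0..} \<times> {0..}) (\<lambda>z. \<sigma> (fst z) (snd z))" by simp
  qed
  have lim: "(\<sigma> r \<longlongrightarrow> 0) at_top" if r: "0 \<le> r" for r
  proof -
    obtain N where N: "summable N" "\<forall>k. \<forall>r\<in>{0..r}. \<forall>t\<ge>0. g k r * b k t \<le> N k" using M[OF r] by blast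
    have "((\<lambda>t. \<Sum>k. g k r * b k t) \<longlongrightarrow> (\<Sum>k. g k r * 0)) at_top"
    proof (rule tannerys_theorem[THEN conjunct2, THEN conjunct2, OF _ _ N(1)])
      show "((\<lambda>t. g k r * b k t) \<longlongrightarrow> g k r * 0) at_top" for k
        by (intro tendsto_mult tendsto_const b)
      have "\<forall>\<^sub>F t::real in at_top. 0 \<le> t" by (rule eventually_ge_at_top)
      then show "\<forall>\<^sub>F (k, t) in at_top \<times>\<^sub>F at_top. norm (g k r * b k t) \<le> N k"
        unfolding eventually_prod_filter using N(2) term0[OF r] r
        by (intro exI[of _ "\<lambda>_. True"] exI[of _ "\<lambda>t. 0 \<le> t"]) auto
    qed simp
    then show ?thesis unfolding \<sigma>_def by simp
  qed
  show thesis
  proof (rule that[of \<beta>])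
    show "\<beta> \<in> class_KL"
      unfolding class_KL_def
    proof (intro CollectI conjI allI impI)
      show "continuous_on ({0..} \<times> {0..}) (\<lambda>(r, t). \<beta> r t)"
        unfolding \<beta>_def case_prod_unfold by (intro continuous_intros cont)
      fix t :: real assume t: "0 \<le> t"
      show "0 \<le> \<beta> r t" if "0 \<le> r" for r using \<sigma>0[OF that t] that by (simp add: \<beta>_def)
      show "\<beta> 0 t = 0" by (simp add: \<beta>_def \<sigma>_def g)
      show "strict_mono_on {0..} (\<lambda>r. \<beta> r t)"
      proof (rule strict_mono_onI)
        fix r s :: real assume "r \<in> {0..}" "r < s"
        then have "r * exp (- t) < s * exp (- t)" "\<sigma> r t \<le> \<sigma> s t" using \<sigma>_mono t by auto
        then show "\<beta> r t < \<beta> s t" unfolding \<beta>_def by (rule add_less_le_mono)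
      qed
      show "\<exists>r\<ge>0. B < \<beta> r t" for B
      proof (intro exI conjI)
        show "0 \<le> (\<bar>B\<bar> + 1) * exp t" by simp
        then have "0 \<le> \<sigma> ((\<bar>B\<bar> + 1) * exp t) t" using t by (rule \<sigma>0)
        moreover have "(\<bar>B\<bar> + 1) * exp t * exp (- t) = \<bar>B\<bar> + 1" by (simp add: exp_minus)
        ultimately show "B < \<beta> ((\<bar>B\<bar> + 1) * exp t) t" unfolding \<beta>_def by linarith
      qed
    next
      fix r :: real assume r: "0 \<le> r"
      show "antimono_on {0..} (\<beta> r)"
      proof (rule monotone_onI)
        fix s t :: real assume "s \<in> {0..}" "s \<le> t"
        then have "r * exp (- t) \<le> r * exp (- s)" "\<sigma> r t \<le> \<sigma> r s"
          using r \<sigma>_anti by (auto intro!: mult_left_mono)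
        then show "\<beta> r s \<ge> \<beta> r t" by (simp add: \<beta>_def)
      qed
      have "((\<lambda>t::real. exp (- t)) \<longlongrightarrow> 0) at_top"
        by (intro filterlim_compose[OF exp_at_bot] filterlim_uminus_at_bot_at_top)
      then have "((\<lambda>t. r * exp (- t) + \<sigma> r t) \<longlongrightarrow> r * 0 + 0) at_top"
        by (intro tendsto_add tendsto_mult tendsto_const lim r)
      then show "(\<beta> r \<longlongrightarrow> 0) at_top" by (simp add: \<beta>_def[abs_def])
    qed
    fix k and r t :: real assume r: "0 \<le> r" and t: "0 \<le> t"
    have "g k r * b k t \<le> \<sigma> r t"
      unfolding \<sigma>_def using sum_le_suminf[OF summ[OF r t], of "{k}"] term0[OF r] by simp
    then show "g k r * b k t \<le> \<beta> r t" using r by (simp add: \<beta>_def add_increasing)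
  qed
qed

lemma class_KLD:
  assumes "\<beta> \<in> class_KL"
  shows "continuous_on ({0..} \<times> {0..}) (\<lambda>(r, t). \<beta> r t)"
    and "\<And>r t. 0 \<le> r \<Longrightarrow> 0 \<le> t \<Longrightarrow> 0 \<le> \<beta> r t"
    and "\<And>t. 0 \<le> t \<Longrightarrow> \<beta> 0 t = 0"
    and "\<And>t. 0 \<le> t \<Longrightarrow> strict_mono_on {0..} (\<lambda>r. \<beta> r t)"
    and "\<And>t B. 0 \<le> t \<Longrightarrow> \<exists>r\<ge>0. B < \<beta> r t"
    and "\<And>r. 0 \<le> r \<Longrightarrow> antimono_on {0..} (\<beta> r)"
    and "\<And>r. 0 \<le> r \<Longrightarrow> (\<beta> r \<longlongrightarrow> 0) at_top"
  using assms by (simp_all add: class_KL_def)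

lemma class_KL_add:
  assumes "\<beta>\<^sub>1 \<in> class_KL" "\<beta>\<^sub>2 \<in> class_KL"
  shows "(\<lambda>r t. \<beta>\<^sub>1 r t + \<beta>\<^sub>2 r t) \<in> class_KL"
  unfolding class_KL_def
proof (intro CollectI conjI allI impI)
  note KL = class_KLD[OF assms(1)] class_KLD[OF assms(2)]
  show "continuous_on ({0..} \<times> {0..}) (\<lambda>(r, t). \<beta>\<^sub>1 r t + \<beta>\<^sub>2 r t)"
    using continuous_on_add[OF KL(1,8)] by (simp add: case_prod_unfold)
  fix t :: real assume t: "0 \<le> t"
  show "0 \<le> \<beta>\<^sub>1 r t + \<beta>\<^sub>2 r t" if "0 \<le> r" for r using KL(2,9)[OF that t] by simp
  show "\<beta>\<^sub>1 0 t + \<beta>\<^sub>2 0 t = 0" using KL(3,10)[OF t] by simp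
  show "strict_mono_on {0..} (\<lambda>r. \<beta>\<^sub>1 r t + \<beta>\<^sub>2 r t)"
  proof (rule strict_mono_onI)
    fix r s :: real assume rs: "r \<in> {0..}" "s \<in> {0..}" "r < s"
    show "\<beta>\<^sub>1 r t + \<beta>\<^sub>2 r t < \<beta>\<^sub>1 s t + \<beta>\<^sub>2 s t"
      using strict_mono_onD[OF KL(4)[OF t] rs] strict_mono_onD[OF KL(11)[OF t] rs] by simp
  qed
  show "\<exists>r\<ge>0. B < \<beta>\<^sub>1 r t + \<beta>\<^sub>2 r t" for B
  proof -
    obtain r where "0 \<le> r" "B < \<beta>\<^sub>1 r t" using KL(5)[OF t] by blast
    then show ?thesis using KL(9)[of r t] t by (intro exI[of _ r]) simp
  qed
next
  fix r :: real assume r: "0 \<le> r"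
  note KL = class_KLD(6,7)[OF assms(1) r] class_KLD(6,7)[OF assms(2) r]
  show "antimono_on {0..} (\<lambda>t. \<beta>\<^sub>1 r t + \<beta>\<^sub>2 r t)"
    using KL(1,3) unfolding monotone_on_def by (blast intro: add_mono)
  show "((\<lambda>t. \<beta>\<^sub>1 r t + \<beta>\<^sub>2 r t) \<longlongrightarrow> 0) at_top"
    using tendsto_add[OF KL(2,4)] by simp
qed

text \<open>The passage from uniform boundedness, stability and attractivity to a KL estimate. The
  index stands for a trajectory and \<open>\<rho> i\<close> for its initial distance. Radii are
  discretised, and each level receives an envelope in time.\<close>

lemma class_KL_majorant:
  fixes e :: "'i \<Rightarrow> real \<Rightarrow> real" and \<rho> :: "'i \<Rightarrow> real"
  assumes \<rho>: "\<And>i. i \<in> I \<Longrightarrow> 0 < \<rho> i"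
    and nonneg: "\<And>i t. i \<in> I \<Longrightarrow> 0 \<le> t \<Longrightarrow> 0 \<le> e i t"
    and bounded: "\<And>r. \<exists>B. \<forall>i\<in>I. \<rho> i \<le> r \<longrightarrow> (\<forall>t\<ge>0. e i t \<le> B)"
    and stable: "\<And>\<epsilon>. 0 < \<epsilon> \<Longrightarrow> \<exists>r>0. \<forall>i\<in>I. \<rho> i \<le> r \<longrightarrow> (\<forall>t\<ge>0. e i t \<le> \<epsilon>)"
    and attractive: "\<And>r \<epsilon>. 0 < \<epsilon> \<Longrightarrow> \<exists>\<tau>. \<forall>i\<in>I. \<rho> i \<le> r \<longrightarrow> (\<forall>t\<ge>0. \<tau> \<le> t \<longrightarrow> e i t \<le> \<epsilon>)"
  shows "\<exists>\<beta>\<in>class_KL. \<forall>i\<in>I. \<forall>t\<ge>0. e i t \<le> \<beta> (\<rho> i) t"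
proof -
  \<comment> \<open>Two series of products are added: \<open>\<beta>\<^sub>1\<close> dominates for radii below \<open>s 0\<close>, \<open>\<beta>\<^sub>2\<close> for the others.\<close>
  define envelope where "envelope r B b \<longleftrightarrow> continuous_on {0..} b \<and> antimono_on {0..} b \<and> (b \<longlongrightarrow> 0) at_top \<and>
      (\<forall>t. 0 \<le> b t \<and> b t \<le> B) \<and> (\<forall>i t. i \<in> I \<and> \<rho> i \<le> r \<and> 0 \<le> t \<longrightarrow> e i t \<le> b t)"
    for r B and b :: "real \<Rightarrow> real"
  have env: "\<exists>b. envelope r B b"
    if "0 \<le> B" "\<forall>i\<in>I. \<rho> i \<le> r \<longrightarrow> (\<forall>t\<ge>0. e i t \<le> B)" for r B
  proof (rule antitone_continuous_envelope[of "{i \<in> I. \<rho> i \<le> r}" e B])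
    show "\<exists>\<tau>. \<forall>i\<in>{i \<in> I. \<rho> i \<le> r}. \<forall>t\<ge>0. \<tau> \<le> t \<longrightarrow> e i t \<le> \<epsilon>" if "0 < \<epsilon>" for \<epsilon>
      using attractive[OF that, of r] by auto
    show "\<exists>b. envelope r B b" if "continuous_on {0..} b" "antimono_on {0..} b" "(b \<longlongrightarrow> 0) at_top"
      "\<And>t. 0 \<le> b t" "\<And>t. b t \<le> B" "\<And>i t. i \<in> {i \<in> I. \<rho> i \<le> r} \<Longrightarrow> 0 \<le> t \<Longrightarrow> e i t \<le> b t" for b
      unfolding envelope_def using that by (intro exI[of _ b]) auto
  qed (use that nonneg in auto)
  \<comment> \<open>The bound \<open>(1/2) ^ k\<close> makes the series near radius 0 summable, and
    \<open>1 / Suc k\<close> forces the radii to 0, so that every positive radius is eventually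
    passed.\<close>
  have "\<exists>s>0. s \<le> 1 / real (Suc k) \<and> (\<forall>i\<in>I. \<rho> i \<le> s \<longrightarrow> (\<forall>t\<ge>0. e i t \<le> (1/2) ^ k))" for k
  proof -
    obtain r where "0 < r" "\<forall>i\<in>I. \<rho> i \<le> r \<longrightarrow> (\<forall>t\<ge>0. e i t \<le> (1/2) ^ k)"
      using stable[of "(1/2) ^ k"] by auto
    then show ?thesis by (intro exI[of _ "min r (1 / real (Suc k))"]) auto
  qed
  then obtain s where s: "\<And>k. 0 < s k" "\<And>k. s k \<le> 1 / real (Suc k)"
    "\<And>k. \<forall>i\<in>I. \<rho> i \<le> s k \<longrightarrow> (\<forall>t\<ge>0. e i t \<le> (1/2) ^ k)"
    by metis
  have "\<exists>b. envelope (s k) ((1/2) ^ k) b" for k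
    by (rule env[OF _ s(3)]) simp
  then obtain b where "\<And>k. envelope (s k) ((1/2) ^ k) (b k)" by metis
  then have b: "\<And>k. continuous_on {0..} (b k)" "\<And>k. antimono_on {0..} (b k)"
    "\<And>k. (b k \<longlongrightarrow> 0) at_top" "\<And>k t. 0 \<le> b k t" "\<And>k t. b k t \<le> (1/2) ^ k"
    "\<And>k i t. i \<in> I \<Longrightarrow> \<rho> i \<le> s k \<Longrightarrow> 0 \<le> t \<Longrightarrow> e i t \<le> b k t"
    by (simp_all add: envelope_def)
  \<comment> \<open>This ramp reaches 1 at \<open>s (Suc k)\<close>; from that radius on the
    \<open>k\<close>-th term of the series is the full envelope \<open>b k\<close>.\<close>
  define g where "g k r = min 1 (r / s (Suc k))" for k r
  obtain \<beta>\<^sub>1 where \<beta>1: "\<beta>\<^sub>1 \<in> class_KL" "\<And>k r t. 0 \<le> r \<Longrightarrow> 0 \<le> t \<Longrightarrow> g k r * b k t \<le> \<beta>\<^sub>1 r t"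
  proof (rule class_KL_series[of g b, OF _ _ _ b(1-4)])
    show "continuous_on {0..} (g k)" for k
      unfolding g_def[abs_def] using s(1)[of "Suc k"] by (intro continuous_intros) auto
    show "mono_on {0..} (g k)" for k
      unfolding g_def mono_on_def
      by (intro allI impI min.mono order_refl divide_right_mono less_imp_le[OF s(1)]) auto
    show "g k 0 = 0" for k by (simp add: g_def)
    show "\<exists>M. summable M \<and> (\<forall>k. \<forall>r\<in>{0..R}. \<forall>t\<ge>0. g k r * b k t \<le> M k)" for R
    proof (intro exI conjI allI ballI impI)
      show "summable (\<lambda>k. (1/2::real) ^ k)" by simp
      fix k and r t :: real assume "r \<in> {0..R}"
      have "g k r * b k t \<le> 1 * b k t" by (intro mult_right_mono b(4)) (simp add: g_def)
      then show "g k r * b k t \<le> (1/2) ^ k" using b(5)[of k t] by simp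
    qed
  qed (rule that)
  define a where "a = s 0"
  have a: "0 < a" using s(1) by (simp add: a_def)
  have "\<exists>B\<ge>0. \<forall>i\<in>I. \<rho> i \<le> r \<longrightarrow> (\<forall>t\<ge>0. e i t \<le> B)" for r
  proof -
    obtain B where "\<forall>i\<in>I. \<rho> i \<le> r \<longrightarrow> (\<forall>t\<ge>0. e i t \<le> B)" using bounded by blast
    then show ?thesis by (intro exI[of _ "max B 0"]) (auto simp: le_max_iff_disj)
  qed
  then obtain B where B: "\<And>r. 0 \<le> B r" "\<And>r. \<forall>i\<in>I. \<rho> i \<le> r \<longrightarrow> (\<forall>t\<ge>0. e i t \<le> B r)" by metis
  have "\<exists>c. envelope ((real n + 2) * a) (B ((real n + 2) * a)) c" for n :: nat
    by (rule env[OF B])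
  then obtain c where "\<And>n::nat. envelope ((real n + 2) * a) (B ((real n + 2) * a)) (c n)" by metis
  then have c: "\<And>n::nat. continuous_on {0..} (c n)" "\<And>n. antimono_on {0..} (c n)"
    "\<And>n. (c n \<longlongrightarrow> 0) at_top" "\<And>n t. 0 \<le> c n t" "\<And>n t. c n t \<le> B ((real n + 2) * a)"
    "\<And>n i t. i \<in> I \<Longrightarrow> \<rho> i \<le> (real n + 2) * a \<Longrightarrow> 0 \<le> t \<Longrightarrow> e i t \<le> c n t"
    by (simp_all add: envelope_def)
  \<comment> \<open>The ramp vanishes up to radius \<open>n * a\<close>, so on bounded radii only
    finitely many terms remain and no decay of the constants \<open>B\<close> is required. It is at
    least 1 from \<open>(n + 1) * a\<close> on, while \<open>c n\<close> is an envelope up to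
    \<open>(n + 2) * a\<close>.\<close>
  define h where "h n r = max 0 (r / a - real n)" for n r
  obtain \<beta>\<^sub>2 where \<beta>2: "\<beta>\<^sub>2 \<in> class_KL" "\<And>n r t. 0 \<le> r \<Longrightarrow> 0 \<le> t \<Longrightarrow> h n r * c n t \<le> \<beta>\<^sub>2 r t"
  proof (rule class_KL_series[of h c, OF _ _ _ c(1-4)])
    show "continuous_on {0..} (h n)" for n
      unfolding h_def[abs_def] using a by (intro continuous_intros) auto
    show "mono_on {0..} (h n)" for n
      unfolding h_def mono_on_def
      by (intro allI impI max.mono order_refl diff_right_mono divide_right_mono less_imp_le[OF a]) auto
    show "h n 0 = 0" for n by (simp add: h_def)
    show "\<exists>M. summable M \<and> (\<forall>n. \<forall>r\<in>{0..R}. \<forall>t\<ge>0. h n r * c n t \<le> M n)" if R: "0 \<le> R" for R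
    proof (intro exI conjI allI ballI impI)
      let ?M = "\<lambda>n. if real n \<le> R / a then R / a * B ((real n + 2) * a) else 0"
      show "summable ?M"
      proof (rule summable_finite[of "{..nat \<lceil>R / a\<rceil>}"])
        fix n assume "n \<notin> {..nat \<lceil>R / a\<rceil>}"
        then have "\<not> real n \<le> R / a" by (auto simp: not_le) linarith
        then show "?M n = 0" by simp
      qed simp
      fix n and r t :: real assume r: "r \<in> {0..R}"
      have rR: "r / a \<le> R / a" using r a by (intro divide_right_mono) auto
      show "h n r * c n t \<le> ?M n"
      proof (cases "real n \<le> R / a")
        case True
        have "h n r \<le> R / a" using rR R a by (auto simp: h_def)
        then have "h n r * c n t \<le> R / a * B ((real n + 2) * a)"
          using c(4,5) R a by (intro mult_mono) auto
        then show ?thesis using True by simp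
      next
        case False
        then have "h n r = 0" using rR by (simp add: h_def)
        then show ?thesis using False by simp
      qed
    qed
  qed (rule that)
  have nonneg_KL: "0 \<le> \<beta> r t" if "\<beta> \<in> class_KL" "0 \<le> r" "0 \<le> t" for \<beta> r t
    by (rule class_KLD(2)[OF that])
  have "e i t \<le> \<beta>\<^sub>1 (\<rho> i) t + \<beta>\<^sub>2 (\<rho> i) t" if i: "i \<in> I" and t: "0 \<le> t" for i t
  proof (cases "\<rho> i < a")
    case True
    obtain j :: nat where "1 / \<rho> i < real j" using reals_Archimedean2 by blast
    then have "1 / real (Suc j) < \<rho> i"
      using \<rho>[OF i] by (simp add: field_simps)
    then have ex: "s j \<le> \<rho> i" using s(2)[of j] by linarith
    \<comment> \<open>The least such index is positive, and its predecessor \<open>k\<close>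
      satisfies \<open>\<rho> i < s k\<close>, whatever the order of the values of \<open>s\<close>.
      So the envelope \<open>b k\<close> covers \<open>i\<close> and its ramp is 1.\<close>
    define m where "m = (LEAST j. s j \<le> \<rho> i)"
    have m: "s m \<le> \<rho> i" unfolding m_def by (rule LeastI[of "\<lambda>j. s j \<le> \<rho> i", OF ex])
    have "m \<noteq> 0" using m True unfolding a_def by (metis not_le)
    then obtain k where k: "m = Suc k" using not0_implies_Suc by blast
    then have "\<not> s k \<le> \<rho> i" using not_less_Least[of k "\<lambda>j. s j \<le> \<rho> i"] by (simp add: m_def)
    then have "e i t \<le> b k t" using b(6)[OF i _ t, of k] by simp
    moreover have "g k (\<rho> i) = 1" using m k s(1)[of m] by (simp add: g_def)
    ultimately have "e i t \<le> \<beta>\<^sub>1 (\<rho> i) t" using \<beta>1(2)[of "\<rho> i" t k] \<rho>[OF i] t by simp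
    then show ?thesis using nonneg_KL[OF \<beta>2(1), of "\<rho> i" t] \<rho>[OF i] t by simp
  next
    case False
    \<comment> \<open>This choice gives \<open>(n + 1) * a <= \<rho> i <= (n + 2) * a\<close>. The
      floor is at least 1, so the subtraction on \<open>nat\<close> does not truncate.\<close>
    define n where "n = nat \<lfloor>\<rho> i / a\<rfloor> - 1"
    have "1 \<le> \<rho> i / a" using False a by simp
    then have fl: "1 \<le> \<lfloor>\<rho> i / a\<rfloor>" by simp
    then have n: "real n = real_of_int \<lfloor>\<rho> i / a\<rfloor> - 1" by (simp add: n_def of_nat_diff le_nat_iff)
    have "\<rho> i / a \<le> real n + 2" "1 \<le> \<rho> i / a - real n" using n by linarith+
    then have "\<rho> i \<le> (real n + 2) * a" and h: "1 \<le> h n (\<rho> i)"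
      using a by (simp_all add: pos_divide_le_eq h_def)
    then have "e i t \<le> c n t" using c(6)[OF i _ t] by simp
    also have "\<dots> \<le> h n (\<rho> i) * c n t" using mult_right_mono[OF h c(4)[of n t]] by simp
    also have "\<dots> \<le> \<beta>\<^sub>2 (\<rho> i) t" using \<beta>2(2)[of "\<rho> i" t n] \<rho>[OF i] t by simp
    finally show ?thesis using nonneg_KL[OF \<beta>1(1), of "\<rho> i" t] \<rho>[OF i] t by simp
  qed
  then show ?thesis by (intro bexI[OF _ class_KL_add[OF \<beta>1(1) \<beta>2(1)]]) auto
qed

section \<open>Descent along piecewise constant controls\<close>

text \<open>The descent argument for any dynamics that is jointly continuous off the target and has
  \<open>W\<close> as a minimum restraint function. The target is explicitly nonempty because
  \<open>infdist\<close> to the empty set is 0 by convention.\<close>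

locale restraint_problem =
  fixes \<Omega> C :: "'a::euclidean_space set"
    and f :: "'a \<Rightarrow> 'b::euclidean_space \<Rightarrow> 'a"
    and l :: "'a \<Rightarrow> 'b \<Rightarrow> real"
    and W :: "'a \<Rightarrow> real" and p\<^sub>0 :: real
  assumes open_\<Omega>: "open \<Omega>"
    and target: "closed C" "C \<subseteq> \<Omega>" "C \<noteq> {}" "compact (frontier C)"
    and f_cont: "continuous_on ((\<Omega> - C) \<times> UNIV) (\<lambda>(x, u). f x u)"
    and l_cont: "continuous_on ((\<Omega> - C) \<times> UNIV) (\<lambda>(x, u). l x u)"
    and l_nonneg: "\<And>x u. x \<in> \<Omega> - C \<Longrightarrow> 0 \<le> l x u"
    and p\<^sub>0_nonneg: "0 \<le> p\<^sub>0"
    and mrf: "min_restraint_function p\<^sub>0 UNIV l f C \<Omega> W"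
begin

lemma W_cont: "continuous_on (\<Omega> - interior C) W"
  and W_semiconcave: "locally_semiconcave_on (\<Omega> - C) W"
  and W_pos: "\<And>x. x \<in> \<Omega> - C \<Longrightarrow> 0 < W x"
  and W_frontier: "\<And>x. x \<in> frontier C \<Longrightarrow> W x = 0"
  and W_proper: "\<And>K. compact K \<Longrightarrow> K \<subseteq> {0..} \<Longrightarrow> compact {x \<in> \<Omega> - interior C. W x \<in> K}"
  and W_hamiltonian: "\<And>x p. x \<in> \<Omega> - C \<Longrightarrow> p \<in> limiting_gradients (\<Omega> - C) W x \<Longrightarrow>
    hamiltonian UNIV l f x p\<^sub>0 p < 0"
  using mrf unfolding min_restraint_function_def by auto

lemma open_D: "open (\<Omega> - C)"
  using open_\<Omega> target by auto

lemma W_cont_D: "continuous_on (\<Omega> - C) W"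
  using W_cont by (rule continuous_on_subset) (use interior_subset in auto)

lemma D_subset: "\<Omega> - C \<subseteq> \<Omega> - interior C"
  using interior_subset by auto

lemma continuous_f_fixed: "continuous_on (\<Omega> - C) (\<lambda>x. f x u)"
  using continuous_on_compose2[OF f_cont, of "\<Omega> - C" "\<lambda>x. (x, u)"]
  by (simp add: continuous_on_Pair image_subset_iff)

lemma continuous_l_fixed: "continuous_on (\<Omega> - C) (\<lambda>x. l x u)"
  using continuous_on_compose2[OF l_cont, of "\<Omega> - C" "\<lambda>x. (x, u)"]
  by (simp add: continuous_on_Pair image_subset_iff)

section \<open>Uniform estimates on compact sets away from the target\<close>

definition pre_hamiltonian :: "'a \<times> 'a \<times> 'b \<Rightarrow> real" where
  "pre_hamiltonian = (\<lambda>(x, p, u). p \<bullet> f x u + p\<^sub>0 * l x u)"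

lemma continuous_pre_hamiltonian:
  "continuous_on ((\<Omega> - C) \<times> UNIV \<times> UNIV) pre_hamiltonian"
proof -
  have "continuous_on ((\<Omega> - C) \<times> UNIV \<times> UNIV) (\<lambda>z. (\<lambda>(x, u). f x u) (fst z, snd (snd z)))"
    by (rule continuous_on_compose2[OF f_cont]) (auto intro!: continuous_intros)
  moreover have "continuous_on ((\<Omega> - C) \<times> UNIV \<times> UNIV) (\<lambda>z. (\<lambda>(x, u). l x u) (fst z, snd (snd z)))"
    by (rule continuous_on_compose2[OF l_cont]) (auto intro!: continuous_intros)
  ultimately have "continuous_on ((\<Omega> - C) \<times> UNIV \<times> UNIV)
      (\<lambda>z. fst (snd z) \<bullet> f (fst z) (snd (snd z)) + p\<^sub>0 * l (fst z) (snd (snd z)))"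
    by (auto intro!: continuous_intros)
  then show ?thesis
    unfolding pre_hamiltonian_def by (simp add: case_prod_unfold)
qed

lemma compact_neighbourhood:
  assumes K: "compact K" "K \<subseteq> \<Omega> - C"
  obtains r K' where "0 < r" "compact K'" "K' \<subseteq> \<Omega> - C" "\<And>x. x \<in> K \<Longrightarrow> cball x r \<subseteq> K'"
proof -
  obtain r where r: "0 < r" "(\<Union>x\<in>K. cball x r) \<subseteq> \<Omega> - C"
    using compact_subset_open_imp_cball_epsilon_subset[OF K(1) open_D K(2)] by blast
  let ?K' = "{x + y |x y. x \<in> K \<and> y \<in> cball 0 r}"
  have "compact ?K'" by (rule compact_sums[OF K(1) compact_cball])
  moreover have sub: "cball x r \<subseteq> ?K'" if "x \<in> K" for x
  proof
    fix w assume "w \<in> cball x r"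
    then have "w = x + (w - x) \<and> x \<in> K \<and> w - x \<in> cball 0 r"
      using that by (auto simp: dist_norm norm_minus_commute)
    then show "w \<in> ?K'" by blast
  qed
  moreover have "?K' \<subseteq> \<Omega> - C"
  proof
    fix w assume "w \<in> ?K'"
    then obtain x y where "w = x + y" "x \<in> K" "y \<in> cball 0 r" by blast
    then have "w \<in> cball x r" by (simp add: dist_norm)
    with \<open>x \<in> K\<close> r(2) show "w \<in> \<Omega> - C" by blast
  qed
  ultimately show thesis using r(1) that by blast
qed

text \<open>One semiconcavity constant, taken on a compact neighbourhood \<open>K'\<close> that
  contains the balls of radius \<open>r\<close> around all points of \<open>K\<close>, makes the
  pointwise parabola estimates uniform.\<close>

lemma limiting_gradients_on_compact:
  assumes K: "compact K" "K \<subseteq> \<Omega> - C"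
  obtains r c P K' where "0 < r" "0 < c" "0 < P" "compact K'" "K' \<subseteq> \<Omega> - C"
    "\<And>x. x \<in> K \<Longrightarrow> cball x r \<subseteq> K'"
    "\<And>x. x \<in> K \<Longrightarrow> limiting_gradients (\<Omega> - C) W x \<noteq> {}"
    "\<And>x p. x \<in> K \<Longrightarrow> p \<in> limiting_gradients (\<Omega> - C) W x \<Longrightarrow> norm p \<le> P"
    "\<And>x p w. x \<in> K \<Longrightarrow> p \<in> limiting_gradients (\<Omega> - C) W x \<Longrightarrow> w \<in> cball x r \<Longrightarrow>
      W w \<le> W x + p \<bullet> (w - x) + c * (norm (w - x))\<^sup>2"
proof -
  obtain r K' where r: "0 < r" and K': "compact K'" "K' \<subseteq> \<Omega> - C"
    and sub: "\<And>x. x \<in> K \<Longrightarrow> cball x r \<subseteq> K'"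
    using compact_neighbourhood[OF K] by blast
  from W_semiconcave K' obtain \<rho> where \<rho>: "\<rho> > 0"
    "\<And>z1 z2. closed_segment z1 z2 \<subseteq> K' \<Longrightarrow>
       W z1 + W z2 - 2 * W (midpoint z1 z2) \<le> \<rho> * (norm (z1 - z2))\<^sup>2"
    unfolding locally_semiconcave_on_def by meson
  have "compact (W ` K)"
    by (intro compact_continuous_image continuous_on_subset[OF W_cont_D] K)
  then obtain M where M: "0 < M" "\<And>w. w \<in> K \<Longrightarrow> \<bar>W w\<bar> \<le> M"
    using compact_imp_bounded[of "W ` K"] by (auto simp: bounded_pos)
  define P where "P = (M + \<bar>2 * \<rho>\<bar> * r\<^sup>2) / r"
  have cont: "continuous_on (cball x r) W" if "x \<in> K" for x
    using that sub K'(2) by (intro continuous_on_subset[OF W_cont_D]) blast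
  have pos: "0 \<le> W w" if "x \<in> K" "w \<in> cball x r" for x w
    using that sub K'(2) by (intro less_imp_le W_pos) blast
  have sc: "W z1 + W z2 - 2 * W (midpoint z1 z2) \<le> \<rho> * (norm (z1 - z2))\<^sup>2"
    if "x \<in> K" "closed_segment z1 z2 \<subseteq> cball x r" for x z1 z2
    using that sub by (intro \<rho>) blast
  have parabola: "W w \<le> W x + p \<bullet> (w - x) + 2 * \<rho> * (norm (w - x))\<^sup>2"
    if "x \<in> K" "p \<in> limiting_gradients (\<Omega> - C) W x" "w \<in> cball x r" for x p w
    by (rule limiting_gradient_upper_parabola[OF sc cont r]) (use that in auto)
  show thesis
  proof (rule that[of r "2 * \<rho>" P K'])
    show "0 < P"
      using r M \<rho> by (auto simp: P_def intro!: divide_pos_pos add_pos_nonneg)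
    fix x assume x: "x \<in> K"
    have "cball x r \<subseteq> \<Omega> - C" using sub[OF x] K'(2) by blast
    then show "limiting_gradients (\<Omega> - C) W x \<noteq> {}"
      by (intro limiting_gradients_nonempty[OF sc[OF x] cont[OF x] r _ pos[OF x]])
    fix p assume p: "p \<in> limiting_gradients (\<Omega> - C) W x"
    have "norm p \<le> (W x + \<bar>2 * \<rho>\<bar> * r\<^sup>2) / r"
      by (rule norm_le_of_upper_parabola[OF parabola pos r]) (use x p in auto)
    also have "\<dots> \<le> P"
      unfolding P_def using M(2)[OF x] r by (intro divide_right_mono add_right_mono) auto
    finally show "norm p \<le> P" .
  qed (use r \<rho> K' sub parabola in auto)
qed

text \<open>A single \<open>n\<close> serves as control bound and as reciprocal of the margin. If no
  \<open>n\<close> works, the failing points and their gradients have a limit \<open>(x, p)\<close>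
  with \<open>p\<close> a limiting gradient at \<open>x\<close>. A control that is good at the limit
  is eventually within the bound, and continuity contradicts the failure.\<close>

lemma uniform_control:
  assumes K: "compact K" "K \<subseteq> \<Omega> - C"
  obtains B \<gamma> where "0 < B" "0 < \<gamma>"
    "\<And>x. x \<in> K \<Longrightarrow> \<exists>p\<in>limiting_gradients (\<Omega> - C) W x. \<exists>u\<in>cball 0 B. pre_hamiltonian (x, p, u) \<le> - \<gamma>"
proof -
  obtain r c P K' where reg: "\<And>x. x \<in> K \<Longrightarrow> limiting_gradients (\<Omega> - C) W x \<noteq> {}"
    "\<And>x p. x \<in> K \<Longrightarrow> p \<in> limiting_gradients (\<Omega> - C) W x \<Longrightarrow> norm p \<le> P"
    using limiting_gradients_on_compact[OF K] by metis
  have "\<exists>n::nat. \<forall>x\<in>K. \<exists>p\<in>limiting_gradients (\<Omega> - C) W x. \<exists>u\<in>cball 0 (real (Suc n)).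
      pre_hamiltonian (x, p, u) \<le> - (1 / Suc n)"
  proof (rule ccontr)
    assume "\<not> ?thesis"
    then have "\<exists>x\<in>K. \<forall>p\<in>limiting_gradients (\<Omega> - C) W x. \<forall>u\<in>cball 0 (real (Suc n)).
        - (1 / Suc n) < pre_hamiltonian (x, p, u)" for n :: nat
      by (meson not_le)
    then obtain X where X: "\<And>n::nat. X n \<in> K"
      "\<And>n p u. p \<in> limiting_gradients (\<Omega> - C) W (X n) \<Longrightarrow> u \<in> cball 0 (real (Suc n)) \<Longrightarrow>
         - (1 / Suc n) < pre_hamiltonian (X n, p, u)"
      by metis
    have "\<exists>p. p \<in> limiting_gradients (\<Omega> - C) W (X n)" for n using reg(1)[OF X(1)] by blast
    then obtain Q where Q: "\<And>n. Q n \<in> limiting_gradients (\<Omega> - C) W (X n)" by metis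
    have XQ: "(X n, Q n) \<in> K \<times> cball 0 P" for n using X(1) reg(2)[OF X(1) Q] by simp
    have "seq_compact (K \<times> cball (0::'a) P)"
      by (intro compact_imp_seq_compact compact_Times K compact_cball)
    from seq_compactE[OF this, of "\<lambda>n. (X n, Q n)"] XQ obtain z k where zk: "z \<in> K \<times> cball 0 P" "strict_mono (k :: nat \<Rightarrow> nat)"
      "((\<lambda>n. (X n, Q n)) \<circ> k) \<longlonglongrightarrow> z"
      by metis
    obtain x p where z: "z = (x, p)" by (cases z)
    have lim: "(\<lambda>n. X (k n)) \<longlonglongrightarrow> x" "(\<lambda>n. Q (k n)) \<longlonglongrightarrow> p"
      using tendsto_fst[OF zk(3)] tendsto_snd[OF zk(3)] by (auto simp: z o_def)
    have x: "x \<in> \<Omega> - C" using zk(1) z K by auto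
    have "p \<in> limiting_gradients (\<Omega> - C) W x"
      by (rule limiting_gradients_closed_graph[OF lim Q])
    from W_hamiltonian[OF x this] obtain u where u: "pre_hamiltonian (x, p, u) < 0"
      by (auto simp: hamiltonian_def INF_less_iff pre_hamiltonian_def)
    have "(\<lambda>n. (X (k n), Q (k n), u)) \<longlonglongrightarrow> (x, p, u)"
      by (intro tendsto_Pair lim tendsto_const)
    then have "(\<lambda>n. pre_hamiltonian (X (k n), Q (k n), u)) \<longlonglongrightarrow> pre_hamiltonian (x, p, u)"
      by (rule continuous_on_tendsto_compose[OF continuous_pre_hamiltonian])
        (use x subsetD[OF K(2) X(1)] in auto)
    moreover have "(\<lambda>n. - (1 / real (Suc (k n)))) \<longlonglongrightarrow> 0"
    proof -
      have "(\<lambda>n. - (1 / real (Suc n))) \<longlonglongrightarrow> 0"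
        using tendsto_minus[OF LIMSEQ_inverse_real_of_nat] by (simp add: inverse_eq_divide)
      from LIMSEQ_subseq_LIMSEQ[OF this zk(2)] show ?thesis by (simp add: o_def)
    qed
    moreover have "\<forall>\<^sub>F n in sequentially. - (1 / real (Suc (k n))) \<le> pre_hamiltonian (X (k n), Q (k n), u)"
    proof -
      obtain N :: nat where N: "norm u \<le> real N" using real_arch_simple by blast
      have "- (1 / real (Suc (k n))) \<le> pre_hamiltonian (X (k n), Q (k n), u)" if "n \<ge> N" for n
      proof -
        have "N \<le> k n" using seq_suble[OF zk(2), of n] that by linarith
        then have "norm u \<le> real (Suc (k n))" using N by linarith
        then show ?thesis by (intro less_imp_le X(2) Q) simp
      qed
      then show ?thesis unfolding eventually_sequentially by blast
    qed
    ultimately have "0 \<le> pre_hamiltonian (x, p, u)"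
      using tendsto_le[OF sequentially_bot] by blast
    with u show False by simp
  qed
  then obtain n :: nat where "\<And>x. x \<in> K \<Longrightarrow> \<exists>p\<in>limiting_gradients (\<Omega> - C) W x.
      \<exists>u\<in>cball 0 (real (Suc n)). pre_hamiltonian (x, p, u) \<le> - (1 / Suc n)"
    by blast
  then show thesis by (intro that[of "real (Suc n)" "1 / Suc n"]) auto
qed

text \<open>The inequality is required at every time: intermediate times control \<open>W\<close>
  between nodes, the final time gives the cost estimate that telescopes.\<close>

definition descent_step :: "real \<Rightarrow> real \<Rightarrow> 'a \<Rightarrow> 'b \<Rightarrow> (real \<Rightarrow> 'a) \<Rightarrow> bool" where
  "descent_step \<gamma> \<delta> x u y \<longleftrightarrow> y 0 = x \<and>
     (\<forall>t\<in>{0..\<delta>}. y t \<in> \<Omega> - C \<and>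
       (y has_vector_derivative f (y t) u) (at t within {0..\<delta>}) \<and>
       W (y t) + p\<^sub>0 * integral {0..t} (\<lambda>s. l (y s) u) + \<gamma> * t \<le> W x)"

lemma uniform_descent_step:
  assumes K: "compact K" "K \<subseteq> \<Omega> - C"
  obtains \<gamma> \<delta> where "0 < \<gamma>" "0 < \<delta>" "\<delta> \<le> 1" "\<And>x. x \<in> K \<Longrightarrow> \<exists>u y. descent_step \<gamma> \<delta> x u y"
proof -
  obtain r c P K' where r: "0 < r" and c: "0 < c" and K': "compact K'" "K' \<subseteq> \<Omega> - C"
    and sub: "\<And>x. x \<in> K \<Longrightarrow> cball x r \<subseteq> K'"
    and P: "\<And>x p. x \<in> K \<Longrightarrow> p \<in> limiting_gradients (\<Omega> - C) W x \<Longrightarrow> norm p \<le> P"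
    and parabola: "\<And>x p w. x \<in> K \<Longrightarrow> p \<in> limiting_gradients (\<Omega> - C) W x \<Longrightarrow> w \<in> cball x r \<Longrightarrow>
      W w \<le> W x + p \<bullet> (w - x) + c * (norm (w - x))\<^sup>2"
    using limiting_gradients_on_compact[OF K] by metis
  obtain B \<gamma> where \<gamma>: "0 < \<gamma>" and ctrl:
    "\<And>x. x \<in> K \<Longrightarrow> \<exists>p\<in>limiting_gradients (\<Omega> - C) W x. \<exists>u\<in>cball 0 B. pre_hamiltonian (x, p, u) \<le> - \<gamma>"
    using uniform_control[OF K] by metis
  have "compact ((\<lambda>(x, u). f x u) ` (K' \<times> cball 0 B))"
    using K' by (intro compact_continuous_image continuous_on_subset[OF f_cont] compact_Times) auto
  then obtain m where m: "0 < m" "\<And>x u. x \<in> K' \<Longrightarrow> u \<in> cball 0 B \<Longrightarrow> norm (f x u) \<le> m"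
    using compact_imp_bounded[of "(\<lambda>(x, u). f x u) ` (K' \<times> cball 0 B)"]
    by (force simp: bounded_pos)
  have "uniformly_continuous_on (K' \<times> cball 0 P \<times> cball 0 B) pre_hamiltonian"
    using K' by (intro compact_uniformly_continuous continuous_on_subset[OF continuous_pre_hamiltonian] compact_Times) auto
  then obtain e where e: "0 < e" "\<And>a b. a \<in> K' \<times> cball 0 P \<times> cball 0 B \<Longrightarrow> b \<in> K' \<times> cball 0 P \<times> cball 0 B \<Longrightarrow>
      dist b a < e \<Longrightarrow> dist (pre_hamiltonian b) (pre_hamiltonian a) < \<gamma> / 4"
    unfolding uniformly_continuous_on_def using \<gamma> by (metis zero_less_divide_iff zero_less_numeral)
  define \<delta> where "\<delta> = Min {1, r / m, e / (2 * m), \<gamma> / (4 * c * m\<^sup>2)}"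
  have \<delta>: "0 < \<delta>" "\<delta> \<le> 1" "m * \<delta> \<le> r" "m * \<delta> < e" "c * m\<^sup>2 * \<delta> \<le> \<gamma> / 4"
  proof -
    show "0 < \<delta>" using r e \<gamma> c m by (simp add: \<delta>_def)
    show "\<delta> \<le> 1" by (simp add: \<delta>_def)
    have "\<delta> \<le> r / m" "\<delta> \<le> e / (2 * m)" "\<delta> \<le> \<gamma> / (4 * c * m\<^sup>2)" by (simp_all add: \<delta>_def)
    then have "m * \<delta> \<le> r" "2 * (m * \<delta>) \<le> e" "4 * (c * m\<^sup>2 * \<delta>) \<le> \<gamma>"
      using m c by (simp_all add: pos_le_divide_eq mult.commute mult.left_commute)
    with e show "m * \<delta> \<le> r" "m * \<delta> < e" "c * m\<^sup>2 * \<delta> \<le> \<gamma> / 4" by auto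
  qed
  show thesis
  proof (rule that[of "\<gamma> / 2" \<delta>])
    fix x assume x: "x \<in> K"
    from ctrl[OF x] obtain p u where p: "p \<in> limiting_gradients (\<Omega> - C) W x"
      and u: "u \<in> cball 0 B" and H: "pre_hamiltonian (x, p, u) \<le> - \<gamma>" by blast
    have cont: "continuous_on (cball x r) (\<lambda>x. f x u)"
      using sub[OF x] K'(2) by (intro continuous_on_subset[OF continuous_f_fixed]) auto
    have bd: "norm (f w u) \<le> m" if "w \<in> cball x r" for w
      using that sub[OF x] u by (intro m) auto
    obtain y where y: "y 0 = x" "\<And>t. t \<in> {0..\<delta>} \<Longrightarrow> norm (y t - x) \<le> m * t"
      "\<And>t. t \<in> {0..\<delta>} \<Longrightarrow> (y has_vector_derivative f (y t) u) (at t within {0..\<delta>})"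
      using peano_cball[OF cont bd \<delta>(1,3)] r by (metis less_imp_le)
    have yr: "norm (y t - x) \<le> m * \<delta>" if "t \<in> {0..\<delta>}" for t
      using order_trans[OF y(2)[OF that], of "m * \<delta>"] mult_left_mono[of t \<delta> m] that m(1) by simp
    have yc: "y t \<in> cball x r" if "t \<in> {0..\<delta>}" for t
      using yr[OF that] \<delta>(3) by (simp add: dist_norm norm_minus_commute)
    have yK: "y t \<in> K'" if "t \<in> {0..\<delta>}" for t using yc[OF that] sub[OF x] by blast
    have yD: "y t \<in> \<Omega> - C" if "t \<in> {0..\<delta>}" for t using yK[OF that] K'(2) by blast
    have ycont: "continuous_on {0..\<delta>} y"
      by (rule continuous_on_vector_derivative[OF y(3)])
    have lcont: "continuous_on {0..\<delta>} (\<lambda>s. l (y s) u)"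
      by (rule continuous_on_compose2[OF continuous_l_fixed ycont]) (use yD in auto)
    have "W (y t) + p\<^sub>0 * integral {0..t} (\<lambda>s. l (y s) u) + \<gamma> / 2 * t \<le> W x" if t: "t \<in> {0..\<delta>}" for t
    proof -
      have sub_t: "{0..t} \<subseteq> {0..\<delta>}" using t by auto
      \<comment> \<open>With \<open>p\<close> frozen, the linear part of the parabola plus the
        weighted cost is the integral of \<open>pre_hamiltonian\<close> along the solution, so no
        chain rule for \<open>W\<close> is involved.\<close>
      have "((\<lambda>s. p \<bullet> f (y s) u) has_integral (p \<bullet> y t - p \<bullet> y 0)) {0..t}"
      proof (rule fundamental_theorem_of_calculus)
        fix s assume "s \<in> {0..t}"
        then have "(y has_vector_derivative f (y s) u) (at s within {0..t})"
          using y(3) sub_t by (blast intro: has_vector_derivative_within_subset)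
        then show "((\<lambda>s. p \<bullet> y s) has_vector_derivative p \<bullet> f (y s) u) (at s within {0..t})"
          by (rule bounded_linear.has_vector_derivative[OF bounded_linear_inner_right])
      qed (use t in simp)
      moreover have "((\<lambda>s. l (y s) u) has_integral integral {0..t} (\<lambda>s. l (y s) u)) {0..t}"
        by (intro integrable_integral integrable_continuous_real continuous_on_subset[OF lcont sub_t])
      ultimately have int: "((\<lambda>s. p \<bullet> f (y s) u + p\<^sub>0 * l (y s) u) has_integral
          (p \<bullet> y t - p \<bullet> y 0 + p\<^sub>0 * integral {0..t} (\<lambda>s. l (y s) u))) {0..t}"
        by (intro has_integral_add has_integral_mult_right)
      have "p \<bullet> y t - p \<bullet> y 0 + p\<^sub>0 * integral {0..t} (\<lambda>s. l (y s) u) \<le> - (3 * \<gamma> / 4) * t"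
      proof (rule has_integral_le[OF int])
        show "((\<lambda>s. - (3 * \<gamma> / 4)) has_integral - (3 * \<gamma> / 4) * t) {0..t}"
          using has_integral_const_real[of "- (3 * \<gamma> / 4)" 0 t] t by (simp add: mult.commute)
        fix s assume s: "s \<in> {0..t}"
        then have s': "s \<in> {0..\<delta>}" using sub_t by auto
        have "dist (pre_hamiltonian (y s, p, u)) (pre_hamiltonian (x, p, u)) < \<gamma> / 4"
        proof (rule e(2))
          show "(x, p, u) \<in> K' \<times> cball 0 P \<times> cball 0 B"
            using P[OF x p] u sub[OF x] r by auto
          show "(y s, p, u) \<in> K' \<times> cball 0 P \<times> cball 0 B"
            using P[OF x p] u yK[OF s'] by auto
          show "dist (y s, p, u) (x, p, u) < e"
            using yr[OF s'] \<delta>(4) by (simp add: dist_Pair_Pair dist_norm)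
        qed
        then have "pre_hamiltonian (y s, p, u) \<le> - (3 * \<gamma> / 4)"
          using H unfolding dist_real_def by linarith
        then show "p \<bullet> f (y s) u + p\<^sub>0 * l (y s) u \<le> - (3 * \<gamma> / 4)"
          by (simp add: pre_hamiltonian_def)
      qed
      moreover have "W (y t) \<le> W x + p \<bullet> (y t - x) + c * (norm (y t - x))\<^sup>2"
        by (rule parabola[OF x p yc[OF t]])
      moreover have "c * (norm (y t - x))\<^sup>2 \<le> \<gamma> / 4 * t"
      proof -
        have "c * (norm (y t - x))\<^sup>2 \<le> c * (m * t)\<^sup>2"
          using y(2)[OF t] c by (intro mult_left_mono power_mono) auto
        also have "\<dots> = c * m\<^sup>2 * t * t" by (simp add: power2_eq_square)
        also have "\<dots> \<le> c * m\<^sup>2 * \<delta> * t" using t c by (intro mult_right_mono mult_left_mono) auto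
        also have "\<dots> \<le> \<gamma> / 4 * t" using \<delta>(5) t by (intro mult_right_mono) auto
        finally show ?thesis .
      qed
      ultimately show ?thesis by (simp add: y(1) inner_diff_right)
    qed
    then have "descent_step (\<gamma> / 2) \<delta> x u y"
      unfolding descent_step_def using y yD by auto
    then show "\<exists>u y. descent_step (\<gamma> / 2) \<delta> x u y" by blast
  qed (use \<gamma> \<delta> in auto)
qed

text \<open>Properness alone gives a compact set that may touch the target; \<open>a > 0\<close>
  excludes its frontier, where \<open>W\<close> vanishes.\<close>

lemma compact_level_band:
  assumes "0 < a"
  shows "compact {x \<in> \<Omega> - interior C. W x \<in> {a..b}}"
    and "{x \<in> \<Omega> - interior C. W x \<in> {a..b}} \<subseteq> \<Omega> - C"
proof -
  show "compact {x \<in> \<Omega> - interior C. W x \<in> {a..b}}"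
    using assms by (intro W_proper) auto
  show "{x \<in> \<Omega> - interior C. W x \<in> {a..b}} \<subseteq> \<Omega> - C"
  proof safe
    fix x assume x: "x \<in> \<Omega>" "x \<notin> interior C" "W x \<in> {a..b}" "x \<in> C"
    then have "x \<in> frontier C" using target(1) by (simp add: frontier_def)
    then show False using W_frontier[of x] x assms by simp
  qed
qed

lemma step_selection:
  obtains \<gamma> \<delta> u y where
    "\<And>x. x \<in> \<Omega> - C \<Longrightarrow> 0 < \<gamma> x \<and> 0 < \<delta> x \<and> \<delta> x \<le> 1 \<and> descent_step (\<gamma> x) (\<delta> x) x (u x) (y x)"
    "\<And>a b. 0 < a \<Longrightarrow> \<exists>g>0. \<exists>h>0. \<forall>x\<in>\<Omega> - C. a \<le> W x \<and> W x \<le> b \<longrightarrow> g \<le> \<gamma> x \<and> h \<le> \<delta> x"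
proof -
  \<comment> \<open>every level band meets only finitely many of these dyadic shells\<close>
  define K where "K i = {x \<in> \<Omega> - interior C. W x \<in> {2 powr real_of_int i..2 powr (real_of_int i + 1)}}" for i :: int
  have "\<exists>g h. 0 < g \<and> 0 < h \<and> h \<le> 1 \<and> (\<forall>x\<in>K i. \<exists>u y. descent_step g h x u y)" for i
  proof -
    have "compact (K i)" "K i \<subseteq> \<Omega> - C" unfolding K_def by (intro compact_level_band; simp)+
    then obtain g h where "0 < g" "0 < h" "h \<le> 1" "\<And>x. x \<in> K i \<Longrightarrow> \<exists>u y. descent_step g h x u y"
      using uniform_descent_step[of "K i"] by blast
    then show ?thesis by blast
  qed
  then obtain G H where GH: "\<And>i. 0 < G i" "\<And>i. 0 < H i" "\<And>i. H i \<le> (1::real)"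
    "\<And>i x. x \<in> K i \<Longrightarrow> \<exists>u y. descent_step (G i) (H i) x u y"
    by metis
  define sh where "sh x = \<lfloor>log 2 (W x)\<rfloor>" for x
  have sh: "x \<in> K (sh x)" if x: "x \<in> \<Omega> - C" for x
  proof -
    have "2 powr real_of_int (sh x) \<le> 2 powr log 2 (W x)" "2 powr log 2 (W x) \<le> 2 powr (real_of_int (sh x) + 1)"
      unfolding sh_def by (intro powr_mono; linarith)+
    moreover have "2 powr log 2 (W x) = W x" using W_pos[OF x] by simp
    ultimately show ?thesis unfolding K_def using x D_subset by auto
  qed
  have "\<forall>x\<in>\<Omega> - C. \<exists>u y. descent_step (G (sh x)) (H (sh x)) x u y" using GH(4)[OF sh] by blast
  then obtain u y where uy: "\<forall>x\<in>\<Omega> - C. descent_step (G (sh x)) (H (sh x)) x (u x) (y x)"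
    by metis
  show thesis
  proof (rule that[of "\<lambda>x. G (sh x)" "\<lambda>x. H (sh x)" u y])
    fix a b :: real assume a: "0 < a"
    let ?I = "{\<lfloor>log 2 a\<rfloor>..\<lfloor>log 2 b\<rfloor>}"
    have sub: "sh x \<in> ?I" if "x \<in> \<Omega> - C" "a \<le> W x" "W x \<le> b" for x
      unfolding sh_def using that a W_pos[of x] by (auto intro!: floor_mono)
    \<comment> \<open>Inserting 1 keeps \<open>Min\<close> meaningful when the range of shells is
      empty.\<close>
    let ?g = "Min (insert 1 (G ` ?I))" and ?h = "Min (insert 1 (H ` ?I))"
    have "0 < ?g" "0 < ?h" using GH by (auto simp: Min_gr_iff)
    moreover have "?g \<le> G (sh x)" "?h \<le> H (sh x)" if "x \<in> \<Omega> - C" "a \<le> W x" "W x \<le> b" for x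
      using sub[OF that] by (intro Min_le; simp)+
    ultimately show "\<exists>g>0. \<exists>h>0. \<forall>x\<in>\<Omega> - C. a \<le> W x \<and> W x \<le> b \<longrightarrow> g \<le> G (sh x) \<and> h \<le> H (sh x)"
      by blast
  qed (use GH uy in auto)
qed

section \<open>Comparison of \<open>W\<close> with the distance from the target\<close>

lemma infdist_small_of_W_small:
  assumes "0 < \<epsilon>"
  obtains \<eta> where "0 < \<eta>" "\<And>x. x \<in> \<Omega> - C \<Longrightarrow> W x \<le> \<eta> \<Longrightarrow> infdist x C < \<epsilon>"
proof -
  have "\<exists>n::nat. \<forall>x\<in>\<Omega> - C. W x \<le> 1 / Suc n \<longrightarrow> infdist x C < \<epsilon>"
  proof (rule ccontr)
    assume "\<not> ?thesis"
    then have "\<exists>x\<in>\<Omega> - C. W x \<le> 1 / Suc n \<and> \<epsilon> \<le> infdist x C" for n :: nat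
      by (meson not_le)
    then obtain X where X: "\<And>n::nat. X n \<in> \<Omega> - C" "\<And>n. W (X n) \<le> 1 / Suc n" "\<And>n. \<epsilon> \<le> infdist (X n) C"
      by metis
    \<comment> \<open>Properness makes this sublevel set compact, so the counterexamples accumulate
      at a point with \<open>W = 0\<close>, which must lie in \<open>C\<close>.\<close>
    let ?K = "{x \<in> \<Omega> - interior C. W x \<in> {0..1}}"
    have cpt: "compact ?K" by (intro W_proper) auto
    have XK: "\<forall>n. X n \<in> ?K"
    proof
      fix n
      have "1 / real (Suc n) \<le> 1" by simp
      then have "W (X n) \<le> 1" using X(2)[of n] by linarith
      then show "X n \<in> ?K" using X(1)[of n] D_subset W_pos[OF X(1)[of n]] by auto
    qed
    obtain x k where x: "x \<in> ?K" "strict_mono (k :: nat \<Rightarrow> nat)" "(X \<circ> k) \<longlonglongrightarrow> x"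
      by (rule seq_compactE[OF compact_imp_seq_compact[OF cpt] XK])
    have "(\<lambda>n. W ((X \<circ> k) n)) \<longlonglongrightarrow> W x"
      by (rule continuous_on_tendsto_compose[OF W_cont x(3)]) (use x(1) XK in auto)
    moreover have "(\<lambda>n. 1 / real (Suc (k n))) \<longlonglongrightarrow> 0"
      using LIMSEQ_subseq_LIMSEQ[OF LIMSEQ_inverse_real_of_nat x(2)] by (simp add: o_def inverse_eq_divide)
    ultimately have "W x \<le> 0"
      using X(2) by (intro tendsto_le[OF sequentially_bot, where f = "\<lambda>n. 1 / real (Suc (k n))"]) auto
    then have "x \<in> C" using W_pos[of x] x(1) by force
    moreover have "(\<lambda>n. infdist ((X \<circ> k) n) C) \<longlonglongrightarrow> infdist x C"
      by (intro tendsto_infdist x(3))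
    then have "\<epsilon> \<le> infdist x C"
      by (rule tendsto_lowerbound) (use X(3) in auto)
    ultimately show False using assms by simp
  qed
  then obtain n :: nat where "\<forall>x\<in>\<Omega> - C. W x \<le> 1 / Suc n \<longrightarrow> infdist x C < \<epsilon>" by blast
  then show thesis by (intro that[of "1 / real (Suc n)"]) auto
qed

lemma infdist_bounded_on_sublevel:
  obtains R where "\<And>x. x \<in> \<Omega> - C \<Longrightarrow> W x \<le> c \<Longrightarrow> infdist x C \<le> R"
proof -
  let ?K = "{x \<in> \<Omega> - interior C. W x \<in> {0..c}}"
  have "compact ?K" by (intro W_proper) auto
  then have "compact ((\<lambda>x. infdist x C) ` ?K)"
    by (intro compact_continuous_image continuous_intros)
  then obtain R where R: "\<And>x. x \<in> ?K \<Longrightarrow> \<bar>infdist x C\<bar> \<le> R"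
    using compact_imp_bounded by (fastforce simp: bounded_iff)
  have "infdist x C \<le> R" if "x \<in> \<Omega> - C" "W x \<le> c" for x
    using R[of x] that D_subset W_pos[of x] by force
  then show thesis by (rule that)
qed

text \<open>The target itself may be unbounded. The segment from a point outside it to a nearest
  point of \<open>C\<close> meets the frontier, so the set lies within distance \<open>r\<close> of
  the compact frontier.\<close>

lemma compact_infdist_sublevel:
  assumes Z: "closed Z"
  shows "compact {z \<in> Z - interior C. infdist z C \<le> r}" (is "compact ?K")
proof -
  have "closed (Z - interior C)" using Z by (intro closed_Diff) auto
  then have "closed ((Z - interior C) \<inter> {z. infdist z C \<le> r})"
    by (rule closed_Int) (intro closed_Collect_le continuous_intros)
  moreover have "?K = (Z - interior C) \<inter> {z. infdist z C \<le> r}" by auto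
  ultimately have "closed ?K" by simp
  moreover have "bounded ?K"
  proof -
    obtain M where M: "\<And>w. w \<in> frontier C \<Longrightarrow> norm w \<le> M"
      using compact_imp_bounded[OF target(4)] by (auto simp: bounded_iff)
    have "norm z \<le> M + r" if z: "z \<in> ?K" for z
    proof -
      obtain w where w: "w \<in> C" "infdist z C = dist z w"
        using infdist_attains_inf[OF target(1,3)] by blast
      have "\<exists>w'\<in>frontier C. dist z w' \<le> r"
      proof (cases "z \<in> C")
        case True
        then show ?thesis using z target(1)
          by (intro bexI[of _ z]) (auto simp: frontier_def)
      next
        case False
        then have "closed_segment z w \<inter> frontier C \<noteq> {}"
          using w(1) by (intro connected_Int_frontier) auto
        then obtain w' where w': "w' \<in> closed_segment z w" "w' \<in> frontier C" by blast
        have "dist z w' \<le> dist z w"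
          using segment_bound(1)[OF w'(1)] by (simp add: dist_norm norm_minus_commute)
        also have "\<dots> \<le> r" using w z by simp
        finally show ?thesis using w'(2) by blast
      qed
      then obtain w' where "w' \<in> frontier C" "dist z w' \<le> r" by blast
      then show ?thesis using M[of w'] norm_triangle_sub[of z w'] by (simp add: dist_norm)
    qed
    then show ?thesis by (auto simp: bounded_iff)
  qed
  ultimately show ?thesis by (simp add: compact_eq_bounded_closed)
qed

text \<open>Closedness of \<open>Z\<close> in the whole space makes the set compact, and
  \<open>Z \<subseteq> \<Omega>\<close> keeps it where \<open>W\<close> is continuous. For
  \<open>Z = \<Omega>\<close> itself \<open>W\<close> may blow up at the boundary of
  \<open>\<Omega>\<close>; this is why uniform bounds are sought on closed subsets.\<close>

lemma W_bounded_of_infdist_bounded: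
  assumes Z: "closed Z" "Z \<subseteq> \<Omega>"
  obtains c where "\<And>z. z \<in> Z - C \<Longrightarrow> infdist z C \<le> r \<Longrightarrow> W z \<le> c"
proof -
  let ?K = "{z \<in> Z - interior C. infdist z C \<le> r}"
  have "compact (W ` ?K)"
    using compact_infdist_sublevel[OF Z(1)] Z(2)
    by (intro compact_continuous_image continuous_on_subset[OF W_cont]) auto
  then obtain c where c: "\<And>x. x \<in> ?K \<Longrightarrow> \<bar>W x\<bar> \<le> c"
    using compact_imp_bounded by (fastforce simp: bounded_iff)
  have "W z \<le> c" if "z \<in> Z - C" "infdist z C \<le> r" for z
    using c[of z] that interior_subset[of C] by force
  then show thesis by (rule that)
qed

text \<open>Counterexamples with distance tending to 0 stay in a compact part of \<open>Z\<close>,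
  and their limit lies on the frontier of \<open>C\<close>, where \<open>W\<close> vanishes.\<close>

lemma W_small_of_infdist_small:
  assumes Z: "closed Z" "Z \<subseteq> \<Omega>" and \<eta>: "0 < \<eta>"
  obtains r where "0 < r" "\<And>z. z \<in> Z - C \<Longrightarrow> infdist z C \<le> r \<Longrightarrow> W z \<le> \<eta>"
proof -
  have "\<exists>n::nat. \<forall>z\<in>Z - C. infdist z C \<le> 1 / Suc n \<longrightarrow> W z \<le> \<eta>"
  proof (rule ccontr)
    assume "\<not> ?thesis"
    then have "\<exists>z\<in>Z - C. infdist z C \<le> 1 / Suc n \<and> \<eta> \<le> W z" for n :: nat
      by (meson not_le less_imp_le)
    then obtain X where X: "\<And>n::nat. X n \<in> Z - C" "\<And>n. infdist (X n) C \<le> 1 / Suc n" "\<And>n. \<eta> \<le> W (X n)"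
      by metis
    let ?K = "{z \<in> Z - interior C. infdist z C \<le> 1}"
    have XK: "\<forall>n. X n \<in> ?K"
    proof
      fix n
      have "1 / real (Suc n) \<le> 1" by simp
      then have "infdist (X n) C \<le> 1" using X(2)[of n] by linarith
      then show "X n \<in> ?K" using X(1)[of n] interior_subset[of C] by auto
    qed
    obtain x k where x: "x \<in> ?K" "strict_mono (k :: nat \<Rightarrow> nat)" "(X \<circ> k) \<longlonglongrightarrow> x"
      by (rule seq_compactE[OF compact_imp_seq_compact[OF compact_infdist_sublevel[OF Z(1)]] XK])
    have "(\<lambda>n. infdist ((X \<circ> k) n) C) \<longlonglongrightarrow> infdist x C"
      by (intro tendsto_infdist x(3))
    moreover have "(\<lambda>n. 1 / real (Suc (k n))) \<longlonglongrightarrow> 0"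
      using LIMSEQ_subseq_LIMSEQ[OF LIMSEQ_inverse_real_of_nat x(2)] by (simp add: o_def inverse_eq_divide)
    ultimately have "infdist x C \<le> 0"
      using X(2) by (intro tendsto_le[OF sequentially_bot, where f = "\<lambda>n. 1 / real (Suc (k n))"]) auto
    then have "infdist x C = 0" using infdist_nonneg[of x C] by linarith
    then have "x \<in> C" using in_closed_iff_infdist_zero[OF target(1,3)] by simp
    then have "x \<in> frontier C" using x(1) target(1) by (auto simp: frontier_def)
    moreover have "(\<lambda>n. W ((X \<circ> k) n)) \<longlonglongrightarrow> W x"
      by (rule continuous_on_tendsto_compose[OF W_cont x(3)]) (use x(1) subsetD[OF Z(2)] XK in auto)
    then have "\<eta> \<le> W x"
      by (rule tendsto_lowerbound) (use X(3) in auto)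
    ultimately show False using W_frontier[of x] \<eta> by simp
  qed
  then obtain n :: nat where "\<forall>z\<in>Z - C. infdist z C \<le> 1 / Suc n \<longrightarrow> W z \<le> \<eta>" by blast
  then show thesis by (intro that[of "1 / real (Suc n)"]) auto
qed

section \<open>Trajectories from all initial states and their consequences\<close>

lemma descent_stepD:
  assumes step: "descent_step \<gamma> \<delta> x u y"
  shows "y 0 = x"
    and "\<And>t. t \<in> {0..\<delta>} \<Longrightarrow> y t \<in> \<Omega> - C"
    and "\<And>t. t \<in> {0..\<delta>} \<Longrightarrow> (y has_vector_derivative f (y t) u) (at t within {0..\<delta>})"
    and "\<And>t. t \<in> {0..\<delta>} \<Longrightarrow> W (y t) + p\<^sub>0 * integral {0..t} (\<lambda>s. l (y s) u) + \<gamma> * t \<le> W x"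
    and "continuous_on {0..\<delta>} (\<lambda>s. f (y s) u)"
    and "continuous_on {0..\<delta>} (\<lambda>s. l (y s) u)"
    and "\<And>t. t \<in> {0..\<delta>} \<Longrightarrow> W (y t) + \<gamma> * t \<le> W x"
proof -
  show y0: "y 0 = x" and D: "\<And>t. t \<in> {0..\<delta>} \<Longrightarrow> y t \<in> \<Omega> - C"
    and deriv: "\<And>t. t \<in> {0..\<delta>} \<Longrightarrow> (y has_vector_derivative f (y t) u) (at t within {0..\<delta>})"
    and W: "\<And>t. t \<in> {0..\<delta>} \<Longrightarrow> W (y t) + p\<^sub>0 * integral {0..t} (\<lambda>s. l (y s) u) + \<gamma> * t \<le> W x"
    using step unfolding descent_step_def by blast+
  have y: "continuous_on {0..\<delta>} y"
    by (rule continuous_on_vector_derivative[OF deriv])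
  show "continuous_on {0..\<delta>} (\<lambda>s. f (y s) u)"
    by (rule continuous_on_compose2[OF continuous_f_fixed y]) (use D in auto)
  show l: "continuous_on {0..\<delta>} (\<lambda>s. l (y s) u)"
    by (rule continuous_on_compose2[OF continuous_l_fixed y]) (use D in auto)
  fix t assume t: "t \<in> {0..\<delta>}"
  have "0 \<le> integral {0..t} (\<lambda>s. l (y s) u)"
    using t D l_nonneg
    by (intro Henstock_Kurzweil_Integration.integral_nonneg integrable_continuous_real continuous_on_subset[OF l]) auto
  then have "0 \<le> p\<^sub>0 * integral {0..t} (\<lambda>s. l (y s) u)" using p\<^sub>0_nonneg by simp
  with W[OF t] show "W (y t) + \<gamma> * t \<le> W x" by linarith
qed

text \<open>One selection of trajectories serves both controllability and the cost bound. The time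
  \<open>\<tau>\<close> depends on the initial level and on \<open>\<epsilon>\<close> only; this
  uniformity is what the KL majorant consumes.\<close>

lemma exists_trajectories:
  obtains T :: "'a \<Rightarrow> ereal" and X :: "'a \<Rightarrow> real \<Rightarrow> 'a" and v :: "'a \<Rightarrow> real \<Rightarrow> 'b" where
    "\<And>z. z \<in> \<Omega> - C \<Longrightarrow> (T z, X z, v z) \<in> admissible f UNIV C \<Omega> z"
    "\<And>z t. z \<in> \<Omega> - C \<Longrightarrow> t \<in> time_interval (T z) \<Longrightarrow> W (X z t) \<le> W z"
    "\<And>c \<epsilon>. 0 < \<epsilon> \<Longrightarrow> \<exists>\<tau>. \<forall>z\<in>\<Omega> - C. W z \<le> c \<longrightarrow>
       (\<forall>t\<in>time_interval (T z). \<tau> \<le> t \<longrightarrow> W (X z t) \<le> \<epsilon>)"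
    "\<And>z. z \<in> \<Omega> - C \<Longrightarrow> 0 < p\<^sub>0 \<Longrightarrow>
       (\<integral>\<^sup>+ t \<in> time_interval (T z). ennreal (l (X z t) (v z t)) \<partial>lebesgue) \<le> ennreal (W z / p\<^sub>0)"
proof -
  obtain \<gamma> \<delta> u y where
    sel: "\<And>x. x \<in> \<Omega> - C \<Longrightarrow> 0 < \<gamma> x \<and> 0 < \<delta> x \<and> \<delta> x \<le> 1 \<and> descent_step (\<gamma> x) (\<delta> x) x (u x) (y x)"
    and unif: "\<And>a b. 0 < a \<Longrightarrow> \<exists>g>0. \<exists>h>0. \<forall>x\<in>\<Omega> - C. a \<le> W x \<and> W x \<le> b \<longrightarrow> g \<le> \<gamma> x \<and> h \<le> \<delta> x"
    using step_selection by blast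
  have \<gamma>: "0 < \<gamma> x" and \<delta>: "0 < \<delta> x" "\<delta> x \<le> 1" and step: "descent_step (\<gamma> x) (\<delta> x) x (u x) (y x)"
    if "x \<in> \<Omega> - C" for x using sel[OF that] by auto
  define \<xi> where "\<xi> z n = ((\<lambda>x. y x (\<delta> x)) ^^ n) z" for z and n :: nat
  have \<xi>_Suc: "\<xi> z (Suc n) = y (\<xi> z n) (\<delta> (\<xi> z n))" for z n by (simp add: \<xi>_def)
  have \<xi>D: "\<xi> z n \<in> \<Omega> - C" if "z \<in> \<Omega> - C" for z n
  proof (induction n)
    case (Suc n)
    then show ?case unfolding \<xi>_Suc using \<delta>[OF Suc] by (intro descent_stepD(2)[OF step]) auto
  qed (use that in \<open>simp add: \<xi>_def\<close>)
  have conc: "concatenation f (\<xi> z) (\<lambda>n. u (\<xi> z n)) (\<lambda>n. \<delta> (\<xi> z n)) (\<lambda>n. y (\<xi> z n))"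
    if z: "z \<in> \<Omega> - C" for z
  proof
    fix n
    note s = descent_stepD[OF step[OF \<xi>D[OF z, of n]]]
    show "0 < \<delta> (\<xi> z n)" by (rule \<delta>[OF \<xi>D[OF z]])
    show "y (\<xi> z n) 0 = \<xi> z n" by (rule s(1))
    show "y (\<xi> z n) (\<delta> (\<xi> z n)) = \<xi> z (Suc n)" by (simp add: \<xi>_Suc)
    show "(y (\<xi> z n) has_vector_derivative f (y (\<xi> z n) t) (u (\<xi> z n))) (at t within {0..\<delta> (\<xi> z n)})"
      if "t \<in> {0..\<delta> (\<xi> z n)}" for t
      by (rule s(3)[OF that])
    have "compact ((\<lambda>t. f (y (\<xi> z n) t) (u (\<xi> z n))) ` {0..\<delta> (\<xi> z n)})"
      by (intro compact_continuous_image s(5) compact_Icc)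
    then show "\<exists>m. \<forall>t\<in>{0..\<delta> (\<xi> z n)}. norm (f (y (\<xi> z n) t) (u (\<xi> z n))) \<le> m"
      using compact_imp_bounded by (fastforce simp: bounded_iff)
  qed
  \<comment> \<open>The locale constants are used with explicit parameters, so that the initial
    state can vary; inside each interpretation they become its exit time, trajectory and
    control.\<close>
  define T where "T z = concatenation.exit_time (\<lambda>n. \<delta> (\<xi> z n))" for z
  define X where "X z = concatenation.trajectory (\<lambda>n. \<delta> (\<xi> z n)) (\<lambda>n. y (\<xi> z n))" for z
  define v where "v z = concatenation.control (\<lambda>n. u (\<xi> z n)) (\<lambda>n. \<delta> (\<xi> z n))" for z
  define nd where "nd z = concatenation.node (\<lambda>n. \<delta> (\<xi> z n))" for z
  have XW: "X z t \<in> \<Omega> - C \<and> (\<exists>m. nd z m \<le> t \<and> (\<forall>n. nd z n \<le> t \<longrightarrow> n \<le> m) \<and> W (X z t) \<le> W (\<xi> z m))"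
    if z: "z \<in> \<Omega> - C" and t: "t \<in> time_interval (T z)" for z t
  proof -
    interpret c: concatenation f "\<xi> z" "\<lambda>n. u (\<xi> z n)" "\<lambda>n. \<delta> (\<xi> z n)" "\<lambda>n. y (\<xi> z n)"
      by (rule conc[OF z])
    let ?m = "c.piece t"
    have t': "t \<in> time_interval c.exit_time" using t by (simp add: T_def)
    have in_step: "t - c.node ?m \<in> {0..\<delta> (\<xi> z ?m)}"
      using c.node_piece[OF t'] by (simp add: c.node_Suc)
    note s = descent_stepD[OF step[OF \<xi>D[OF z, of ?m]]]
    have X: "X z t = y (\<xi> z ?m) (t - c.node ?m)" by (simp add: X_def c.trajectory_def)
    have "0 \<le> \<gamma> (\<xi> z ?m) * (t - c.node ?m)"
      using \<gamma>[OF \<xi>D[OF z, of ?m]] in_step by simp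
    then have "W (X z t) \<le> W (\<xi> z ?m)" using s(7)[OF in_step] unfolding X by linarith
    moreover have "X z t \<in> \<Omega> - C" using s(2)[OF in_step] unfolding X .
    ultimately show ?thesis
      unfolding nd_def using c.node_piece(1)[OF t'] c.piece_mono_node[OF t'] by blast
  qed
  have \<xi>_decr: "W (\<xi> z (Suc n)) + \<gamma> (\<xi> z n) * \<delta> (\<xi> z n) \<le> W (\<xi> z n)" if z: "z \<in> \<Omega> - C" for z n
    using descent_stepD(7)[OF step[OF \<xi>D[OF z, of n]]] \<delta>[OF \<xi>D[OF z, of n]] by (simp add: \<xi>_Suc)
  have \<xi>_mono: "W (\<xi> z n) \<le> W (\<xi> z m)" if z: "z \<in> \<Omega> - C" and "m \<le> n" for z m n
  proof (rule lift_Suc_antimono_le[where f = "\<lambda>n. W (\<xi> z n)", OF _ \<open>m \<le> n\<close>])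
    fix k
    have "0 < \<gamma> (\<xi> z k) * \<delta> (\<xi> z k)" using \<gamma> \<delta> \<xi>D[OF z] by simp
    then show "W (\<xi> z (Suc k)) \<le> W (\<xi> z k)" using \<xi>_decr[OF z, of k] by linarith
  qed
  have nd: "nd z 0 = 0" "nd z (Suc n) = nd z n + \<delta> (\<xi> z n)" "ereal (nd z n) < T z" if z: "z \<in> \<Omega> - C" for z n
  proof -
    interpret c: concatenation f "\<xi> z" "\<lambda>n. u (\<xi> z n)" "\<lambda>n. \<delta> (\<xi> z n)" "\<lambda>n. y (\<xi> z n)"
      by (rule conc[OF z])
    show "nd z 0 = 0" "nd z (Suc n) = nd z n + \<delta> (\<xi> z n)" "ereal (nd z n) < T z"
      unfolding nd_def T_def using c.node_less_exit_time by (simp_all add: c.node_Suc)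
  qed
  \<comment> \<open>Inside a step \<open>W\<close> is compared only with its value at the start of
    the step and need not be monotone. What holds is the bound by the value at any earlier
    node.\<close>
  have X_le: "W (X z t) \<le> W (\<xi> z n)" if z: "z \<in> \<Omega> - C" and "t \<in> time_interval (T z)" "nd z n \<le> t" for z t n
    using XW[OF that(1,2)] \<xi>_mono[OF z] that(3) by (meson order_trans)
  have hit: "\<exists>\<tau>. \<forall>z\<in>\<Omega> - C. W z \<le> c \<longrightarrow> (\<exists>n. nd z n \<le> \<tau> \<and> W (\<xi> z n) < \<epsilon>)" if \<epsilon>: "0 < \<epsilon>" for c \<epsilon>
  proof -
    from unif[OF \<epsilon>, of c] obtain g h where g: "0 < g" and h: "0 < h"
      and gh: "\<And>x. x \<in> \<Omega> - C \<Longrightarrow> \<epsilon> \<le> W x \<Longrightarrow> W x \<le> c \<Longrightarrow> g \<le> \<gamma> x \<and> h \<le> \<delta> x" by meson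
    have "\<exists>n. nd z n \<le> c / g + 1 \<and> W (\<xi> z n) < \<epsilon>" if z: "z \<in> \<Omega> - C" and Wc: "W z \<le> c" for z
    proof -
      have le_c: "W (\<xi> z n) \<le> c" for n
        using \<xi>_mono[OF z, of 0 n] Wc by (simp add: \<xi>_def)
      \<comment> \<open>While the level stays above \<open>\<epsilon>\<close>, \<open>W\<close>
        falls at rate at least \<open>g\<close> and consecutive nodes are at least \<open>h\<close>
        apart.\<close>
      have decay: "W (\<xi> z n) \<le> c - g * nd z n \<and> h * n \<le> nd z n" if "\<forall>k<n. \<epsilon> \<le> W (\<xi> z k)" for n
        using that
      proof (induction n)
        case 0
        then show ?case using Wc nd(1)[OF z] by (simp add: \<xi>_def)
      next
        case (Suc n)
        have k: "g \<le> \<gamma> (\<xi> z n)" "h \<le> \<delta> (\<xi> z n)"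
          using gh[OF \<xi>D[OF z] _ le_c] Suc.prems by auto
        have "g * \<delta> (\<xi> z n) \<le> \<gamma> (\<xi> z n) * \<delta> (\<xi> z n)"
          using k(1) \<delta>(1)[OF \<xi>D[OF z, of n]] by (intro mult_right_mono) auto
        then show ?case using Suc \<xi>_decr[OF z, of n] k(2) nd(2)[OF z, of n]
          by (simp add: algebra_simps)
      qed
      have W0: "0 < W (\<xi> z n)" for n by (intro W_pos \<xi>D z)
      have ex: "\<exists>n. W (\<xi> z n) < \<epsilon>"
      proof (rule ccontr)
        assume "\<not> ?thesis"
        then have all: "\<epsilon> \<le> W (\<xi> z n)" for n by (simp add: not_less)
        \<comment> \<open>By then \<open>n\<close> steps take time at least \<open>h * n\<close>,
          and the decrease \<open>g * h * n\<close> exceeds the initial level \<open>c\<close>,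
          against positivity of \<open>W\<close>.\<close>
        obtain n :: nat where n: "c / (g * h) < real n" using reals_Archimedean2 by blast
        have "c < g * (h * n)" using n g h by (simp add: pos_divide_less_eq mult_ac)
        also have "\<dots> \<le> g * nd z n" using decay[of n] all g by (intro mult_left_mono) auto
        finally show False using decay[of n] all W0[of n] by force
      qed
      define n where "n = (LEAST n. W (\<xi> z n) < \<epsilon>)"
      have n: "W (\<xi> z n) < \<epsilon>" unfolding n_def by (rule LeastI_ex[OF ex])
      have before: "\<epsilon> \<le> W (\<xi> z k)" if "k < n" for k
        using not_less_Least[OF that[unfolded n_def]] by (simp add: not_less)
      \<comment> \<open>The node before the hit is reached by time \<open>c / g\<close>, since
        \<open>W\<close> is still positive there; one further step lasts at most 1.\<close>
      have "nd z n \<le> c / g + 1"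
      proof (cases n)
        case 0
        have "0 \<le> c" using Wc W_pos[OF z] by linarith
        then show ?thesis using 0 nd(1)[OF z] g by simp
      next
        case (Suc m)
        have "W (\<xi> z m) \<le> c - g * nd z m" using decay[of m] before Suc by auto
        then have "g * nd z m \<le> c" using W0[of m] by linarith
        then have "nd z m \<le> c / g" using g by (simp add: pos_le_divide_eq mult.commute)
        then show ?thesis using Suc nd(2)[OF z, of m] \<delta>(2)[OF \<xi>D[OF z, of m]] by simp
      qed
      with n show ?thesis by blast
    qed
    then show ?thesis by blast
  qed
  have small: "\<exists>\<tau>. \<forall>z\<in>\<Omega> - C. W z \<le> c \<longrightarrow> (\<forall>t\<in>time_interval (T z). \<tau> \<le> t \<longrightarrow> W (X z t) \<le> \<epsilon>)"
    if \<epsilon>: "0 < \<epsilon>" for c \<epsilon>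
  proof -
    from hit[OF \<epsilon>, of c] obtain \<tau> where \<tau>: "\<And>z. z \<in> \<Omega> - C \<Longrightarrow> W z \<le> c \<Longrightarrow> \<exists>n. nd z n \<le> \<tau> \<and> W (\<xi> z n) < \<epsilon>"
      by blast
    have "W (X z t) \<le> \<epsilon>" if z: "z \<in> \<Omega> - C" and "W z \<le> c" and t: "t \<in> time_interval (T z)" "\<tau> \<le> t" for z t
    proof -
      obtain n where "nd z n \<le> \<tau>" "W (\<xi> z n) < \<epsilon>" using \<tau>[OF z \<open>W z \<le> c\<close>] by blast
      then show ?thesis using X_le[OF z t(1), of n] t(2) by linarith
    qed
    then show ?thesis by blast
  qed
  show thesis
  proof (rule that[of T X v])
    fix z assume z: "z \<in> \<Omega> - C"
    interpret c: concatenation f "\<xi> z" "\<lambda>n. u (\<xi> z n)" "\<lambda>n. \<delta> (\<xi> z n)" "\<lambda>n. y (\<xi> z n)"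
      by (rule conc[OF z])
    have to_target: "((\<lambda>t. infdist (X z t) C) \<longlongrightarrow> 0) (to_left (T z))"
    proof (rule tendstoI)
      fix e :: real assume "0 < e"
      then obtain \<eta> where \<eta>: "0 < \<eta>" "\<And>x. x \<in> \<Omega> - C \<Longrightarrow> W x \<le> \<eta> \<Longrightarrow> infdist x C < e"
        using infdist_small_of_W_small by blast
      \<comment> \<open>Every node precedes the exit time, so the small level is reached strictly
        before it, whether the exit time is finite or not.\<close>
      from hit[OF \<eta>(1), of "W z"] z obtain n where n: "W (\<xi> z n) < \<eta>" by blast
      have nn: "0 \<le> nd z n" using c.node_nonneg by (simp add: nd_def)
      have "\<forall>\<^sub>F t in to_left (T z). nd z n \<le> t \<and> ereal t < T z"
        by (rule eventually_to_left[OF nd(3)[OF z]])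
      then show "\<forall>\<^sub>F t in to_left (T z). dist (infdist (X z t) C) 0 < e"
      proof eventually_elim
        case (elim t)
        then have t: "t \<in> time_interval (T z)" using nn by (simp add: time_interval_def)
        have "W (X z t) \<le> \<eta>" using X_le[OF z t, of n] elim n by linarith
        then show ?case using \<eta>(2)[of "X z t"] XW[OF z t] infdist_nonneg[of "X z t" C] by simp
      qed
    qed
    show "(T z, X z, v z) \<in> admissible f UNIV C \<Omega> z"
      unfolding admissible_def
    proof (intro CollectI case_prodI conjI)
      show "0 < T z" unfolding T_def by (rule c.exit_time_pos)
      show "\<forall>t\<in>time_interval (T z). X z t \<in> \<Omega> - C" using XW[OF z] by blast
      show "((\<lambda>t. infdist (X z t) C) \<longlongrightarrow> 0) (to_left (T z))" by (rule to_target)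
      show "Linf_loc (T z) UNIV (v z)" unfolding T_def v_def by (rule c.Linf_loc_control)
      show "carath_solution f (T z) (X z) (v z) z"
        using c.carath_solution_trajectory unfolding T_def v_def X_def by (simp add: \<xi>_def)
    qed
    show "W (X z t) \<le> W z" if t: "t \<in> time_interval (T z)" for t
      using X_le[OF z t, of 0] nd(1)[OF z] t by (simp add: \<xi>_def time_interval_def)
    assume p0: "0 < p\<^sub>0"
    define J where "J n = integral {0..\<delta> (\<xi> z n)} (\<lambda>s. l (y (\<xi> z n) s) (u (\<xi> z n)))" for n
    have lpos: "0 \<le> l (y (\<xi> z n) s) (u (\<xi> z n))" if "s \<in> {0..\<delta> (\<xi> z n)}" for n s
      using descent_stepD(2)[OF step[OF \<xi>D[OF z, of n]] that] by (rule l_nonneg)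
    have lint: "(\<lambda>s. l (y (\<xi> z n) s) (u (\<xi> z n))) integrable_on {0..\<delta> (\<xi> z n)}" for n
      by (rule integrable_continuous_real[OF descent_stepD(6)[OF step[OF \<xi>D[OF z]]]])
    have J0: "0 \<le> J n" for n
      unfolding J_def by (rule Henstock_Kurzweil_Integration.integral_nonneg[OF lint lpos])
    \<comment> \<open>The descent inequality at the end of the step, with the positive decrease
      \<open>\<gamma> * \<delta>\<close> discarded; summed over the steps it telescopes.\<close>
    have J_le: "p\<^sub>0 * J n \<le> W (\<xi> z n) - W (\<xi> z (Suc n))" for n
    proof -
      have d: "\<delta> (\<xi> z n) \<in> {0..\<delta> (\<xi> z n)}" using \<delta>[OF \<xi>D[OF z, of n]] by simp
      have "0 < \<gamma> (\<xi> z n) * \<delta> (\<xi> z n)" using \<gamma> \<delta> \<xi>D[OF z] by simp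
      then show ?thesis
        using descent_stepD(4)[OF step[OF \<xi>D[OF z, of n]] d] unfolding J_def \<xi>_Suc by linarith
    qed
    have "p\<^sub>0 * (\<Sum>k<n. J k) \<le> W z - W (\<xi> z n)" for n
    proof (induction n)
      case (Suc n)
      then show ?case using J_le[of n] by (simp add: algebra_simps)
    qed (simp add: \<xi>_def)
    then have "p\<^sub>0 * (\<Sum>k<n. J k) \<le> W z" for n
      using W_pos[OF \<xi>D[OF z, of n]] by (meson diff_le_eq less_imp_le order_trans le_add_same_cancel1)
    then have J_sum: "(\<Sum>k<n. J k) \<le> W z / p\<^sub>0" for n
      using p0 by (simp add: pos_le_divide_eq mult.commute)
    have "(\<integral>\<^sup>+ t \<in> time_interval (T z). ennreal (l (X z t) (v z t)) \<partial>lebesgue) \<le> (\<Sum>n. ennreal (J n))"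
      unfolding T_def X_def v_def J_def
      by (rule c.cost_le_suminf) (use lpos lint in auto)
    also have "\<dots> \<le> ennreal (W z / p\<^sub>0)"
    proof (unfold suminf_eq_SUP, rule SUP_least)
      fix n
      have "(\<Sum>k<n. ennreal (J k)) = ennreal (\<Sum>k<n. J k)" using J0 by (intro sum_ennreal) auto
      then show "(\<Sum>k<n. ennreal (J k)) \<le> ennreal (W z / p\<^sub>0)" using J_sum[of n] by (simp add: ennreal_leI)
    qed
    finally show "(\<integral>\<^sup>+ t \<in> time_interval (T z). ennreal (l (X z t) (v z t)) \<partial>lebesgue) \<le> ennreal (W z / p\<^sub>0)" .
  qed (rule small)
qed

text \<open>Initial distances in \<open>Z\<close> are turned into levels of \<open>W\<close>, which
  bound the later levels, and these are turned back into distances. That gives the three hypotheses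
  of \<open>class_KL_majorant\<close>.\<close>

lemma asymp_controllable_from_closed:
  assumes Z: "closed Z" "Z \<subseteq> \<Omega>"
  shows "asymp_controllable_from Z f UNIV C \<Omega>"
  unfolding asymp_controllable_from_def
proof
  fix zb assume zb: "zb \<in> frontier C"
  then have zbC: "infdist zb C = 0" using target(1) by (simp add: frontier_def)
  obtain T X v where adm: "\<And>z. z \<in> \<Omega> - C \<Longrightarrow> (T z, X z, v z) \<in> admissible f UNIV C \<Omega> z"
    and decr: "\<And>z t. z \<in> \<Omega> - C \<Longrightarrow> t \<in> time_interval (T z) \<Longrightarrow> W (X z t) \<le> W z"
    and decay: "\<And>c \<epsilon>. 0 < \<epsilon> \<Longrightarrow> \<exists>\<tau>. \<forall>z\<in>\<Omega> - C. W z \<le> c \<longrightarrow>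
       (\<forall>t\<in>time_interval (T z). \<tau> \<le> t \<longrightarrow> W (X z t) \<le> \<epsilon>)"
    by (rule exists_trajectories) (rule that; assumption)
  have XD: "X z t \<in> \<Omega> - C" if "z \<in> \<Omega> - C" "t \<in> time_interval (T z)" for z t
    using adm[OF that(1)] that(2) unfolding admissible_def by blast
  define e where "e z t = infdist (prolong zb (T z) (X z) t) C" for z t
  \<comment> \<open>After the exit time the prolonged trajectory rests at \<open>zb\<close>, at
    distance 0, so only earlier times need an estimate.\<close>
  have e_le: "e z t \<le> c" if "0 \<le> c" "0 \<le> t" "t \<in> time_interval (T z) \<Longrightarrow> infdist (X z t) C \<le> c" for z t c
    using that zbC by (auto simp: e_def prolong_def time_interval_def)
  have "\<exists>\<beta>\<in>class_KL. \<forall>z\<in>Z - C. \<forall>t\<ge>0. e z t \<le> \<beta> (infdist z C) t"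
  proof (rule class_KL_majorant)
    show "0 < infdist z C" if "z \<in> Z - C" for z
      using that in_closed_iff_infdist_zero[OF target(1,3), of z] infdist_nonneg[of z C] by force
    show "0 \<le> e z t" for z t by (simp add: e_def infdist_nonneg)
    show "\<exists>B. \<forall>z\<in>Z - C. infdist z C \<le> r \<longrightarrow> (\<forall>t\<ge>0. e z t \<le> B)" for r
    proof -
      obtain c where c: "\<And>z. z \<in> Z - C \<Longrightarrow> infdist z C \<le> r \<Longrightarrow> W z \<le> c"
        using W_bounded_of_infdist_bounded[OF Z] by blast
      obtain R where R: "\<And>x. x \<in> \<Omega> - C \<Longrightarrow> W x \<le> c \<Longrightarrow> infdist x C \<le> R"
        using infdist_bounded_on_sublevel by blast
      have "e z t \<le> max R 0" if z: "z \<in> Z - C" "infdist z C \<le> r" and t: "0 \<le> t" for z t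
      proof (rule e_le[OF _ t])
        assume ti: "t \<in> time_interval (T z)"
        have zD: "z \<in> \<Omega> - C" using z(1) Z(2) by blast
        have "W (X z t) \<le> c" using decr[OF zD ti] c[OF z] by linarith
        then show "infdist (X z t) C \<le> max R 0" using R[OF XD[OF zD ti]] by simp
      qed simp
      then show ?thesis by blast
    qed
    show "\<exists>r>0. \<forall>z\<in>Z - C. infdist z C \<le> r \<longrightarrow> (\<forall>t\<ge>0. e z t \<le> \<epsilon>)" if \<epsilon>: "0 < \<epsilon>" for \<epsilon>
    proof -
      obtain \<eta> where \<eta>: "0 < \<eta>" "\<And>x. x \<in> \<Omega> - C \<Longrightarrow> W x \<le> \<eta> \<Longrightarrow> infdist x C < \<epsilon>"
        using infdist_small_of_W_small[OF \<epsilon>] by blast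
      obtain r where r: "0 < r" "\<And>z. z \<in> Z - C \<Longrightarrow> infdist z C \<le> r \<Longrightarrow> W z \<le> \<eta>"
        using W_small_of_infdist_small[OF Z \<eta>(1)] by blast
      have "e z t \<le> \<epsilon>" if z: "z \<in> Z - C" "infdist z C \<le> r" and t: "0 \<le> t" for z t
      proof (rule e_le[OF _ t])
        assume ti: "t \<in> time_interval (T z)"
        have zD: "z \<in> \<Omega> - C" using z(1) Z(2) by blast
        have "W (X z t) \<le> \<eta>" using decr[OF zD ti] r(2)[OF z] by linarith
        then show "infdist (X z t) C \<le> \<epsilon>" using \<eta>(2)[OF XD[OF zD ti]] by simp
      qed (use \<epsilon> in simp)
      then show ?thesis using r(1) by blast
    qed
    show "\<exists>\<tau>. \<forall>z\<in>Z - C. infdist z C \<le> r \<longrightarrow> (\<forall>t\<ge>0. \<tau> \<le> t \<longrightarrow> e z t \<le> \<epsilon>)" if \<epsilon>: "0 < \<epsilon>" for r \<epsilon>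
    proof -
      obtain c where c: "\<And>z. z \<in> Z - C \<Longrightarrow> infdist z C \<le> r \<Longrightarrow> W z \<le> c"
        using W_bounded_of_infdist_bounded[OF Z] by blast
      obtain \<eta> where \<eta>: "0 < \<eta>" "\<And>x. x \<in> \<Omega> - C \<Longrightarrow> W x \<le> \<eta> \<Longrightarrow> infdist x C < \<epsilon>"
        using infdist_small_of_W_small[OF \<epsilon>] by blast
      obtain \<tau> where \<tau>: "\<And>z t. z \<in> \<Omega> - C \<Longrightarrow> W z \<le> c \<Longrightarrow> t \<in> time_interval (T z) \<Longrightarrow> \<tau> \<le> t \<Longrightarrow> W (X z t) \<le> \<eta>"
        using decay[OF \<eta>(1), of c] by blast
      have "e z t \<le> \<epsilon>" if z: "z \<in> Z - C" "infdist z C \<le> r" and t: "0 \<le> t" "\<tau> \<le> t" for z t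
      proof (rule e_le[OF _ t(1)])
        assume ti: "t \<in> time_interval (T z)"
        have zD: "z \<in> \<Omega> - C" using z(1) Z(2) by blast
        show "infdist (X z t) C \<le> \<epsilon>"
          using \<eta>(2)[OF XD[OF zD ti] \<tau>[OF zD c[OF z] ti t(2)]] by simp
      qed (use \<epsilon> in simp)
      then show ?thesis by blast
    qed
  qed
  then obtain \<beta> where \<beta>: "\<beta> \<in> class_KL" "\<And>z t. z \<in> Z - C \<Longrightarrow> 0 \<le> t \<Longrightarrow> e z t \<le> \<beta> (infdist z C) t"
    by blast
  show "\<exists>\<beta>\<in>class_KL. \<forall>z\<in>Z - C. \<exists>(T, x, u)\<in>admissible f UNIV C \<Omega> z.
      \<forall>t\<ge>0. infdist (prolong zb T x t) C \<le> \<beta> (infdist z C) t"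
  proof (intro bexI[of _ \<beta>] ballI)
    fix z assume z: "z \<in> Z - C"
    then have "z \<in> \<Omega> - C" using Z(2) by blast
    from adm[OF this] show "\<exists>(T, x, u)\<in>admissible f UNIV C \<Omega> z.
        \<forall>t\<ge>0. infdist (prolong zb T x t) C \<le> \<beta> (infdist z C) t"
      using \<beta>(2)[OF z] unfolding e_def by (intro bexI[of _ "(T z, X z, v z)"]) simp_all
  qed (rule \<beta>(1))
qed

lemma value_function_le:
  assumes "0 < p\<^sub>0" and z: "z \<in> \<Omega> - C"
  shows "value_function l f UNIV C \<Omega> z \<le> ennreal (W z / p\<^sub>0)"
proof -
  obtain T X v where "\<And>z. z \<in> \<Omega> - C \<Longrightarrow> (T z, X z, v z) \<in> admissible f UNIV C \<Omega> z"
    and "\<And>z. z \<in> \<Omega> - C \<Longrightarrow> 0 < p\<^sub>0 \<Longrightarrow>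
      (\<integral>\<^sup>+ t \<in> time_interval (T z). ennreal (l (X z t) (v z t)) \<partial>lebesgue) \<le> ennreal (W z / p\<^sub>0)"
    by (rule exists_trajectories) (rule that; assumption)
  note this[OF z]
  with assms(1) show ?thesis
    unfolding value_function_def by (intro INF_lower2[of "(T z, X z, v z)"]) auto
qed

end

section \<open>Polynomial dynamics\<close>

lemma mpower_scaleR: "mpower (k *\<^sub>R u) \<alpha> = k ^ mdegree \<alpha> * mpower u \<alpha>"
  by (simp add: mpower_def mdegree_def power_mult_distrib prod.distrib power_sum)

lemma mpower_0: "1 \<le> mdegree \<alpha> \<Longrightarrow> mpower 0 \<alpha> = 0"
proof -
  assume "1 \<le> mdegree \<alpha>"
  then obtain j where "\<alpha> $ j \<noteq> 0" unfolding mdegree_def by force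
  then show ?thesis unfolding mpower_def
    by (intro prod_zero) (auto intro!: bexI[of _ j])
qed

lemma poly_dynamics_0: "poly_dynamics d f\<^sub>0 F x 0 = f\<^sub>0 x"
  by (simp add: poly_dynamics_def mpower_0)

lemma continuous_on_poly_dynamics:
  fixes F :: "nat ^ 'm \<Rightarrow> 'a::euclidean_space \<Rightarrow> 'a"
  assumes "continuous_on S f\<^sub>0"
    and "\<And>\<alpha>. 1 \<le> mdegree \<alpha> \<Longrightarrow> mdegree \<alpha> \<le> d \<Longrightarrow> continuous_on S (F \<alpha>)"
  shows "continuous_on (S \<times> UNIV) (\<lambda>(x, u). poly_dynamics d f\<^sub>0 F x u)"
  unfolding poly_dynamics_def mpower_def case_prod_unfold
proof (intro continuous_on_add continuous_on_sum continuous_on_scaleR)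
  show "continuous_on (S \<times> UNIV) (\<lambda>z. f\<^sub>0 (fst z))"
    by (rule continuous_on_compose2[OF assms(1)]) (auto intro!: continuous_intros)
  fix i and \<alpha> :: "nat ^ 'm" assume "i \<in> {1..d}" "\<alpha> \<in> {\<alpha>. mdegree \<alpha> = i}"
  then have "continuous_on S (F \<alpha>)" by (intro assms(2)) auto
  then show "continuous_on (S \<times> UNIV) (\<lambda>z. F \<alpha> (fst z))"
    by (rule continuous_on_compose2) (auto intro!: continuous_intros)
  show "continuous_on (S \<times> UNIV) (\<lambda>z. \<Prod>j\<in>UNIV. (snd z :: real ^ 'm) $ j ^ \<alpha> $ j)"
    by (intro continuous_intros)
qed

lemma hamiltonian_neg_iff:
  "hamiltonian UNIV l g x p\<^sub>0 p < 0 \<longleftrightarrow> (\<exists>u. p \<bullet> g x u + p\<^sub>0 * l x u < 0)"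
  by (auto simp: hamiltonian_def INF_less_iff)

text \<open>As \<open>k >= 1\<close>, all terms below degree \<open>d\<close> total at most
  \<open>S * k ^ (d - 1)\<close>. With \<open>a = A d + m < 0\<close>, the value
  \<open>k = 1 + S / - a\<close> satisfies \<open>S + k * a = a\<close>, so the whole expression is
  at most \<open>k ^ (d - 1) * a\<close>.\<close>

lemma polynomial_eventually_neg:
  fixes A :: "nat \<Rightarrow> real"
  assumes d: "1 \<le> d" and s: "A d + m < 0"
  obtains k where "1 \<le> k" "c + (\<Sum>i=1..d. k ^ i * A i) + k ^ d * m < 0"
proof -
  define S where "S = \<bar>c\<bar> + (\<Sum>i=1..<d. \<bar>A i\<bar>)"
  define a where "a = A d + m"
  define k where "k = 1 + S / - a"
  have S: "0 \<le> S" by (simp add: S_def sum_nonneg)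
  have a: "a < 0" using s by (simp add: a_def)
  have k: "1 \<le> k" using S a unfolding k_def by (simp add: divide_nonneg_neg)
  have "k * a = a - S" using a by (simp add: k_def field_simps)
  then have neg: "S + k * a < 0" using a by simp
  have le: "k ^ i * A i \<le> k ^ (d - 1) * \<bar>A i\<bar>" if "i < d" for i
  proof -
    have "k ^ i * A i \<le> k ^ i * \<bar>A i\<bar>" using k by (intro mult_left_mono) auto
    also have "\<dots> \<le> k ^ (d - 1) * \<bar>A i\<bar>" using k that by (intro mult_right_mono power_increasing) auto
    finally show ?thesis .
  qed
  have "c \<le> k ^ (d - 1) * \<bar>c\<bar>"
    using mult_right_mono[OF one_le_power[OF k, of "d - 1"], of "\<bar>c\<bar>"] by linarith
  moreover have "(\<Sum>i=1..<d. k ^ i * A i) \<le> k ^ (d - 1) * (\<Sum>i=1..<d. \<bar>A i\<bar>)"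
    unfolding sum_distrib_left by (intro sum_mono le) auto
  moreover have "{1..d} = insert d {1..<d}" using d by auto
  then have "(\<Sum>i=1..d. k ^ i * A i) = k ^ d * A d + (\<Sum>i=1..<d. k ^ i * A i)" by simp
  moreover have "k ^ d = k ^ (d - 1) * k" using d by (metis le_add_diff_inverse2 power_add power_one_right)
  ultimately have "c + (\<Sum>i=1..d. k ^ i * A i) + k ^ d * m \<le> k ^ (d - 1) * (S + k * a)"
    unfolding S_def a_def by (simp add: algebra_simps)
  also have "\<dots> < 0" using neg k by (intro mult_pos_neg) auto
  finally show thesis using that k by blast
qed

lemma hamiltonian_neg_of_max_degree:
  assumes d: "1 \<le> d" and p\<^sub>0: "0 \<le> p\<^sub>0"
    and l: "\<And>u. l x u = M\<^sub>0 x + M\<^sub>1 x u" and M\<^sub>1_0: "M\<^sub>1 x 0 = 0"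
    and M\<^sub>1_scale: "\<And>k u. 1 \<le> k \<Longrightarrow> M\<^sub>1 x (k *\<^sub>R u) \<le> k ^ d * M\<^sub>1 x u"
    and neg: "hamiltonian UNIV l (max_degree_dynamics d f\<^sub>0 F) x p\<^sub>0 p < 0"
  shows "hamiltonian UNIV l (poly_dynamics d f\<^sub>0 F) x p\<^sub>0 p < 0"
proof -
  obtain u where u: "p \<bullet> max_degree_dynamics d f\<^sub>0 F x u + p\<^sub>0 * l x u < 0"
    using neg by (auto simp: hamiltonian_neg_iff)
  define A where "A i = (\<Sum>\<alpha> | mdegree \<alpha> = i. mpower u \<alpha> * (p \<bullet> F \<alpha> x))" for i
  have max: "p \<bullet> f\<^sub>0 x + p\<^sub>0 * M\<^sub>0 x + (A d + p\<^sub>0 * M\<^sub>1 x u) < 0"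
    using u by (simp add: max_degree_dynamics_def A_def l inner_add_right inner_sum_right algebra_simps)
  have scaled: "p \<bullet> poly_dynamics d f\<^sub>0 F x (k *\<^sub>R u) = p \<bullet> f\<^sub>0 x + (\<Sum>i=1..d. k ^ i * A i)" for k
    by (simp add: poly_dynamics_def A_def inner_add_right inner_sum_right mpower_scaleR sum_distrib_left mult.assoc)
  show ?thesis
  \<comment> \<open>a negative degree-\<open>d\<close> part wins after scaling \<open>u\<close> up; otherwise the control 0 already works\<close>
  proof (cases "A d + p\<^sub>0 * M\<^sub>1 x u < 0")
    case True
    \<comment> \<open>The cost \<open>M\<^sub>1\<close> is counted as a part of degree
      \<open>d\<close>: the growth hypothesis bounds it at the scaled control by
      \<open>k ^ d\<close> times its value at \<open>u\<close>, and \<open>p\<^sub>0 >= 0\<close>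
      preserves the inequality.\<close>
    obtain k where k: "1 \<le> k"
      "p \<bullet> f\<^sub>0 x + p\<^sub>0 * M\<^sub>0 x + (\<Sum>i=1..d. k ^ i * A i) + k ^ d * (p\<^sub>0 * M\<^sub>1 x u) < 0"
      by (rule polynomial_eventually_neg[where A = A, OF d True])
    have "p\<^sub>0 * M\<^sub>1 x (k *\<^sub>R u) \<le> k ^ d * (p\<^sub>0 * M\<^sub>1 x u)"
      using mult_left_mono[OF M\<^sub>1_scale[OF k(1)] p\<^sub>0] by (simp add: mult_ac)
    then have "p \<bullet> poly_dynamics d f\<^sub>0 F x (k *\<^sub>R u) + p\<^sub>0 * l x (k *\<^sub>R u) < 0"
      using k(2) unfolding scaled l by (simp add: algebra_simps)
    then show ?thesis unfolding hamiltonian_neg_iff by blast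
  next
    case False
    then have "p \<bullet> poly_dynamics d f\<^sub>0 F x 0 + p\<^sub>0 * l x 0 < 0"
      using max by (simp add: poly_dynamics_0 l M\<^sub>1_0)
    then show ?thesis unfolding hamiltonian_neg_iff by blast
  qed
qed

theorem theorem4p7:
  fixes \<Omega> C :: "(real ^ 'n) set"
    and d :: nat
    and f\<^sub>0 :: "real ^ 'n \<Rightarrow> real ^ 'n"
    and F :: "nat ^ 'm \<Rightarrow> real ^ 'n \<Rightarrow> real ^ 'n"
    and l M\<^sub>1 :: "real ^ 'n \<Rightarrow> real ^ 'm \<Rightarrow> real"
    and M\<^sub>0 W :: "real ^ 'n \<Rightarrow> real"
    and p\<^sub>0 :: real
  assumes "open \<Omega>"
    and "closed C" "C \<subseteq> \<Omega>" "C \<noteq> {}" "compact (frontier C)"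
    and "d \<ge> 1"
    and "continuous_on \<Omega> f\<^sub>0"
    and "\<And>\<alpha>. 1 \<le> mdegree \<alpha> \<Longrightarrow> mdegree \<alpha> \<le> d \<Longrightarrow> continuous_on \<Omega> (F \<alpha>)"
    and "\<And>x u. x \<in> \<Omega> \<Longrightarrow> l x u = M\<^sub>0 x + M\<^sub>1 x u"
    and "continuous_on \<Omega> M\<^sub>0" "\<And>x. x \<in> \<Omega> \<Longrightarrow> 0 \<le> M\<^sub>0 x"
    and "continuous_on (\<Omega> \<times> UNIV) (\<lambda>(x, u). M\<^sub>1 x u)" "\<And>x u. x \<in> \<Omega> \<Longrightarrow> 0 \<le> M\<^sub>1 x u"
    and "\<And>x. x \<in> \<Omega> - C \<Longrightarrow> M\<^sub>1 x 0 = 0"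
    and "\<And>k x u. 1 \<le> k \<Longrightarrow> x \<in> \<Omega> - C \<Longrightarrow> M\<^sub>1 x (k *\<^sub>R u) \<le> k ^ d * M\<^sub>1 x u"
    and "0 \<le> p\<^sub>0"
    and "min_restraint_function p\<^sub>0 UNIV l (max_degree_dynamics d f\<^sub>0 F) C \<Omega> W"
  shows "min_restraint_function p\<^sub>0 UNIV l (poly_dynamics d f\<^sub>0 F) C \<Omega> W \<and>
    (\<Omega> = UNIV \<longrightarrow> globally_asymp_controllable (poly_dynamics d f\<^sub>0 F) UNIV C \<Omega>) \<and>
    (\<forall>Z. closed Z \<and> Z \<subseteq> \<Omega> \<longrightarrow>
       asymp_controllable_from Z (poly_dynamics d f\<^sub>0 F) UNIV C \<Omega>) \<and>
    (p\<^sub>0 > 0 \<longrightarrow> (\<forall>z\<in>\<Omega> - C.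
       value_function l (poly_dynamics d f\<^sub>0 F) UNIV C \<Omega> z \<le> ennreal (W z / p\<^sub>0)))"
proof -
  have ham: "hamiltonian UNIV l (poly_dynamics d f\<^sub>0 F) x p\<^sub>0 p < 0"
    if x: "x \<in> \<Omega> - C" and p: "p \<in> limiting_gradients (\<Omega> - C) W x" for x p
  proof (rule hamiltonian_neg_of_max_degree[where M\<^sub>0 = M\<^sub>0 and M\<^sub>1 = M\<^sub>1, OF assms(6,16)])
    show "hamiltonian UNIV l (max_degree_dynamics d f\<^sub>0 F) x p\<^sub>0 p < 0"
      using assms(17) x p unfolding min_restraint_function_def by blast
  qed (use assms(9,14,15) x in auto)
  \<comment> \<open>Among the defining conditions only the Hamiltonian one refers to the
    dynamics.\<close>
  have mrf: "min_restraint_function p\<^sub>0 UNIV l (poly_dynamics d f\<^sub>0 F) C \<Omega> W"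
    using assms(17) ham unfolding min_restraint_function_def by simp
  have "continuous_on (\<Omega> \<times> UNIV) (\<lambda>(x, u). M\<^sub>0 x + M\<^sub>1 x u)"
  proof -
    have "continuous_on (\<Omega> \<times> UNIV) (\<lambda>z. M\<^sub>0 (fst z))"
      by (rule continuous_on_compose2[OF assms(10)]) (auto intro!: continuous_intros)
    from continuous_on_add[OF this assms(12)] show ?thesis by (simp add: case_prod_unfold)
  qed
  then have l_cont: "continuous_on (\<Omega> \<times> UNIV) (\<lambda>(x, u). l x u)"
    by (rule continuous_on_eq) (auto simp: assms(9))
  interpret restraint_problem \<Omega> C "poly_dynamics d f\<^sub>0 F" l W p\<^sub>0
  proof
    show "continuous_on ((\<Omega> - C) \<times> UNIV) (\<lambda>(x, u). poly_dynamics d f\<^sub>0 F x u)"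
      by (rule continuous_on_subset[OF continuous_on_poly_dynamics[OF assms(7,8)]]) auto
    show "continuous_on ((\<Omega> - C) \<times> UNIV) (\<lambda>(x, u). l x u)"
      by (rule continuous_on_subset[OF l_cont]) auto
    show "0 \<le> l x u" if "x \<in> \<Omega> - C" for x u
      using that assms(9,11,13) by simp
  qed (use assms mrf in auto)
  \<comment> \<open>Global controllability for the whole space is the case
    \<open>Z = \<Omega>\<close>, which is then closed.\<close>
  show ?thesis
    using mrf asymp_controllable_from_closed value_function_le
    unfolding globally_asymp_controllable_def by auto
qed

end
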